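(* The constant $$S=\inf\Big\{\frac{\mathcal{E}(u,u)}{\|u\|_{L^{2^*_\alpha}(\mathbb{R}^N)}^2}: u\in\dot H^{\frac\alpha2}(\mathbb{R}^N),\ u\neq 0\Big\}$$ is attained, that is, there exists $u_*\in\dot H^{\frac\alpha2}(\mathbb{R}^N)$, $u_*\neq0$, such that $$\mathcal{E}(u_*,u_* )=S\,\|u_*\|_{L^{2^*_\alpha}(\mathbb{R}^N)}^2.$$
   Context: Let $N\ge 2$, $0<\alpha<2$ and $2^*_\alpha=\frac{2N}{N-\alpha}$. Let $\mu$ be a nonnegative Borel measure on the unit sphere $\mathbb{S}^{N-1}$ (the spectral measure) that is finite, $\mu(\mathbb{S}^{N-1})<\infty$, symmetric, $d\mu(\theta)=d\mu(-\theta)$, and non-degenerate: $\inf_{\zeta\in\mathbb{S}^{N-1}}\int_{\mathbb{S}^{N-1}}|\zeta\cdot\theta|^\alpha\,d\mu(\theta)\ge c_0>0$. The energy is $$\mathcal{E}(u,u)=\frac12\int_{\mathbb{R}^N}\int_0^\infty\int_{\mathbb{S}^{N-1}}|u(x)-u(x-r\theta)|^2\,d\mu(\theta)\,\frac{dr}{r^{1+\alpha}}\,dx.$$ $\dot H^{\frac\alpha2}(\mathbb{R}^N)$ is the homogeneous fractional Sobolev space (the completion of $C_c^\infty(\mathbb{R}^N)$ in the norm $\|u\|_{\dot H^{\alpha/2}}=\big(\int|\xi|^\alpha|\hat u(\xi)|^2d\xi\big)^{1/2}$, which is realized as a space of functions in $L^{2^*_\alpha}(\mathbb{R}^N)$);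 under the assumptions on $\mu$, $\mathcal{E}(u,u)^{1/2}$ is an equivalent norm on it. *)

theory Defs
  imports "HOL-Analysis.Analysis"
begin

primrec Ck :: "nat \<Rightarrow> ('a::euclidean_space \<Rightarrow> real) \<Rightarrow> bool" where
  "Ck 0 f \<longleftrightarrow> continuous_on UNIV f"
| "Ck (Suc k) f \<longleftrightarrow> (\<forall>x. f differentiable (at x)) \<and>
     (\<forall>b\<in>Basis. Ck k (\<lambda>x. frechet_derivative f (at x) b))"

definition test_functions :: "('a::euclidean_space \<Rightarrow> real) set" where
  "test_functions = {f. (\<forall>k. Ck k f) \<and> compact (closure {x. f x \<noteq> 0})}"

definition fourier :: "('a::euclidean_space \<Rightarrow> real) \<Rightarrow> 'a \<Rightarrow> complex" where
  "fourier f \<xi> = (LINT x|lborel. cis (- (\<xi> \<bullet> x)) * of_real (f x))"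

(* Only applied to test functions, whose Fourier transform decays rapidly, so that the
   integral converges. *)
definition hdot_norm :: "real \<Rightarrow> ('a::euclidean_space \<Rightarrow> real) \<Rightarrow> real" where
  "hdot_norm \<alpha> f = sqrt (LINT \<xi>|lborel. norm \<xi> powr \<alpha> * (cmod (fourier f \<xi>))\<^sup>2)"

definition crit_exponent :: "nat \<Rightarrow> real \<Rightarrow> real" where
  "crit_exponent N \<alpha> = 2 * real N / (real N - \<alpha>)"

(* Elements are Borel representatives, not classes modulo null sets. *)
definition Lp_functions :: "real \<Rightarrow> ('a::euclidean_space \<Rightarrow> real) set" where
  "Lp_functions p =
     {u. u \<in> borel_measurable borel \<and> integrable lborel (\<lambda>x. \<bar>u x\<bar> powr p)}"

definition Lp_norm :: "real \<Rightarrow> ('a::euclidean_space \<Rightarrow> real) \<Rightarrow> real" where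
  "Lp_norm p u = (LINT x|lborel. \<bar>u x\<bar> powr p) powr (1 / p)"

(* The completion of the test functions under the norm hdot_norm, realized in the Lebesgue space
   with the critical exponent: by the Sobolev inequality a sequence of test functions that is
   Cauchy for hdot_norm converges there, and its limit represents its class in the completion. *)
definition hdot_space :: "real \<Rightarrow> ('a::euclidean_space \<Rightarrow> real) set" where
  "hdot_space \<alpha> = {u. u \<in> Lp_functions (crit_exponent DIM('a) \<alpha>) \<and>
     (\<exists>\<phi>::nat \<Rightarrow> 'a \<Rightarrow> real.
        (\<forall>n. \<phi> n \<in> test_functions) \<and>
        (\<forall>\<epsilon>>0. \<exists>M. \<forall>m\<ge>M. \<forall>n\<ge>M. hdot_norm \<alpha> (\<lambda>x. \<phi> m x - \<phi> n x) < \<epsilon>) \<and>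
        (\<lambda>n. Lp_norm (crit_exponent DIM('a) \<alpha>) (\<lambda>x. \<phi> n x - u x)) \<longlonglongrightarrow> 0)}"

definition nonzero_hdot :: "real \<Rightarrow> ('a::euclidean_space \<Rightarrow> real) set" where
  "nonzero_hdot \<alpha> = {u \<in> hdot_space \<alpha>. \<not> (AE x in lborel. u x = 0)}"

definition energy :: "'a::euclidean_space measure \<Rightarrow> real \<Rightarrow> ('a \<Rightarrow> real) \<Rightarrow> ennreal" where
  "energy \<mu> \<alpha> u =
     (\<integral>\<^sup>+x. (\<integral>\<^sup>+r\<in>{0<..}. (\<integral>\<^sup>+\<theta>. ennreal (\<bar>u x - u (x - r *\<^sub>R \<theta>)\<bar>\<^sup>2) \<partial>\<mu>)
        / ennreal (r powr (1 + \<alpha>)) \<partial>lborel) \<partial>lborel) / 2"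

definition best_constant :: "'a::euclidean_space measure \<Rightarrow> real \<Rightarrow> ennreal" where
  "best_constant \<mu> \<alpha> =
     (INF u\<in>nonzero_hdot \<alpha>. energy \<mu> \<alpha> u / ennreal ((Lp_norm (crit_exponent DIM('a) \<alpha>) u)\<^sup>2))"

end

theory Submission
  imports Defs "HOL-Probability.Probability" "HOL-Library.Diagonal_Subsequence"
begin

text \<open>
  Non-degeneracy makes the support of \<open>\<mu>\<close> span the space, so every \<open>u\<close> admits a uniformly non-degenerate frame
  \<open>\<theta>\<^sub>1, \<dots>, \<theta>\<^sub>N\<close> along which its one-dimensional energies are bounded by a multiple of the full energy. Comparing
  \<open>u(x)\<close> with averages of \<open>u\<close> over the parallelepipeds spanned by \<open>t\<theta>\<^sub>1, \<dots>, t\<theta>\<^sub>N\<close> and optimising in \<open>t\<close> as in Hedberg's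
  argument gives a refined Sobolev inequality: the critical norm is controlled by the energy and the Morrey quantity
  \<open>sup t\<^sup>\<beta> \<integral> |u(x - ty)|\<^sup>2 dy\<close>, the integral being over a fixed ball and \<open>\<beta> = N - \<alpha>\<close>. A normalised minimising sequence
  therefore keeps, after translation and the critical scaling \<open>t\<^bsup>\<beta>/2\<^esup> u(x - ty)\<close>, a fixed amount of \<open>L\<^sup>2\<close> mass on that
  ball, and local compactness yields a nonzero limit \<open>w\<close>. By Brezis--Lieb for the energy and for the critical norm both
  split between \<open>w\<close> and the remainder; since \<open>s \<mapsto> s\<^bsup>p/2\<^esup>\<close> is strictly superadditive for the critical exponent
  \<open>p > 2\<close>, \<open>w\<close> is a minimiser. Plancherel's identity compares the energy with the homogeneous Sobolev norm, which
  places \<open>w\<close> in the homogeneous space.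
\<close>

section \<open>Test functions\<close>

text \<open>The spectral measure may be singular, for instance a finite sum of point masses, so the
  energy sees increments only along its own directions and no pointwise comparison with an isotropic
  kernel is available. This is why frames appear: N independent directions rebuild every
  translation, and choosing them afresh for each u, inside small balls of positive measure, keeps
  all constants uniform. The exponents fit because \<beta> = N - \<alpha> gives p = 2 +
  2\<alpha>/\<beta>, the very power that the optimisation in t produces.

  The second obstacle is the space: its elements are limits of test functions that are Cauchy in the
  Fourier norm, whereas compactness yields only an almost everywhere limit w. Midpoints taken in the
  tails of the sequence provide a sequence of test functions that is Cauchy in energy and still
  tends to w; Fatou's lemma then carries inequalities from test functions to w and to the
  remainders. The limit is compared with the best constant at its own mass A, since the quotient is
  homogeneous.\<close>

lemma Ck_Suc_imp: "Ck (Suc k) f \<Longrightarrow> Ck k f"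
proof (induction k arbitrary: f)
  case 0
  then show ?case by (auto intro!: differentiable_imp_continuous_on simp: differentiable_on_def differentiable_at_withinI)
next
  case (Suc k)
  then show ?case by (metis Ck.simps(2))
qed

lemma frechet_derivative_unique: "(f has_derivative f') (at x) \<Longrightarrow> frechet_derivative f (at x) = f'"
  by (rule frechet_derivative_at[symmetric])

text \<open>Any explicit derivative may be supplied; by uniqueness it is the one chosen by
  \<open>frechet_derivative\<close>. The sum, product and chain rules can then be used in their
  ordinary form.\<close>

lemma Ck_SucI:
  assumes "\<And>x. (f has_derivative f' x) (at x)" "\<And>b. b \<in> Basis \<Longrightarrow> Ck k (\<lambda>x. f' x b)"
  shows "Ck (Suc k) f"
  using assms by (auto simp: differentiable_def frechet_derivative_unique[OF assms(1)])

lemma Ck_SucD: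
  assumes "Ck (Suc k) f"
  shows "(f has_derivative frechet_derivative f (at x)) (at x)"
    and "b \<in> Basis \<Longrightarrow> Ck k (\<lambda>x. frechet_derivative f (at x) b)"
  using assms by (auto simp: frechet_derivative_works)

lemma Ck_const: "Ck k (\<lambda>x. c)"
proof (induction k arbitrary: c)
  case (Suc k)
  show ?case by (rule Ck_SucI[where f'="\<lambda>x h. 0"]) (use Suc in auto)
qed auto

lemma Ck_add: "Ck k f \<Longrightarrow> Ck k g \<Longrightarrow> Ck k (\<lambda>x. f x + g x)"
proof (induction k arbitrary: f g)
  case 0 then show ?case by (auto intro: continuous_intros)
next
  case (Suc k)
  show ?case
    by (rule Ck_SucI[OF has_derivative_add[OF Ck_SucD(1)[OF Suc.prems(1)] Ck_SucD(1)[OF Suc.prems(2)]]])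
       (intro Suc.IH Ck_SucD(2)[OF Suc.prems(1)] Ck_SucD(2)[OF Suc.prems(2)])
qed

lemma Ck_mult: "Ck k f \<Longrightarrow> Ck k g \<Longrightarrow> Ck k (\<lambda>x. f x * g x)"
proof (induction k arbitrary: f g)
  case 0 then show ?case by (auto intro: continuous_intros)
next
  case (Suc k)
  show ?case
    by (rule Ck_SucI[OF has_derivative_mult[OF Ck_SucD(1)[OF Suc.prems(1)] Ck_SucD(1)[OF Suc.prems(2)]]])
       (intro Ck_add Suc.IH Ck_SucD(2)[OF Suc.prems(1)] Ck_SucD(2)[OF Suc.prems(2)] Suc.prems[THEN Ck_Suc_imp])
qed

lemma Ck_affine: "Ck k f \<Longrightarrow> Ck k (\<lambda>x. f (c + s *\<^sub>R x))"
proof (induction k arbitrary: f)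
  case 0
  then have "continuous_on UNIV f" by simp
  moreover have "continuous_on UNIV (\<lambda>x. c + s *\<^sub>R x)" by (intro continuous_intros)
  ultimately show ?case using continuous_on_compose2[of UNIV f UNIV "\<lambda>x. c + s *\<^sub>R x"] by simp
next
  case (Suc k)
  note d = Ck_SucD(1)[OF Suc.prems]
  show ?case
  proof (rule Ck_SucI)
    fix x
    show "((\<lambda>x. f (c + s *\<^sub>R x)) has_derivative (\<lambda>h. frechet_derivative f (at (c + s *\<^sub>R x)) (s *\<^sub>R h))) (at x)"
      by (rule has_derivative_compose[OF _ d]) (auto intro!: derivative_eq_intros)
  next
    fix b :: 'a assume b: "b \<in> Basis"
    have "frechet_derivative f (at x) (s *\<^sub>R b) = s * frechet_derivative f (at x) b" for x
      using linear_cmul[OF has_derivative_linear[OF d]] by auto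
    then show "Ck k (\<lambda>x. frechet_derivative f (at (c + s *\<^sub>R x)) (s *\<^sub>R b))"
      by (auto intro!: Ck_mult Ck_const Suc.IH[of "\<lambda>x. frechet_derivative f (at x) b"] Ck_SucD(2)[OF Suc.prems] b)
  qed
qed

lemma Ck_inner: "Ck k (\<lambda>x. x \<bullet> b)"
proof (cases k)
  case (Suc m)
  show ?thesis unfolding Suc by (rule Ck_SucI[where f'="\<lambda>x h. h \<bullet> b"]) (auto intro!: derivative_eq_intros Ck_const)
qed (auto intro!: continuous_intros)

lemma test_functionsI:
  fixes f :: "'a::euclidean_space \<Rightarrow> real"
  assumes "\<And>k. Ck k f" "\<And>x. f x \<noteq> 0 \<Longrightarrow> norm x \<le> R"
  shows "f \<in> test_functions"
proof -
  have "bounded {x. f x \<noteq> 0}" using assms by (auto simp: bounded_iff)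
  then show ?thesis using assms by (auto simp: test_functions_def)
qed

lemma test_functions_support:
  assumes "f \<in> test_functions"
  obtains R where "R > 0" "\<And>x. norm x \<ge> R \<Longrightarrow> f x = 0"
proof -
  have "bounded (closure {x. f x \<noteq> 0})" using assms by (auto simp: test_functions_def compact_imp_bounded)
  then have "bounded {x. f x \<noteq> 0}" by (rule bounded_subset[OF _ closure_subset])
  then obtain R where "\<forall>x\<in>{x. f x \<noteq> 0}. norm x < R" unfolding bounded_pos_less by blast
  then have "norm x \<ge> max R 1 \<Longrightarrow> f x = 0" for x by force
  then show ?thesis by (intro that[of "max R 1"]) auto
qed

lemma test_functions_Ck: "f \<in> test_functions \<Longrightarrow> Ck k f"
  by (auto simp: test_functions_def)

lemma test_functions_add:
  assumes "f \<in> test_functions" "g \<in> test_functions"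
  shows "(\<lambda>x. f x + g x) \<in> test_functions"
proof -
  obtain R where R: "R > 0" "\<And>x. norm x \<ge> R \<Longrightarrow> f x = 0" using test_functions_support[OF assms(1)] by metis
  obtain S where S: "S > 0" "\<And>x. norm x \<ge> S \<Longrightarrow> g x = 0" using test_functions_support[OF assms(2)] by metis
  have "norm x \<le> R + S" if "f x + g x \<noteq> 0" for x
    using R(2)[of x] S(2)[of x] R(1) S(1) that by (cases "norm x \<ge> R"; cases "norm x \<ge> S") auto
  then show ?thesis by (rule test_functionsI[OF Ck_add[OF assms[THEN test_functions_Ck]]])
qed

lemma test_functions_affine:
  assumes "f \<in> test_functions" "s \<noteq> 0"
  shows "(\<lambda>x. c * f (y + s *\<^sub>R x)) \<in> test_functions"
proof -
  obtain R where R: "R > 0" "\<And>x. norm x \<ge> R \<Longrightarrow> f x = 0" using test_functions_support[OF assms(1)] by metis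
  have "norm x \<le> (R + norm y) / \<bar>s\<bar>" if "c * f (y + s *\<^sub>R x) \<noteq> 0" for x
  proof -
    have "norm (y + s *\<^sub>R x) < R" using R(2)[of "y + s *\<^sub>R x"] that by force
    then have "norm (s *\<^sub>R x) \<le> R + norm y" using norm_triangle_ineq4[of "y + s *\<^sub>R x" y] by simp
    then show ?thesis using assms(2) by (simp add: field_simps)
  qed
  then show ?thesis by (rule test_functionsI[OF Ck_mult[OF Ck_const Ck_affine[OF test_functions_Ck[OF assms(1)]]]])
qed

lemma test_functions_cmult: "f \<in> test_functions \<Longrightarrow> (\<lambda>x. c * f x) \<in> test_functions"
  using test_functions_affine[of f 1 c 0] by simp

lemma test_functions_diff:
  "f \<in> test_functions \<Longrightarrow> g \<in> test_functions \<Longrightarrow> (\<lambda>x. f x - g x) \<in> test_functions"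
  using test_functions_add[of f "\<lambda>x. -1 * g x"] test_functions_cmult[of g "-1"] by simp

lemma test_functions_continuous: "f \<in> test_functions \<Longrightarrow> continuous_on UNIV f"
  using test_functions_Ck[of f 0] by simp

lemma continuous_zero_outside_bounded:
  fixes f :: "'a::euclidean_space \<Rightarrow> real"
  assumes "continuous_on UNIV f" "\<And>x. norm x \<ge> R \<Longrightarrow> f x = 0"
  obtains B where "B > 0" "\<And>x. \<bar>f x\<bar> \<le> B"
proof -
  have "bounded (f ` cball 0 R)"
    by (intro compact_imp_bounded compact_continuous_image continuous_on_subset[OF assms(1)]) auto
  then obtain B where B: "B > 0" "\<And>x. x \<in> cball 0 R \<Longrightarrow> \<bar>f x\<bar> \<le> B"
    unfolding bounded_pos by (metis imageI real_norm_def)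
  then have "\<bar>f x\<bar> \<le> B" for x using assms(2)[of x] B(2)[of x] B(1) by (cases "norm x \<le> R") simp_all
  then show ?thesis using B that by blast
qed

text \<open>The partial derivatives are continuous and vanish far out, hence are bounded; the mean
  value inequality then gives one global constant. It makes the energy integrand of order r^2 near r
  = 0.\<close>

lemma test_functions_Lipschitz:
  fixes f :: "'a::euclidean_space \<Rightarrow> real"
  assumes "f \<in> test_functions"
  obtains B where "B > 0" "\<And>x y. \<bar>f x - f y\<bar> \<le> B * norm (x - y)"
proof -
  obtain R where R: "R > 0" "\<And>x. norm x \<ge> R \<Longrightarrow> f x = 0" using test_functions_support[OF assms(1)] by metis
  note d = Ck_SucD[OF test_functions_Ck[OF assms, of 1, unfolded One_nat_def]]
  \<comment> \<open>The margin 1 puts \<open>x\<close> in the open complement of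
    \<open>cball 0 R\<close>, so that \<open>f\<close> is 0 on a whole neighbourhood of
    \<open>x\<close>.\<close>
  have z: "frechet_derivative f (at x) b = 0" if "norm x \<ge> R + 1" for x b
  proof -
    have "(f has_derivative (\<lambda>h. 0)) (at x)"
    proof (rule has_derivative_transform_within_open[of "\<lambda>x. 0"])
      show "open (- cball (0::'a) R)" by auto
    qed (use that R in auto)
    then show ?thesis by (simp add: frechet_derivative_unique)
  qed
  have "\<exists>B. \<forall>b\<in>Basis. \<forall>x. \<bar>frechet_derivative f (at x) b\<bar> \<le> B b"
  proof (intro bchoice ballI)
    fix b :: 'a assume b: "b \<in> Basis"
    have "continuous_on UNIV (\<lambda>x. frechet_derivative f (at x) b)" using d(2)[OF b] by simp
    from continuous_zero_outside_bounded[OF this z]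
    show "\<exists>B. \<forall>x. \<bar>frechet_derivative f (at x) b\<bar> \<le> B" by metis
  qed
  then obtain B where B: "\<And>b x. b \<in> Basis \<Longrightarrow> \<bar>frechet_derivative f (at x) b\<bar> \<le> B b" by auto
  define L where "L = (\<Sum>b\<in>Basis. \<bar>B b\<bar>)"
  have on: "onorm (frechet_derivative f (at x)) \<le> L" for x
  proof (rule onorm_le)
    fix h :: 'a
    have lin: "linear (frechet_derivative f (at x))" using has_derivative_linear[OF d(1)] .
    have "frechet_derivative f (at x) h = frechet_derivative f (at x) (\<Sum>b\<in>Basis. (h \<bullet> b) *\<^sub>R b)"
      by (simp add: euclidean_representation)
    also have "\<dots> = (\<Sum>b\<in>Basis. (h \<bullet> b) * frechet_derivative f (at x) b)"
      by (simp add: linear_sum[OF lin] linear_cmul[OF lin])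
    also have "norm \<dots> \<le> (\<Sum>b\<in>Basis. norm h * \<bar>B b\<bar>)"
      by (rule sum_norm_le) (auto simp: abs_mult intro!: mult_mono Basis_le_norm order_trans[OF B])
    finally show "norm (frechet_derivative f (at x) h) \<le> L * norm h"
      by (simp add: L_def sum_distrib_left mult.commute)
  qed
  have lip: "\<bar>f x - f y\<bar> \<le> L * norm (x - y)" for x y
    using differentiable_bound[of UNIV f "\<lambda>x. frechet_derivative f (at x)" L x y] d(1) on by auto
  have "L \<ge> 0" by (auto simp: L_def intro: sum_nonneg)
  have "\<bar>f x - f y\<bar> \<le> (L + 1) * norm (x - y)" for x y
    using lip[of x y] by (simp add: algebra_simps add_increasing)
  then show ?thesis using that[of "L + 1"] \<open>L \<ge> 0\<close> by auto
qed

section \<open>A smooth bump with compact support\<close>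

definition bump_aux :: "nat \<Rightarrow> real \<Rightarrow> real" where
  "bump_aux m t = (if t > 0 then inverse t ^ m * exp (- inverse t) else 0)"

lemma bump_aux_lim: "((\<lambda>t. inverse t ^ m * exp (- inverse t)) \<longlongrightarrow> (0::real)) (at_right 0)"
proof -
  have "((\<lambda>x::real. x ^ m / exp x) \<longlongrightarrow> 0) at_top" by (rule tendsto_power_div_exp_0)
  then have "((\<lambda>t::real. inverse t ^ m / exp (inverse t)) \<longlongrightarrow> 0) (at_right 0)"
    by (rule filterlim_compose[OF _ filterlim_inverse_at_top_right])
  then show ?thesis by (simp add: exp_minus divide_inverse)
qed

text \<open>The functions t^(-m) exp(-1/t), extended by 0, are closed under differentiation up to
  linear combinations. Carrying all m along lets a single induction on the order prove smoothness.
  Only t = 0 needs an argument: the exponential beats every power of 1/t.\<close>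

lemma bump_aux_deriv:
  "(bump_aux m has_real_derivative (bump_aux (m + 2) t - of_nat m * bump_aux (m + 1) t)) (at t)"
proof -
  consider "t > 0" | "t < 0" | "t = 0" by linarith
  then show ?thesis
  proof cases
    case 1
    define y where "y = inverse t"
    have i: "(inverse has_real_derivative - (y ^ 2)) (at t)"
      using 1 DERIV_inverse[of t] by (simp add: y_def power2_eq_square)
    have p: "((\<lambda>t. inverse t ^ m) has_real_derivative of_nat m * y ^ (m - 1) * (- (y ^ 2))) (at t)"
      using DERIV_power[OF i, of m] by (simp add: y_def mult_ac)
    have e: "((\<lambda>t. exp (- inverse t)) has_real_derivative exp (- y) * (y ^ 2)) (at t)"
      using DERIV_fun_exp[OF DERIV_minus[OF i]] by (simp add: y_def)
    have "of_nat m * y ^ (m - 1) * (- (y ^ 2)) * exp (- y) + exp (- y) * (y ^ 2) * y ^ m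
        = bump_aux (m + 2) t - of_nat m * bump_aux (m + 1) t"
      using 1 by (cases m) (simp_all add: bump_aux_def y_def[symmetric] algebra_simps power2_eq_square)
    with DERIV_mult[OF p e]
    have d: "((\<lambda>t. inverse t ^ m * exp (- inverse t)) has_real_derivative (bump_aux (m + 2) t - of_nat m * bump_aux (m + 1) t)) (at t)"
      by (simp add: y_def)
    have "(\<forall>\<^sub>F x in nhds t. bump_aux m x = inverse x ^ m * exp (- inverse x))"
      unfolding eventually_nhds using 1 by (intro exI[of _ "{0<..}"]) (auto simp: bump_aux_def)
    from DERIV_cong_ev[OF refl this refl] d show ?thesis by simp
  next
    case 2
    have "(\<forall>\<^sub>F x in nhds t. bump_aux m x = 0)"
      unfolding eventually_nhds using 2 by (intro exI[of _ "{..<0}"]) (auto simp: bump_aux_def)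
    from DERIV_cong_ev[OF refl this refl] have "(bump_aux m has_real_derivative 0) (at t)" by simp
    moreover have "bump_aux (m + 2) t - of_nat m * bump_aux (m + 1) t = 0" using 2 by (simp add: bump_aux_def)
    ultimately show ?thesis by simp
  next
    case 3
    have "((\<lambda>h. (bump_aux m (0 + h) - bump_aux m 0) / h) \<longlongrightarrow> 0) (at 0)"
    proof (subst filterlim_at_split, intro conjI)
      show "((\<lambda>h. (bump_aux m (0 + h) - bump_aux m 0) / h) \<longlongrightarrow> 0) (at_left 0)"
        by (rule tendsto_eventually) (auto simp: eventually_at_filter bump_aux_def)
      \<comment> \<open>Dividing by \<open>h\<close> raises the exponent by one, hence the limit is
        taken at \<open>Suc m\<close>.\<close>
      show "((\<lambda>h. (bump_aux m (0 + h) - bump_aux m 0) / h) \<longlongrightarrow> 0) (at_right 0)"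
        by (rule Lim_transform_eventually[OF bump_aux_lim[of "Suc m"]])
           (auto simp: eventually_at_filter bump_aux_def divide_inverse)
    qed
    then show ?thesis using 3 by (auto simp: DERIV_def bump_aux_def)
  qed
qed

text \<open>The inner function is the polynomial 1 - |x|^2 rather than 1 - |x|, which is
  differentiable at the origin as well.\<close>

lemma Ck_bump_aux: "Ck k (\<lambda>x::'a::euclidean_space. bump_aux m (1 - x \<bullet> x))"
proof (induction k arbitrary: m)
  case 0
  have "continuous_on UNIV (bump_aux m)"
    using bump_aux_deriv by (intro DERIV_continuous_on) (blast intro: has_field_derivative_at_within)
  moreover have "continuous_on UNIV (\<lambda>x::'a. 1 - x \<bullet> x)" by (intro continuous_intros)
  ultimately show ?case using continuous_on_compose2[of UNIV "bump_aux m" UNIV "\<lambda>x::'a. 1 - x \<bullet> x"] by simp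
next
  case (Suc k)
  let ?d = "\<lambda>x::'a. bump_aux (m + 2) (1 - x \<bullet> x) - of_nat m * bump_aux (m + 1) (1 - x \<bullet> x)"
  show ?case
  proof (rule Ck_SucI)
    fix x :: 'a
    have "((\<lambda>x. 1 - x \<bullet> x) has_derivative (\<lambda>h. - 2 * (x \<bullet> h))) (at x)"
      by (auto intro!: derivative_eq_intros simp: inner_commute)
    from has_derivative_compose[OF this bump_aux_deriv[unfolded has_field_derivative_def]]
    show "((\<lambda>x. bump_aux m (1 - x \<bullet> x)) has_derivative (\<lambda>h. ?d x * (- 2 * (x \<bullet> h)))) (at x)" .
  next
    fix b :: 'a
    have "Ck k (\<lambda>x. (bump_aux (m + 2) (1 - x \<bullet> x) + (- of_nat m) * bump_aux (m + 1) (1 - x \<bullet> x)) * (- 2 * (x \<bullet> b)))"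
      by (intro Ck_mult Ck_add Ck_const Ck_inner Suc.IH)
    then show "Ck k (\<lambda>x. ?d x * (- 2 * (x \<bullet> b)))" by simp
  qed
qed

lemma ex_test_function:
  obtains f :: "'a::euclidean_space \<Rightarrow> real" where "f \<in> test_functions" "f 0 \<noteq> 0"
proof (rule that)
  show "(\<lambda>x::'a. bump_aux 0 (1 - x \<bullet> x)) \<in> test_functions"
  proof (rule test_functionsI[OF Ck_bump_aux])
    fix x :: 'a assume "bump_aux 0 (1 - x \<bullet> x) \<noteq> 0"
    then have "x \<bullet> x < 1" by (auto simp: bump_aux_def split: if_splits)
    then show "norm x \<le> 1" by (simp add: norm_eq_sqrt_inner)
  qed
qed (auto simp: bump_aux_def)

section \<open>Gaussians and the Plancherel identity\<close>

lemma measurable_cis[measurable]: "cis \<in> borel_measurable borel"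
  by (intro borel_measurable_continuous_onI continuous_on_cis continuous_on_id)

text \<open>Read off from the characteristic function of the standard normal distribution by undoing
  its normalisation \<open>sqrt (2 * pi)\<close>.\<close>

lemma lborel_char_gaussian_real:
  "integrable lborel (\<lambda>x::real. cis (a * x) * of_real (exp (- x\<^sup>2 / 2)))"
  "(LINT x|lborel. cis (a * x) * of_real (exp (- x\<^sup>2 / 2))) = of_real (sqrt (2 * pi) * exp (- a\<^sup>2 / 2))"
proof -
  have g: "integrable lborel (\<lambda>x::real. exp (- x\<^sup>2 / 2))"
  proof -
    have "integrable lborel (\<lambda>x::real. sqrt (2 * pi) * std_normal_density x)"
      using integrable_normal_density[of 1 0] by simp
    then show ?thesis by (simp add: std_normal_density_def)
  qed
  show "integrable lborel (\<lambda>x::real. cis (a * x) * of_real (exp (- x\<^sup>2 / 2)))"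
    by (rule Bochner_Integration.integrable_bound[OF g]) (auto simp: norm_mult)
  have "complex_of_real (exp (- a\<^sup>2 / 2)) = char std_normal_distribution a"
    by (simp add: char_std_normal_distribution)
  also have "\<dots> = (LINT x|lborel. std_normal_density x *\<^sub>R iexp (a * x))"
    unfolding char_def by (subst integral_density) (auto simp: normal_density_nonneg)
  also have "\<dots> = (LINT x|lborel. of_real (1 / sqrt (2 * pi)) * (cis (a * x) * of_real (exp (- x\<^sup>2 / 2))))"
    by (intro Bochner_Integration.integral_cong refl)
       (simp add: std_normal_density_def cis_conv_exp scaleR_conv_of_real mult_ac)
  also have "\<dots> = of_real (1 / sqrt (2 * pi)) * (LINT x|lborel. cis (a * x) * of_real (exp (- x\<^sup>2 / 2)))"
    by (rule integral_mult_right_zero)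
  finally show "(LINT x|lborel. cis (a * x) * of_real (exp (- x\<^sup>2 / 2))) = of_real (sqrt (2 * pi) * exp (- a\<^sup>2 / 2))"
    by (simp add: field_simps)
qed

lemma norm_sum_Basis_sq: "(norm (\<Sum>b\<in>Basis. f b *\<^sub>R b :: 'a::euclidean_space))\<^sup>2 = (\<Sum>b\<in>Basis. (f b)\<^sup>2)"
proof -
  have "(norm (\<Sum>b\<in>Basis. f b *\<^sub>R b :: 'a))\<^sup>2 = (\<Sum>b\<in>Basis. ((\<Sum>b\<in>Basis. f b *\<^sub>R b :: 'a) \<bullet> b)\<^sup>2)"
    unfolding power2_norm_eq_inner by (subst euclidean_inner) (simp only: power2_eq_square)
  then show ?thesis by (simp add: inner_sum_left_Basis)
qed

definition gauss :: "'a::euclidean_space \<Rightarrow> real" where "gauss x = exp (- (norm x)\<^sup>2 / 2)"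

lemma gauss_measurable[measurable]: "gauss \<in> borel_measurable borel"
  unfolding gauss_def by measurable

lemma gauss_pos: "gauss x > 0" and gauss_le_1: "gauss x \<le> 1" and gauss_0: "gauss 0 = 1"
  by (auto simp: gauss_def)

lemma gauss_nonneg[simp]: "0 \<le> gauss x" and abs_gauss[simp]: "\<bar>gauss x\<bar> = gauss x"
  by (auto simp: gauss_def)

text \<open>Lebesgue measure is the image of the product of one-dimensional Lebesgue measures over
  \<open>Basis\<close>, and in coordinates the integrand is a product of one-dimensional
  ones.\<close>

lemma gauss_fourier:
  fixes a :: "'a::euclidean_space"
  shows "integrable lborel (\<lambda>x::'a. cis (a \<bullet> x) * of_real (gauss x))" (is ?A)
    and "(LINT x|lborel. cis (a \<bullet> x) * of_real (gauss x)) = of_real ((sqrt (2 * pi)) ^ DIM('a) * gauss a)" (is ?B)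
proof -
  interpret product_sigma_finite "\<lambda>b::'a. lborel :: real measure" ..
  let ?T = "\<lambda>f. \<Sum>b\<in>Basis. f b *\<^sub>R b :: 'a"
  let ?F = "\<lambda>x::'a. cis (a \<bullet> x) * complex_of_real (gauss x)"
  let ?f = "\<lambda>b x. cis ((a \<bullet> b) * x) * complex_of_real (exp (- x\<^sup>2 / 2))"
  let ?P = "Pi\<^sub>M (Basis::'a set) (\<lambda>b. lborel :: real measure)"
  have T[measurable]: "?T \<in> measurable ?P borel" by measurable
  have F[measurable]: "?F \<in> borel_measurable borel" by measurable
  have cisum: "cis (\<Sum>b\<in>A. g b) = (\<Prod>b\<in>A. cis (g b))" for A and g :: "'a \<Rightarrow> real"
    by (induction A rule: infinite_finite_induct) (auto simp: cis_mult[symmetric])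
  have gs: "gauss (?T f) = (\<Prod>b\<in>Basis. exp (- (f b)\<^sup>2 / 2))" for f
    by (simp add: gauss_def norm_sum_Basis_sq exp_sum[symmetric] sum_negf sum_divide_distrib)
  have eq: "?F (?T f) = (\<Prod>b\<in>Basis. ?f b (f b))" for f
    by (simp add: gs inner_sum_right cisum prod.distrib mult.commute of_real_prod)
  have "integrable ?P (\<lambda>f. \<Prod>b\<in>Basis. ?f b (f b))"
    by (rule product_integrable_prod[OF finite_Basis]) (rule lborel_char_gaussian_real(1))
  then show ?A
    by (subst lborel_eq, subst integrable_distr_eq[OF T F]) (simp only: eq)
  have "(LINT x|lborel. ?F x) = integral\<^sup>L ?P (\<lambda>f. \<Prod>b\<in>Basis. ?f b (f b))"
    by (subst lborel_eq, subst integral_distr[OF T F]) (simp only: eq)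
  also have "\<dots> = (\<Prod>b\<in>Basis. LINT x|lborel. ?f b x)"
    by (rule product_integral_prod[OF finite_Basis]) (rule lborel_char_gaussian_real(1))
  also have "\<dots> = (\<Prod>b\<in>Basis. of_real (sqrt (2 * pi) * exp (- (a \<bullet> b)\<^sup>2 / 2)))"
    by (simp only: lborel_char_gaussian_real(2))
  also have "\<dots> = of_real ((sqrt (2 * pi)) ^ DIM('a) * gauss a)"
    using gs[of "\<lambda>b. a \<bullet> b"] by (simp add: prod.distrib euclidean_representation)
  finally show ?B .
qed

lemma gauss_integrable: "integrable lborel (gauss :: 'a::euclidean_space \<Rightarrow> real)"
proof -
  have "integrable lborel (\<lambda>x::'a. complex_of_real (gauss x))"
    using gauss_fourier(1)[of "0::'a"] by simp
  from integrable_norm[OF this] show ?thesis by simp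
qed

lemma gauss_integral: "(LINT x|lborel. gauss (x::'a::euclidean_space)) = (sqrt (2 * pi)) ^ DIM('a)"
proof -
  have "complex_of_real (LINT x|lborel. gauss (x::'a)) = of_real ((sqrt (2 * pi)) ^ DIM('a))"
    using gauss_fourier(2)[of "0::'a"] by (simp add: gauss_0)
  then show ?thesis by (simp only: of_real_eq_iff)
qed

lemma integrable_prod_lborel:
  fixes f :: "'a::euclidean_space \<Rightarrow> real" and g :: "'b::euclidean_space \<Rightarrow> real"
  assumes f: "integrable lborel f" and g: "integrable lborel g"
  shows "integrable (lborel \<Otimes>\<^sub>M lborel) (\<lambda>(x, y). f x * g y)"
proof -
  have [measurable]: "f \<in> borel_measurable borel" "g \<in> borel_measurable borel"
    using borel_measurable_integrable[OF f] borel_measurable_integrable[OF g] by simp_all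
  show ?thesis
    by (rule lborel_pair.Fubini_integrable)
       (use f g in \<open>auto simp: abs_mult intro!: integrable_mult_left integrable_abs\<close>)
qed

lemma lborel_integral_affine:
  fixes f :: "'a::euclidean_space \<Rightarrow> 'b::{banach, second_countable_topology}"
  assumes [measurable]: "f \<in> borel_measurable borel" and c: "c \<noteq> 0"
  shows "(LINT x|lborel. f x) = \<bar>c\<bar> ^ DIM('a) *\<^sub>R (LINT x|lborel. f (t + c *\<^sub>R x))"
  by (subst lborel_affine[OF c, of t]) (simp add: integral_density integral_distr)

lemma nn_integral_lborel_affine:
  fixes f :: "'a::euclidean_space \<Rightarrow> ennreal"
  assumes [measurable]: "f \<in> borel_measurable borel" and c: "c \<noteq> 0"
  shows "(\<integral>\<^sup>+x. f x \<partial>lborel) = ennreal (\<bar>c\<bar> ^ DIM('a)) * (\<integral>\<^sup>+x. f (t + c *\<^sub>R x) \<partial>lborel)"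
  by (subst lborel_affine[OF c, of t]) (simp add: nn_integral_density nn_integral_distr nn_integral_cmult)

lemma fourier_measurable[measurable]:
  assumes [measurable]: "f \<in> borel_measurable borel"
  shows "fourier f \<in> borel_measurable borel"
  unfolding fourier_def by measurable

lemma norm_fourier_le: "cmod (fourier f \<xi>) \<le> (LINT x|lborel. \<bar>f x\<bar>)"
  unfolding fourier_def by (rule order_trans[OF integral_norm_bound]) (simp add: norm_mult)

text \<open>The Gaussian factor makes the triple integral over \<xi>, x, y absolutely convergent for
  f merely integrable, so the \<xi>-integral may be done first. It yields a Gaussian in x - y of
  width 1/k, an approximate identity, written in the conclusion with its scale moved into the
  argument of f.\<close>

lemma fourier_square_gauss:
  fixes f :: "'a::euclidean_space \<Rightarrow> real"
  assumes f: "integrable lborel f" and k: "k > 0"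
  shows "integrable lborel (\<lambda>\<xi>. (cmod (fourier f \<xi>))\<^sup>2 * gauss (\<xi> /\<^sub>R k))"
    and "(LINT \<xi>|lborel. (cmod (fourier f \<xi>))\<^sup>2 * gauss (\<xi> /\<^sub>R k))
      = (sqrt (2 * pi)) ^ DIM('a) * (LINT x|lborel. f x * (LINT z|lborel. f (x - z /\<^sub>R k) * gauss z))"
proof -
  have [measurable]: "f \<in> borel_measurable borel" using borel_measurable_integrable[OF f] by simp
  have fa: "integrable lborel (\<lambda>x. \<bar>f x\<bar>)" using f by (rule integrable_abs)
  define I where "I = (LINT x|lborel. \<bar>f x\<bar>)"
  \<comment> \<open>As \<open>f\<close> is real, conjugating its transform only flips the sign of
    the character, so the squared modulus is a double integral with characters of opposite
    sign.\<close>
  define F where "F \<xi> x y = cis (- (\<xi> \<bullet> x)) * of_real (f x) * (cis (\<xi> \<bullet> y) * of_real (f y)) * complex_of_real (gauss (\<xi> /\<^sub>R k))"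
    for \<xi> x y :: 'a
  have [measurable]: "(\<lambda>(p, y). F (fst p) (snd p) y) \<in> borel_measurable ((borel \<Otimes>\<^sub>M borel) \<Otimes>\<^sub>M borel)"
    unfolding F_def by measurable
  have gk: "integrable lborel (\<lambda>\<xi>::'a. gauss (\<xi> /\<^sub>R k))"
  proof -
    have "(\<integral>\<^sup>+x. ennreal (gauss (0 + inverse k *\<^sub>R x)) \<partial>(lborel::'a measure)) < \<infinity>"
    proof -
      have "(\<integral>\<^sup>+x. ennreal (gauss (x::'a)) \<partial>lborel) < \<infinity>"
        using gauss_integrable[where 'a='a] by (subst nn_integral_eq_integral) auto
      then have "ennreal (\<bar>inverse k\<bar> ^ DIM('a)) * (\<integral>\<^sup>+x. ennreal (gauss (0 + inverse k *\<^sub>R x)) \<partial>(lborel::'a measure)) < \<infinity>"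
        using k by (subst (asm) nn_integral_lborel_affine[of _ "inverse k" 0]) auto
      then show ?thesis using k by (auto simp: ennreal_mult_less_top)
    qed
    then show ?thesis by (intro integrableI_bounded) auto
  qed
  define G where "G = (LINT \<xi>::'a|lborel. gauss (\<xi> /\<^sub>R k))"
  have nF: "norm (F \<xi> x y) = \<bar>f x\<bar> * \<bar>f y\<bar> * gauss (\<xi> /\<^sub>R k)" for \<xi> x y
    by (simp add: F_def norm_mult )
  have sq: "complex_of_real ((cmod (fourier f \<xi>))\<^sup>2 * gauss (\<xi> /\<^sub>R k)) = (LINT x|lborel. LINT y|lborel. F \<xi> x y)" for \<xi>
  proof -
    have "cnj (fourier f \<xi>) = (LINT y|lborel. cis (\<xi> \<bullet> y) * of_real (f y))"
      unfolding fourier_def by (subst Bochner_Integration.integral_cnj[symmetric]) (simp add: cis_cnj)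
    then have "complex_of_real ((cmod (fourier f \<xi>))\<^sup>2) = fourier f \<xi> * (LINT y|lborel. cis (\<xi> \<bullet> y) * of_real (f y))"
      by (metis complex_norm_square)
    moreover have "(LINT x|lborel. LINT y|lborel. F \<xi> x y)
      = fourier f \<xi> * (LINT y|lborel. cis (\<xi> \<bullet> y) * of_real (f y)) * complex_of_real (gauss (\<xi> /\<^sub>R k))"
      unfolding F_def fourier_def by (simp only: integral_mult_left_zero integral_mult_right_zero)
    ultimately show ?thesis by (simp only: of_real_mult)
  qed
  have dom: "cmod (LINT y|lborel. F \<xi> x y) \<le> \<bar>f x\<bar> * gauss (\<xi> /\<^sub>R k) * I" for \<xi> x
    by (rule order_trans[OF integral_norm_bound]) (simp add: nF I_def mult_ac)
  \<comment> \<open>The order \<xi>, x, y is reversed by two exchanges: \<xi> with x, when the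
    integral over y has already been taken, and then \<xi> with y at fixed x. \<open>i1\<close> and
    \<open>i2\<close> justify them.\<close>
  have i1: "integrable (lborel \<Otimes>\<^sub>M lborel) (\<lambda>(\<xi>, x). LINT y|lborel. F \<xi> x y)"
  proof (rule Bochner_Integration.integrable_bound[OF integrable_mult_left[OF integrable_prod_lborel[OF gk fa], of I]])
    show "(\<lambda>(\<xi>, x). LINT y|lborel. F \<xi> x y) \<in> borel_measurable (lborel \<Otimes>\<^sub>M lborel)"
      unfolding F_def by measurable
  qed (use dom in \<open>auto simp: abs_mult I_def mult_ac\<close>)
  have i2: "integrable (lborel \<Otimes>\<^sub>M lborel) (\<lambda>(\<xi>, y). F \<xi> x y)" for x
  proof (rule Bochner_Integration.integrable_bound[OF integrable_mult_left[OF integrable_prod_lborel[OF gk fa], of "f x"]])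
    show "(\<lambda>(\<xi>, y). F \<xi> x y) \<in> borel_measurable (lborel \<Otimes>\<^sub>M lborel)"
      unfolding F_def by measurable
  qed (auto simp: nF abs_mult mult_ac)
  have inner: "(LINT \<xi>|lborel. F \<xi> x y) = of_real (f x * f y * (k ^ DIM('a) * ((sqrt (2 * pi)) ^ DIM('a) * gauss (k *\<^sub>R (x - y)))))" for x y
  proof -
    have "(LINT \<xi>|lborel. F \<xi> x y) = of_real (f x * f y) * (LINT \<xi>|lborel. cis (\<xi> \<bullet> (y - x)) * complex_of_real (gauss (\<xi> /\<^sub>R k)))"
      unfolding integral_mult_right_zero[symmetric]
      by (intro Bochner_Integration.integral_cong refl) (simp add: F_def cis_mult inner_diff_right mult_ac)
    also have "(LINT \<xi>|lborel. cis (\<xi> \<bullet> (y - x)) * complex_of_real (gauss (\<xi> /\<^sub>R k)))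
       = \<bar>k\<bar> ^ DIM('a) *\<^sub>R (LINT \<xi>|lborel. cis ((0 + k *\<^sub>R \<xi>) \<bullet> (y - x)) * complex_of_real (gauss ((0 + k *\<^sub>R \<xi>) /\<^sub>R k)))"
      using k by (intro lborel_integral_affine) auto
    also have "\<dots> = k ^ DIM('a) *\<^sub>R (LINT \<xi>|lborel. cis ((k *\<^sub>R (y - x)) \<bullet> \<xi>) * complex_of_real (gauss \<xi>))"
      using k by (simp add: inner_commute)
    also have "\<dots> = of_real (k ^ DIM('a) * ((sqrt (2 * pi)) ^ DIM('a) * gauss (k *\<^sub>R (y - x))))"
      by (simp only: gauss_fourier(2) scaleR_conv_of_real of_real_mult)
    also have "gauss (k *\<^sub>R (y - x)) = gauss (k *\<^sub>R (x - y))"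
      by (simp add: gauss_def norm_minus_commute)
    finally show ?thesis by simp
  qed
  have conv: "(LINT y|lborel. f y * (k ^ DIM('a) * gauss (k *\<^sub>R (x - y)))) = (LINT z|lborel. f (x - z /\<^sub>R k) * gauss z)" for x
  proof -
    have "(LINT y|lborel. f y * (k ^ DIM('a) * gauss (k *\<^sub>R (x - y))))
      = \<bar>- inverse k\<bar> ^ DIM('a) *\<^sub>R (LINT z|lborel. f (x + (- inverse k) *\<^sub>R z) * (k ^ DIM('a) * gauss (k *\<^sub>R (x - (x + (- inverse k) *\<^sub>R z)))))"
      using k by (intro lborel_integral_affine) auto
    also have "\<dots> = inverse k ^ DIM('a) *\<^sub>R (LINT z|lborel. k ^ DIM('a) * (f (x - z /\<^sub>R k) * gauss z))"
      using k by (simp add: mult_ac)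
    also have "\<dots> = (LINT z|lborel. f (x - z /\<^sub>R k) * gauss z)"
      unfolding integral_mult_right_zero using k by (simp add: power_inverse)
    finally show ?thesis .
  qed
  show "integrable lborel (\<lambda>\<xi>. (cmod (fourier f \<xi>))\<^sup>2 * gauss (\<xi> /\<^sub>R k))"
  proof (rule Bochner_Integration.integrable_bound[OF integrable_mult_left[OF gk, of "I\<^sup>2"]])
    show "AE \<xi> in lborel. norm ((cmod (fourier f \<xi>))\<^sup>2 * gauss (\<xi> /\<^sub>R k)) \<le> norm (gauss (\<xi> /\<^sub>R k) * I\<^sup>2)"
      using norm_fourier_le[of f]
      by (intro AE_I2) (auto simp: abs_mult I_def mult.commute intro!: mult_left_mono power_mono)
  qed measurable
  have "complex_of_real (LINT \<xi>|lborel. (cmod (fourier f \<xi>))\<^sup>2 * gauss (\<xi> /\<^sub>R k))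
     = (LINT \<xi>|lborel. LINT x|lborel. LINT y|lborel. F \<xi> x y)"
    by (subst integral_complex_of_real[symmetric]) (rule Bochner_Integration.integral_cong[OF refl sq])
  also have "\<dots> = (LINT x|lborel. LINT \<xi>|lborel. LINT y|lborel. F \<xi> x y)"
    using lborel_pair.Fubini_integral[OF i1] by simp
  also have "\<dots> = (LINT x|lborel. LINT y|lborel. LINT \<xi>|lborel. F \<xi> x y)"
    using lborel_pair.Fubini_integral[OF i2] by simp
  also have "\<dots> = (LINT x|lborel. LINT y|lborel. complex_of_real ((sqrt (2 * pi)) ^ DIM('a) * (f x * (f y * (k ^ DIM('a) * gauss (k *\<^sub>R (x - y)))))))"
    unfolding inner by (simp add: mult_ac)
  also have "\<dots> = complex_of_real (LINT x|lborel. LINT y|lborel. (sqrt (2 * pi)) ^ DIM('a) * (f x * (f y * (k ^ DIM('a) * gauss (k *\<^sub>R (x - y))))))"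
    by (simp only: integral_complex_of_real)
  also have "(LINT x|lborel. LINT y|lborel. (sqrt (2 * pi)) ^ DIM('a) * (f x * (f y * (k ^ DIM('a) * gauss (k *\<^sub>R (x - y))))))
    = (sqrt (2 * pi)) ^ DIM('a) * (LINT x|lborel. f x * (LINT z|lborel. f (x - z /\<^sub>R k) * gauss z))"
    by (simp only: integral_mult_right_zero conv)
  finally show "(LINT \<xi>|lborel. (cmod (fourier f \<xi>))\<^sup>2 * gauss (\<xi> /\<^sub>R k))
      = (sqrt (2 * pi)) ^ DIM('a) * (LINT x|lborel. f x * (LINT z|lborel. f (x - z /\<^sub>R k) * gauss z))"
    by (simp only: of_real_eq_iff)
qed

text \<open>Let k tend to infinity in \<open>fourier_square_gauss\<close>. On the frequency side the
  weights increase to 1, so monotone convergence presupposes no square integrability of the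
  transform; on the other side continuity and boundedness of f give dominated convergence.\<close>

theorem plancherel:
  fixes f :: "'a::euclidean_space \<Rightarrow> real"
  assumes cont: "continuous_on UNIV f" and f: "integrable lborel f" and bdd: "\<And>x. \<bar>f x\<bar> \<le> B"
  shows "(\<integral>\<^sup>+\<xi>. ennreal ((cmod (fourier f \<xi>))\<^sup>2) \<partial>lborel) = ennreal ((2 * pi) ^ DIM('a)) * (\<integral>\<^sup>+x. ennreal ((f x)\<^sup>2) \<partial>lborel)"
proof -
  have [measurable]: "f \<in> borel_measurable borel" using borel_measurable_integrable[OF f] by simp
  let ?c = "(sqrt (2 * pi)) ^ DIM('a)"
  have B: "B \<ge> 0" using bdd[of 0] by linarith
  define H where "H k x = (LINT z|lborel. f (x - z /\<^sub>R real (Suc k)) * gauss z)" for k x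
  have H: "(\<lambda>k. H k x) \<longlonglongrightarrow> (LINT z|lborel. f x * gauss (z::'a))" for x
    unfolding H_def
  proof (rule integral_dominated_convergence[where w="\<lambda>z. B * gauss z"])
    show "AE z in lborel. (\<lambda>k. f (x - z /\<^sub>R real (Suc k)) * gauss z) \<longlonglongrightarrow> f x * gauss (z::'a)"
    proof (intro AE_I2 tendsto_mult tendsto_const)
      fix z :: 'a
      have "(\<lambda>k. x - z /\<^sub>R real (Suc k)) \<longlonglongrightarrow> x - 0 *\<^sub>R z"
        by (intro tendsto_diff tendsto_const tendsto_scaleR LIMSEQ_inverse_real_of_nat)
      moreover have "isCont f x" using cont by (simp add: continuous_on_eq_continuous_at)
      ultimately show "(\<lambda>k. f (x - z /\<^sub>R real (Suc k))) \<longlonglongrightarrow> f x"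
        by (intro isCont_tendsto_compose[of x f]) auto
    qed
    show "AE z in lborel. norm (f (x - z /\<^sub>R real (Suc k)) * gauss z) \<le> B * gauss z" for k
      using bdd by (intro AE_I2) (auto simp: abs_mult intro!: mult_right_mono)
    show "integrable lborel (\<lambda>z::'a. B * gauss z)" by (simp add: gauss_integrable)
  qed measurable
  have Hb: "\<bar>H k x\<bar> \<le> B * ?c" for k x
  proof -
    have "\<bar>H k x\<bar> \<le> (LINT z|lborel. B * gauss (z::'a))"
      unfolding H_def real_norm_def[symmetric]
    proof (rule Bochner_Integration.integral_norm_bound_integral)
      show i: "integrable lborel (\<lambda>z::'a. B * gauss z)" by (simp add: gauss_integrable)
      show "integrable lborel (\<lambda>z. f (x - z /\<^sub>R real (Suc k)) * gauss z)"
        by (rule Bochner_Integration.integrable_bound[OF i])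
           (use bdd B in \<open>auto simp: abs_mult intro!: mult_right_mono\<close>)
    qed (use bdd in \<open>auto simp: abs_mult intro!: mult_right_mono\<close>)
    then show ?thesis by (simp add: gauss_integral)
  qed
  have "(\<lambda>k. LINT x|lborel. f x * H k x) \<longlonglongrightarrow> (LINT x|lborel. f x * (LINT z|lborel. f x * gauss (z::'a)))"
  proof (rule integral_dominated_convergence[where w="\<lambda>x. \<bar>f x\<bar> * (B * ?c)"])
    show "AE x in lborel. norm (f x * H k x) \<le> \<bar>f x\<bar> * (B * ?c)" for k
      using Hb by (intro AE_I2) (auto simp: abs_mult intro!: mult_left_mono)
  qed (use f H in \<open>auto intro!: tendsto_mult simp: H_def\<close>)
  also have "(LINT x|lborel. f x * (LINT z|lborel. f x * gauss (z::'a))) = ?c * (LINT x|lborel. (f x)\<^sup>2)"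
    by (simp add: gauss_integral power2_eq_square mult.assoc[symmetric])
  finally have "(\<lambda>k. ?c * (LINT x|lborel. f x * H k x)) \<longlonglongrightarrow> ?c * (?c * (LINT x|lborel. (f x)\<^sup>2))"
    by (intro tendsto_mult tendsto_const)
  \<comment> \<open>One factor comes from the transform of the Gaussian, the other from its total
    mass.\<close>
  moreover have "?c * ?c = (2 * pi) ^ DIM('a)" by (subst power_mult_distrib[symmetric]) (simp only: real_sqrt_mult_self, simp)
  ultimately have lim1: "(\<lambda>k. ennreal (?c * (LINT x|lborel. f x * H k x))) \<longlonglongrightarrow> ennreal ((2 * pi) ^ DIM('a) * (LINT x|lborel. (f x)\<^sup>2))"
    by (intro tendsto_ennrealI) (simp only: mult.assoc[symmetric])
  have "(\<lambda>k. \<integral>\<^sup>+\<xi>. ennreal ((cmod (fourier f \<xi>))\<^sup>2 * gauss (\<xi> /\<^sub>R real (Suc k))) \<partial>lborel)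
        \<longlonglongrightarrow> (\<integral>\<^sup>+\<xi>. ennreal ((cmod (fourier f \<xi>))\<^sup>2) \<partial>lborel)"
  proof (rule nn_integral_LIMSEQ)
    have "gauss (\<xi> /\<^sub>R real (Suc m)) \<le> gauss (\<xi> /\<^sub>R real (Suc n))" if "m \<le> n" for m n and \<xi> :: 'a
    proof -
      have "(norm \<xi> / real (Suc n)) ^ 2 \<le> (norm \<xi> / real (Suc m)) ^ 2"
        using that by (intro power_mono divide_left_mono) auto
      moreover have "norm (\<xi> /\<^sub>R real (Suc k)) = norm \<xi> / real (Suc k)" for k
        by (simp add: divide_inverse mult.commute del: of_nat_Suc)
      ultimately show ?thesis unfolding gauss_def by simp
    qed
    then show "incseq (\<lambda>k \<xi>. ennreal ((cmod (fourier f \<xi>))\<^sup>2 * gauss (\<xi> /\<^sub>R real (Suc k))))"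
      by (auto simp: incseq_def le_fun_def intro!: ennreal_leI mult_left_mono)
    show "(\<lambda>k. ennreal ((cmod (fourier f \<xi>))\<^sup>2 * gauss (\<xi> /\<^sub>R real (Suc k)))) \<longlonglongrightarrow> ennreal ((cmod (fourier f \<xi>))\<^sup>2)" for \<xi>
    proof -
      have "(\<lambda>k. norm (\<xi> /\<^sub>R real (Suc k))) \<longlonglongrightarrow> norm (0 *\<^sub>R \<xi>)"
        by (intro tendsto_norm tendsto_const tendsto_scaleR LIMSEQ_inverse_real_of_nat)
      then have "(\<lambda>k. gauss (\<xi> /\<^sub>R real (Suc k))) \<longlonglongrightarrow> exp (- (norm (0 *\<^sub>R \<xi>))\<^sup>2 / 2)"
        unfolding gauss_def by (intro tendsto_exp tendsto_divide tendsto_minus tendsto_power tendsto_const) simp_all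
      then have "(\<lambda>k. (cmod (fourier f \<xi>))\<^sup>2 * gauss (\<xi> /\<^sub>R real (Suc k))) \<longlonglongrightarrow> (cmod (fourier f \<xi>))\<^sup>2 * 1"
        by (intro tendsto_mult tendsto_const) simp
      then show ?thesis by (intro tendsto_ennrealI) simp
    qed
  qed measurable
  moreover have "(\<integral>\<^sup>+\<xi>. ennreal ((cmod (fourier f \<xi>))\<^sup>2 * gauss (\<xi> /\<^sub>R real (Suc k))) \<partial>lborel)
    = ennreal (?c * (LINT x|lborel. f x * H k x))" for k
    using fourier_square_gauss[OF f, of "real (Suc k)"]
    by (subst nn_integral_eq_integral) (auto simp: H_def)
  ultimately have "(\<integral>\<^sup>+\<xi>. ennreal ((cmod (fourier f \<xi>))\<^sup>2) \<partial>lborel) = ennreal ((2 * pi) ^ DIM('a) * (LINT x|lborel. (f x)\<^sup>2))"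
    using lim1 by (simp add: LIMSEQ_unique)
  also have "\<dots> = ennreal ((2 * pi) ^ DIM('a)) * ennreal (LINT x|lborel. (f x)\<^sup>2)"
    by (simp add: ennreal_mult')
  also have "ennreal (LINT x|lborel. (f x)\<^sup>2) = (\<integral>\<^sup>+x. ennreal ((f x)\<^sup>2) \<partial>lborel)"
  proof (rule nn_integral_eq_integral[symmetric])
    show "integrable lborel (\<lambda>x. (f x)\<^sup>2)"
    proof (rule Bochner_Integration.integrable_bound[OF integrable_mult_left[OF f, of B]])
      show "AE x in lborel. norm ((f x)\<^sup>2) \<le> norm (f x * B)"
      proof (intro AE_I2)
        fix x
        have "\<bar>f x\<bar> * \<bar>f x\<bar> \<le> \<bar>f x\<bar> * B" using bdd by (intro mult_left_mono) auto
        then show "norm ((f x)\<^sup>2) \<le> norm (f x * B)" using B by (simp add: power2_eq_square abs_mult)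
      qed
    qed measurable
  qed auto
  finally show ?thesis .
qed

section \<open>The Brezis--Lieb lemma\<close>

text \<open>Convexity of the p-th power at the points x/(1-s) and y/s with weights 1-s and s. Making
  s small moves nearly all the cost onto y.\<close>

lemma powr_add_le:
  fixes x y p s :: real
  assumes "x \<ge> 0" "y \<ge> 0" "p \<ge> 1" "0 < s" "s < 1"
  shows "(x + y) powr p \<le> (1 - s) powr (1 - p) * x powr p + s powr (1 - p) * y powr p"
proof -
  have pos: "1 \<le> (1 - s) powr (1 - p)" "1 \<le> s powr (1 - p)"
    using assms by (auto simp: powr_mono2' intro!: ge_one_powr_ge_zero
      simp: powr_minus_divide[of _ "p - 1", simplified] divide_simps powr_le1)
  consider "x = 0" | "y = 0" | "x > 0" "y > 0" using assms by linarith
  then show ?thesis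
  proof cases
    case 1
    have "y powr p * 1 \<le> y powr p * s powr (1 - p)"
      by (rule mult_left_mono) (use pos in auto)
    then show ?thesis using 1 assms by (simp add: mult.commute)
  next
    case 2
    have "x powr p * 1 \<le> x powr p * (1 - s) powr (1 - p)"
      by (rule mult_left_mono) (use pos in auto)
    then show ?thesis using 2 assms by (simp add: mult.commute)
  next
    case 3
    have "((1 - s) *\<^sub>R (x / (1 - s)) + s *\<^sub>R (y / s)) powr p
        \<le> (1 - s) * (x / (1 - s)) powr p + s * (y / s) powr p"
      using convex_onD[OF powr_convex[OF assms(3)], of s "x / (1-s)" "y / s"] assms 3
      by auto
    moreover have "(1 - s) *\<^sub>R (x / (1 - s)) + s *\<^sub>R (y / s) = x + y" using assms by simp
    moreover have "(1 - s) * (x / (1 - s)) powr p = (1 - s) powr (1 - p) * x powr p"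
      using assms 3 by (simp add: powr_divide powr_diff)
    moreover have "s * (y / s) powr p = s powr (1 - p) * y powr p"
      using assms 3 by (simp add: powr_divide powr_diff)
    ultimately show ?thesis by simp
  qed
qed

text \<open>Both signs of the difference come from \<open>powr_add_le\<close>, applied to the pair
  a, b and to the pair a+b, -b. The factor (1-s)^(1-p) tends to 1 as s tends to 0, which leaves only
  \<epsilon> |a|^p; the price is the large constant at |b|^p.\<close>

lemma brezis_lieb_pointwise:
  fixes p \<epsilon> :: real
  assumes "p \<ge> 1" "\<epsilon> > 0"
  obtains C where "C \<ge> 0"
    "\<And>a b::real. \<bar>\<bar>a + b\<bar> powr p - \<bar>a\<bar> powr p - \<bar>b\<bar> powr p\<bar> \<le> \<epsilon> * \<bar>a\<bar> powr p + C * \<bar>b\<bar> powr p"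
proof -
  have "((\<lambda>s::real. (1 - s) powr (1 - p)) \<longlongrightarrow> (1 - 0) powr (1 - p)) (at_right 0)"
    by (intro tendsto_intros) auto
  \<comment> \<open>Half of \<open>min \<epsilon> 1\<close> serves two uses: the bound \<epsilon>/2
    for the error, and the crude bound A < 2 with which (A - 1) Z is turned back into X and
    Y.\<close>
  then have "eventually (\<lambda>s::real. (1 - s) powr (1 - p) < 1 + min \<epsilon> 1 / 2) (at_right 0)"
    using assms by (intro order_tendstoD) auto
  moreover have "eventually (\<lambda>s::real. 0 < s \<and> s < 1) (at_right 0)"
    by (auto simp: eventually_at_right_field intro!: exI[of _ 1])
  ultimately have "eventually (\<lambda>s::real. (1 - s) powr (1 - p) < 1 + min \<epsilon> 1 / 2 \<and> 0 < s \<and> s < 1) (at_right 0)"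
    by eventually_elim auto
  then obtain s :: real where s: "(1 - s) powr (1 - p) < 1 + min \<epsilon> 1 / 2" "0 < s" "s < 1"
    using eventually_happens[of _ "at_right (0::real)"] trivial_limit_at_right_real by blast
  define A where "A = (1 - s) powr (1 - p)"
  define B where "B = s powr (1 - p)"
  have AB: "1 \<le> A" "0 \<le> B"
    using s assms by (auto simp: A_def B_def powr_minus_divide[of _ "p - 1", simplified] divide_simps powr_le1)
  have A2: "A < 1 + \<epsilon> / 2" "A < 1 + 1/2" using s by (auto simp: A_def min_def split: if_splits)
  show ?thesis
  proof (rule that[of "2 * B + 1"])
    show "0 \<le> 2 * B + 1" using AB by simp
    fix a b :: real
    have 1: "\<bar>a + b\<bar> powr p \<le> A * \<bar>a\<bar> powr p + B * \<bar>b\<bar> powr p"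
      using powr_add_le[of "\<bar>a\<bar>" "\<bar>b\<bar>" p s] s assms powr_mono2[of p "\<bar>a+b\<bar>" "\<bar>a\<bar>+\<bar>b\<bar>"]
        abs_triangle_ineq[of a b]
      by (simp add: A_def B_def)
    have 2: "\<bar>a\<bar> powr p \<le> A * \<bar>a + b\<bar> powr p + B * \<bar>b\<bar> powr p"
      using powr_add_le[of "\<bar>a+b\<bar>" "\<bar>b\<bar>" p s] s assms powr_mono2[of p "\<bar>a\<bar>" "\<bar>a+b\<bar>+\<bar>b\<bar>"]
        abs_triangle_ineq[of "a + b" "- b"]
      by (simp add: A_def B_def)
    define X Y Z where "X = \<bar>a\<bar> powr p" and "Y = \<bar>b\<bar> powr p" and "Z = \<bar>a + b\<bar> powr p"
    have nn: "X \<ge> 0" "Y \<ge> 0" "Z \<ge> 0" by (auto simp: X_def Y_def Z_def)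
    have 1: "Z \<le> A * X + B * Y" and 2: "X \<le> A * Z + B * Y" using 1 2 by (auto simp: X_def Y_def Z_def)
    have "A * X \<le> (1 + \<epsilon> / 2) * X" using A2 nn by (intro mult_right_mono) auto
    then have u: "Z - X \<le> \<epsilon> * X + B * Y" using 1 mult_nonneg_nonneg[OF less_imp_le[OF assms(2)] nn(1)] by (simp add: algebra_simps)
    have le2: "Z \<le> 2 * X + B * Y" using 1 A2 nn mult_right_mono[of A 2 X] by auto
    have "(A - 1) * Z \<le> (A - 1) * (2 * X + B * Y)" using AB le2 by (intro mult_left_mono) auto
    also have "\<dots> \<le> \<epsilon> * X + B * Y"
    proof -
      have "(A - 1) * (2 * X) \<le> (\<epsilon> / 2) * (2 * X)" using A2 nn by (intro mult_right_mono) auto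
      moreover have "(A - 1) * (B * Y) \<le> 1 * (B * Y)" using A2 nn AB by (intro mult_right_mono) auto
      ultimately show ?thesis by (simp add: algebra_simps)
    qed
    finally have l: "X - Z \<le> \<epsilon> * X + 2 * (B * Y)" using 2 by (simp add: algebra_simps)
    have "B * Y \<ge> 0" "\<epsilon> * X \<ge> 0" using AB nn assms by auto
    then have "\<bar>Z - X - Y\<bar> \<le> \<epsilon> * X + (2 * B + 1) * Y"
      using u l nn by (simp add: algebra_simps abs_le_iff)
    then show "\<bar>\<bar>a + b\<bar> powr p - \<bar>a\<bar> powr p - \<bar>b\<bar> powr p\<bar> \<le> \<epsilon> * \<bar>a\<bar> powr p + (2 * B + 1) * \<bar>b\<bar> powr p"
      by (simp add: X_def Y_def Z_def)
  qed
qed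

lemma powr_add_le2:
  fixes a b p :: real
  assumes "p \<ge> 1"
  shows "\<bar>a + b\<bar> powr p \<le> 2 powr (p - 1) * (\<bar>a\<bar> powr p + \<bar>b\<bar> powr p)"
proof -
  have "\<bar>a + b\<bar> powr p \<le> (\<bar>a\<bar> + \<bar>b\<bar>) powr p" using assms by (intro powr_mono2) auto
  also have "\<dots> \<le> (1/2) powr (1 - p) * \<bar>a\<bar> powr p + (1/2) powr (1 - p) * \<bar>b\<bar> powr p"
    using powr_add_le[of "\<bar>a\<bar>" "\<bar>b\<bar>" p "1/2"] assms by simp
  also have "(1/2::real) powr (1 - p) = 2 powr (p - 1)"
    by (simp add: powr_divide powr_diff)
  finally show ?thesis by (simp add: algebra_simps)
qed

text \<open>After subtraction of \<epsilon> |f_n - g|^p the pointwise defect is dominated by C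
  |g|^p, so its positive part tends to 0 in the mean; what was subtracted is at most \<epsilon>
  times a bound independent of n. Hence the defect tends to 0 in L^1.\<close>

lemma brezis_lieb:
  fixes f :: "nat \<Rightarrow> 'b \<Rightarrow> real" and g :: "'b \<Rightarrow> real"
  assumes p: "p \<ge> 1"
    and [measurable]: "\<And>n. f n \<in> borel_measurable M" "g \<in> borel_measurable M"
    and int: "\<And>n. integrable M (\<lambda>x. \<bar>f n x\<bar> powr p)"
    and bound: "\<And>n. (LINT x|M. \<bar>f n x\<bar> powr p) \<le> K"
    and lim: "AE x in M. (\<lambda>n. f n x) \<longlonglongrightarrow> g x"
  shows "integrable M (\<lambda>x. \<bar>g x\<bar> powr p)"
    and "\<And>n. integrable M (\<lambda>x. \<bar>f n x - g x\<bar> powr p)"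
    and "(\<lambda>n. (LINT x|M. \<bar>f n x\<bar> powr p) - (LINT x|M. \<bar>f n x - g x\<bar> powr p))
           \<longlonglongrightarrow> (LINT x|M. \<bar>g x\<bar> powr p)"
proof -
  have K: "K \<ge> 0" by (rule order_trans[OF _ bound[of 0]]) simp
  have nnK: "(\<integral>\<^sup>+x. ennreal (\<bar>f n x\<bar> powr p) \<partial>M) \<le> ennreal K" for n
    using int bound by (subst nn_integral_eq_integral) (auto intro: ennreal_leI)
  have "(\<integral>\<^sup>+x. ennreal (\<bar>g x\<bar> powr p) \<partial>M) = (\<integral>\<^sup>+x. liminf (\<lambda>n. ennreal (\<bar>f n x\<bar> powr p)) \<partial>M)"
  proof (rule nn_integral_cong_AE)
    show "AE x in M. ennreal (\<bar>g x\<bar> powr p) = liminf (\<lambda>n. ennreal (\<bar>f n x\<bar> powr p))"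
      using lim
    proof eventually_elim
      case (elim x)
      have "(\<lambda>n. \<bar>f n x\<bar> powr p) \<longlonglongrightarrow> \<bar>g x\<bar> powr p"
        using elim p by (intro tendsto_powr' tendsto_rabs tendsto_const) auto
      then have "(\<lambda>n. ennreal (\<bar>f n x\<bar> powr p)) \<longlonglongrightarrow> ennreal (\<bar>g x\<bar> powr p)"
        by (intro tendsto_ennrealI)
      then show ?case by (metis lim_imp_Liminf sequentially_bot)
    qed
  qed
  also have "\<dots> \<le> liminf (\<lambda>n. \<integral>\<^sup>+x. ennreal (\<bar>f n x\<bar> powr p) \<partial>M)"
    by (rule nn_integral_liminf) measurable
  also have "\<dots> \<le> ennreal K"
    using nnK by (intro Liminf_le) auto
  finally have gK: "(\<integral>\<^sup>+x. ennreal (\<bar>g x\<bar> powr p) \<partial>M) \<le> ennreal K" .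
  show gint: "integrable M (\<lambda>x. \<bar>g x\<bar> powr p)"
    by (rule integrableI_bounded) (use gK in \<open>auto simp: top_unique less_top[symmetric]\<close>)
  have dbd: "\<bar>f n x - g x\<bar> powr p \<le> 2 powr (p - 1) * (\<bar>f n x\<bar> powr p + \<bar>g x\<bar> powr p)" for n x
    using powr_add_le2[OF p, of "f n x" "- g x"] by simp
  show dint: "integrable M (\<lambda>x. \<bar>f n x - g x\<bar> powr p)" for n
    by (rule Bochner_Integration.integrable_bound[of _ "\<lambda>x. 2 powr (p - 1) * (\<bar>f n x\<bar> powr p + \<bar>g x\<bar> powr p)"])
       (use int gint dbd in auto)
  define G where "G = (LINT x|M. \<bar>g x\<bar> powr p)"
  have GK: "0 \<le> G" "G \<le> K" using gK gint K by (auto simp: G_def nn_integral_eq_integral)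
  \<comment> \<open>A bound, uniform in n, for the p-th power integral of f_n - g, from
    \<open>dbd\<close> and the Fatou bound on g; adding 1 keeps it positive for the division in
    \<open>\<epsilon>\<close>.\<close>
  define L where "L = 2 powr (p - 1) * (2 * K) + 1"
  have L: "L > 0" using K by (auto simp: L_def intro!: add_nonneg_pos)
  have dL: "(LINT x|M. \<bar>f n x - g x\<bar> powr p) \<le> L" for n
  proof -
    have "(LINT x|M. \<bar>f n x - g x\<bar> powr p) \<le> (LINT x|M. 2 powr (p - 1) * (\<bar>f n x\<bar> powr p + \<bar>g x\<bar> powr p))"
      using int gint dint dbd by (intro integral_mono) auto
    also have "\<dots> = 2 powr (p - 1) * ((LINT x|M. \<bar>f n x\<bar> powr p) + G)"
      using int gint by (simp add: G_def)
    also have "\<dots> \<le> 2 powr (p - 1) * (2 * K)"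
      using bound[of n] GK by (intro mult_left_mono) auto
    finally show ?thesis by (simp add: L_def)
  qed
  let ?d = "\<lambda>n x. \<bar>\<bar>f n x\<bar> powr p - \<bar>f n x - g x\<bar> powr p - \<bar>g x\<bar> powr p\<bar>"
  have ddint: "integrable M (?d n)" for n using int gint dint by auto
  have "(\<lambda>n. LINT x|M. ?d n x) \<longlonglongrightarrow> 0"
  proof (rule LIMSEQ_I)
    fix r :: real assume r: "r > 0"
    define \<epsilon> where "\<epsilon> = r / (2 * L)"
    have e: "\<epsilon> > 0" using r L by (auto simp: \<epsilon>_def)
    obtain C where C: "C \<ge> 0" "\<And>a b::real. \<bar>\<bar>a + b\<bar> powr p - \<bar>a\<bar> powr p - \<bar>b\<bar> powr p\<bar> \<le> \<epsilon> * \<bar>a\<bar> powr p + C * \<bar>b\<bar> powr p"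
      using brezis_lieb_pointwise[OF p e] by metis
    define W where "W n x = max 0 (?d n x - \<epsilon> * \<bar>f n x - g x\<bar> powr p)" for n x
    have Wb: "norm (W n x) \<le> C * \<bar>g x\<bar> powr p" for n x
      using C(2)[of "f n x - g x" "g x"] C(1) by (auto simp: W_def)
    have [measurable]: "W n \<in> borel_measurable M" for n unfolding W_def by measurable
    have Wl: "(\<lambda>n. LINT x|M. W n x) \<longlonglongrightarrow> (LINT x|M. 0)"
    proof (rule integral_dominated_convergence[where w="\<lambda>x. C * \<bar>g x\<bar> powr p"])
      show "AE x in M. (\<lambda>n. W n x) \<longlonglongrightarrow> 0"
        using lim
      proof eventually_elim
        case (elim x)
        have "(\<lambda>n. W n x) \<longlonglongrightarrow> max 0 (\<bar>\<bar>g x\<bar> powr p - \<bar>g x - g x\<bar> powr p - \<bar>g x\<bar> powr p\<bar> - \<epsilon> * \<bar>g x - g x\<bar> powr p)"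
          unfolding W_def
          using elim p by (intro tendsto_max tendsto_diff tendsto_mult tendsto_powr' tendsto_rabs tendsto_const) auto
        then show ?case by simp
      qed
    qed (use gint Wb in auto)
    then obtain N where N: "\<And>n. n \<ge> N \<Longrightarrow> (LINT x|M. W n x) < r / 2"
      using order_tendstoD(2)[OF Wl, of "r/2"] r by (auto simp: eventually_sequentially)
    have Wint: "integrable M (W n)" for n
      by (rule Bochner_Integration.integrable_bound[of _ "\<lambda>x. C * \<bar>g x\<bar> powr p"]) (use gint Wb C in \<open>auto intro: order_trans\<close>)
    have dWle: "?d n x \<le> W n x + \<epsilon> * \<bar>f n x - g x\<bar> powr p" for n x unfolding W_def by linarith
    show "\<exists>N. \<forall>n\<ge>N. norm ((LINT x|M. ?d n x) - 0) < r"
    proof (intro exI allI impI)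
      fix n assume n: "n \<ge> N"
      have "(LINT x|M. ?d n x) \<le> (LINT x|M. W n x + \<epsilon> * \<bar>f n x - g x\<bar> powr p)"
        using ddint Wint dint by (intro integral_mono) (simp_all add: dWle)
      also have "\<dots> = (LINT x|M. W n x) + \<epsilon> * (LINT x|M. \<bar>f n x - g x\<bar> powr p)"
        using Wint dint by simp
      also have "\<dots> < r/2 + \<epsilon> * L"
        using N[OF n] mult_left_mono[OF dL[of n], of \<epsilon>] e by linarith
      also have "\<dots> = r" using L by (simp add: \<epsilon>_def)
      finally show "norm ((LINT x|M. ?d n x) - 0) < r" by simp
    qed
  qed
  then have "(\<lambda>n. LINT x|M. (\<bar>f n x\<bar> powr p - \<bar>f n x - g x\<bar> powr p - \<bar>g x\<bar> powr p)) \<longlonglongrightarrow> 0"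
    by (rule Lim_null_comparison[rotated]) (auto intro!: always_eventually integral_abs_bound simp: real_norm_def)
  then have "(\<lambda>n. ((LINT x|M. \<bar>f n x\<bar> powr p) - (LINT x|M. \<bar>f n x - g x\<bar> powr p) - G) + G) \<longlonglongrightarrow> 0 + G"
    using int gint dint by (intro tendsto_add tendsto_const) (simp add: G_def)
  then show "(\<lambda>n. (LINT x|M. \<bar>f n x\<bar> powr p) - (LINT x|M. \<bar>f n x - g x\<bar> powr p)) \<longlonglongrightarrow> (LINT x|M. \<bar>g x\<bar> powr p)"
    by (simp add: G_def)
qed

section \<open>The energy on the Fourier side\<close>

definition trans_sq :: "('a::euclidean_space \<Rightarrow> real) \<Rightarrow> 'a \<Rightarrow> ennreal" where
  "trans_sq u h = (\<integral>\<^sup>+x. ennreal ((u x - u (x - h))\<^sup>2) \<partial>lborel)"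

text \<open>Set to 0 for r \<le> 0, so that radial integrals run over the whole line, where affine
  substitution and Fubini apply without indicators.\<close>

definition levy_weight :: "real \<Rightarrow> real \<Rightarrow> ennreal" where
  "levy_weight \<alpha> r = (if r > 0 then ennreal (r powr (- 1 - \<alpha>)) else 0)"

text \<open>The one-dimensional energy along a single direction. Integrated over directions it is
  twice the energy, so some directions have a value controlled by the energy.\<close>

definition ray_energy :: "real \<Rightarrow> ('a::euclidean_space \<Rightarrow> real) \<Rightarrow> 'a \<Rightarrow> ennreal" where
  "ray_energy \<alpha> u \<theta> = (\<integral>\<^sup>+r. levy_weight \<alpha> r * trans_sq u (r *\<^sub>R \<theta>) \<partial>lborel)"

lemma levy_weight_measurable[measurable]: "levy_weight \<alpha> \<in> borel_measurable borel"
  unfolding levy_weight_def by measurable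

lemma trans_sq_measurable[measurable]:
  assumes [measurable]: "u \<in> borel_measurable borel"
  shows "trans_sq u \<in> borel_measurable borel"
  unfolding trans_sq_def by measurable

lemma ray_energy_measurable[measurable]:
  assumes [measurable]: "u \<in> borel_measurable borel"
  shows "ray_energy \<alpha> u \<in> borel_measurable borel"
  unfolding ray_energy_def by measurable

text \<open>Both bounds on \<alpha> enter here: \<alpha> < 2 for r^(1-\<alpha>) at the origin,
  \<alpha> > 0 for r^(-1-\<alpha>) at infinity.\<close>

lemma nn_integral_min_levy_weight_finite:
  assumes "0 < \<alpha>" "\<alpha> < 2"
  shows "(\<integral>\<^sup>+r. levy_weight \<alpha> r * ennreal (min 1 (r\<^sup>2)) \<partial>lborel) < \<infinity>"
proof -
  have "(\<integral>\<^sup>+r. levy_weight \<alpha> r * ennreal (min 1 (r\<^sup>2)) \<partial>lborel)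
    \<le> (\<integral>\<^sup>+r. ennreal (r powr (1 - \<alpha>)) * indicator {0..1} r + ennreal (r powr (- 1 - \<alpha>)) * indicator {1..} r \<partial>lborel)"
  proof (intro nn_integral_mono)
    fix r :: real
    consider "r \<le> 0" | "0 < r" "r \<le> 1" | "r > 1" by linarith
    then show "levy_weight \<alpha> r * ennreal (min 1 (r\<^sup>2))
      \<le> ennreal (r powr (1 - \<alpha>)) * indicator {0..1} r + ennreal (r powr (- 1 - \<alpha>)) * indicator {1..} r"
    proof cases
      case 2
      have "r powr (- 1 - \<alpha>) * min 1 (r\<^sup>2) \<le> r powr (- 1 - \<alpha>) * r powr 2"
        using 2 by (intro mult_left_mono) auto
      also have "\<dots> = r powr (1 - \<alpha>)" by (simp add: powr_add[symmetric])
      finally show ?thesis using 2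
        by (auto simp: levy_weight_def ennreal_mult[symmetric] intro!: add_increasing2 ennreal_leI)
    next
      case 3
      have "r powr (- 1 - \<alpha>) * min 1 (r\<^sup>2) \<le> r powr (- 1 - \<alpha>) * 1"
        using 3 by (intro mult_left_mono) auto
      then show ?thesis using 3
        by (auto simp: levy_weight_def ennreal_mult[symmetric] intro!: ennreal_leI)
    qed (simp add: levy_weight_def)
  qed
  also have "\<dots> = (\<integral>\<^sup>+r. ennreal (r powr (1 - \<alpha>)) * indicator {0..1} r \<partial>lborel) + (\<integral>\<^sup>+r. ennreal (r powr (- 1 - \<alpha>)) * indicator {1..} r \<partial>lborel)"
    by (rule nn_integral_add) measurable
  also have "(\<integral>\<^sup>+r. ennreal (r powr (1 - \<alpha>)) * indicator {0..1} r \<partial>lborel) = ennreal (1 powr (1 - \<alpha> + 1) / (1 - \<alpha> + 1))"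
    using assms by (intro nn_integral_has_integral_lebesgue' has_integral_powr_from_0) auto
  also have "(\<integral>\<^sup>+r. ennreal (r powr (- 1 - \<alpha>)) * indicator {1..} r \<partial>lborel) = ennreal (- (1 powr (- 1 - \<alpha> + 1)) / (- 1 - \<alpha> + 1))"
    using assms by (intro nn_integral_has_integral_lebesgue' has_integral_powr_to_inf) auto
  also have "ennreal (1 powr (1 - \<alpha> + 1) / (1 - \<alpha> + 1)) + ennreal (- (1 powr (- 1 - \<alpha> + 1)) / (- 1 - \<alpha> + 1)) < \<infinity>"
    by simp
  finally show ?thesis .
qed

text \<open>Since |1 - cis(r s)|^2 = 2 - 2 cos(r s), this is, up to Plancherel's constant, the
  Fourier multiplier of \<open>ray_energy\<close>, taken at s = \<xi> \<bullet> \<theta>.\<close>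

definition levy_symbol :: "real \<Rightarrow> real \<Rightarrow> ennreal" where
  "levy_symbol \<alpha> s = (\<integral>\<^sup>+r. levy_weight \<alpha> r * ennreal (2 - 2 * cos (r * s)) \<partial>lborel)"

lemma levy_weight_scale:
  assumes "c > 0"
  shows "levy_weight \<alpha> (c * r) = ennreal (c powr (- 1 - \<alpha>)) * levy_weight \<alpha> r"
  using assms by (auto simp: levy_weight_def powr_mult ennreal_mult zero_less_mult_iff)

text \<open>Substituting r/|s| for r pulls out |s|^\<alpha>; evenness of the cosine removes the sign
  of s.\<close>

lemma levy_symbol_scale:
  assumes "0 < \<alpha>"
  shows "levy_symbol \<alpha> s = ennreal (\<bar>s\<bar> powr \<alpha>) * levy_symbol \<alpha> 1"
proof (cases "s = 0")
  case False
  define c where "c = 1 / \<bar>s\<bar>"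
  have c: "c > 0" using False by (simp add: c_def)
  have cs: "cos (c * (r * s)) = cos r" for r
  proof (cases "s > 0")
    case True then show ?thesis by (simp add: c_def)
  next
    case f: False
    then have "c * (r * s) = - r" using False by (simp add: c_def)
    then show ?thesis by simp
  qed
  have "levy_symbol \<alpha> s = ennreal \<bar>c\<bar> * (\<integral>\<^sup>+r. levy_weight \<alpha> (0 + c * r) * ennreal (2 - 2 * cos ((0 + c * r) * s)) \<partial>lborel)"
    unfolding levy_symbol_def using c by (intro nn_integral_real_affine) auto
  also have "\<dots> = ennreal c * (\<integral>\<^sup>+r. ennreal (c powr (- 1 - \<alpha>)) * (levy_weight \<alpha> r * ennreal (2 - 2 * cos (r * 1))) \<partial>lborel)"
    using c by (simp add: levy_weight_scale[OF c] cs mult.assoc)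
  also have "\<dots> = ennreal c * ennreal (c powr (- 1 - \<alpha>)) * levy_symbol \<alpha> 1"
    by (subst nn_integral_cmult) (auto simp: levy_symbol_def mult.assoc)
  also have "ennreal c * ennreal (c powr (- 1 - \<alpha>)) = ennreal (c powr (- \<alpha>))"
    using c by (simp add: ennreal_mult[symmetric] powr_mult_base)
  also have "c powr (- \<alpha>) = \<bar>s\<bar> powr \<alpha>"
    using False by (simp add: c_def powr_divide powr_minus_divide)
  finally show ?thesis .
qed (simp add: levy_symbol_def)

lemma two_minus_two_cos: "2 - 2 * cos (x::real) = 4 * (sin (x / 2))\<^sup>2"
  using cos_double_sin[of "x / 2"] by simp

lemma levy_symbol_finite:
  assumes "0 < \<alpha>" "\<alpha> < 2"
  shows "levy_symbol \<alpha> 1 < \<infinity>"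
proof -
  have b: "2 - 2 * cos r \<le> 4 * min 1 (r\<^sup>2)" for r :: real
  proof -
    have "(sin (r / 2))\<^sup>2 \<le> (r / 2)\<^sup>2" using abs_sin_x_le_abs_x[of "r / 2"] abs_le_square_iff by blast
    also have "\<dots> \<le> r\<^sup>2" by (simp add: power_divide)
    finally have "(sin (r / 2))\<^sup>2 \<le> r\<^sup>2" .
    moreover have "(sin (r / 2))\<^sup>2 \<le> 1" by (simp add: abs_square_le_1)
    ultimately show ?thesis unfolding two_minus_two_cos by simp
  qed
  have "levy_symbol \<alpha> 1 \<le> (\<integral>\<^sup>+r. 4 * (levy_weight \<alpha> r * ennreal (min 1 (r\<^sup>2))) \<partial>lborel)"
    unfolding levy_symbol_def
  proof (intro nn_integral_mono)
    fix r :: real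
    have "ennreal (2 - 2 * cos (r * 1)) \<le> ennreal (4 * min 1 (r\<^sup>2))" using b by (intro ennreal_leI) simp
    also have "\<dots> = 4 * ennreal (min 1 (r\<^sup>2))" by (simp add: ennreal_mult)
    finally show "levy_weight \<alpha> r * ennreal (2 - 2 * cos (r * 1)) \<le> 4 * (levy_weight \<alpha> r * ennreal (min 1 (r\<^sup>2)))"
      by (simp add: mult_left_mono mult.left_commute)
  qed
  also have "\<dots> = 4 * (\<integral>\<^sup>+r. levy_weight \<alpha> r * ennreal (min 1 (r\<^sup>2)) \<partial>lborel)"
    by (rule nn_integral_cmult) measurable
  also have "\<dots> < \<infinity>" using nn_integral_min_levy_weight_finite[OF assms] by (simp add: ennreal_mult_less_top)
  finally show ?thesis .
qed

lemma levy_symbol_pos: "levy_symbol \<alpha> 1 > 0"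
proof -
  \<comment> \<open>\<alpha> is arbitrary here, so the power may increase or decrease on [1, 2]; the
    minimum of its end values is a lower bound in either case. The interval lies in [0, pi], where 2
    - 2 cos is increasing.\<close>
  let ?m = "min (1 powr (- 1 - \<alpha>)) (2 powr (- 1 - \<alpha>))"
  have c1: "2 - 2 * cos (1::real) > 0" using cos_monotone_0_pi[of 0 1] pi_gt3 by simp
  have "0 < ennreal (?m * (2 - 2 * cos 1)) * emeasure lborel {1..2::real}"
    using c1 by (simp add: ennreal_zero_less_mult_iff)
  also have "\<dots> = (\<integral>\<^sup>+r. ennreal (?m * (2 - 2 * cos 1)) * indicator {1..2::real} r \<partial>lborel)"
    by (subst nn_integral_cmult_indicator) auto
  also have "\<dots> \<le> levy_symbol \<alpha> 1"
    unfolding levy_symbol_def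
  proof (intro nn_integral_mono)
    fix r :: real
    show "ennreal (?m * (2 - 2 * cos 1)) * indicator {1..2::real} r \<le> levy_weight \<alpha> r * ennreal (2 - 2 * cos (r * 1))"
    proof (cases "r \<in> {1..2}")
      case True
      have "?m \<le> r powr (- 1 - \<alpha>)"
        using True by (cases "- 1 - \<alpha> \<ge> 0") (auto intro!: min.coboundedI1 min.coboundedI2 powr_mono2 powr_mono2' simp: ge_one_powr_ge_zero)
      moreover have "cos r \<le> cos 1" using True pi_gt3 by (intro cos_monotone_0_pi_le) auto
      ultimately have "?m * (2 - 2 * cos 1) \<le> r powr (- 1 - \<alpha>) * (2 - 2 * cos r)"
        using c1 by (intro mult_mono) auto
      then show ?thesis using True c1 by (auto simp: levy_weight_def ennreal_mult[symmetric] intro!: ennreal_leI)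
    qed simp
  qed
  finally show ?thesis .
qed

lemma integrable_compact_support:
  fixes f :: "'a::euclidean_space \<Rightarrow> real"
  assumes "continuous_on UNIV f" "\<And>x. norm x \<ge> R \<Longrightarrow> f x = 0"
  shows "integrable lborel f"
proof -
  have "integrable lborel (\<lambda>x. indicator (cball 0 R) x *\<^sub>R f x)"
    by (rule borel_integrable_compact) (use assms(1) continuous_on_subset in auto)
  moreover have "(\<lambda>x. indicator (cball 0 R) x *\<^sub>R f x) = f"
    using assms(2) by (auto simp: fun_eq_iff indicator_def not_le)
  ultimately show ?thesis by simp
qed

lemma test_functions_borel[measurable_dest]: "f \<in> test_functions \<Longrightarrow> f \<in> borel_measurable borel"
  by (intro borel_measurable_continuous_onI test_functions_continuous)

lemma test_functions_bounded:
  assumes "f \<in> test_functions"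
  obtains B where "B > 0" "\<And>x. \<bar>f x\<bar> \<le> B"
proof -
  obtain R where "R > 0" "\<And>x. norm x \<ge> R \<Longrightarrow> f x = 0" using test_functions_support[OF assms] by metis
  then show ?thesis using continuous_zero_outside_bounded[OF test_functions_continuous[OF assms], of R] that by metis
qed

lemma test_functions_integrable: "f \<in> test_functions \<Longrightarrow> integrable lborel f"
  by (metis integrable_compact_support test_functions_continuous test_functions_support)

lemma fourier_diff_trans:
  fixes f :: "'a::euclidean_space \<Rightarrow> real"
  assumes f: "integrable lborel f"
  shows "fourier (\<lambda>x. f x - f (x - h)) \<xi> = (1 - cis (- (\<xi> \<bullet> h))) * fourier f \<xi>"
    and "integrable lborel (\<lambda>x. f (x - h))"
proof -
  have [measurable]: "f \<in> borel_measurable borel" using borel_measurable_integrable[OF f] by simp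
  have e: "(LINT x|lborel. g x) = (LINT x|lborel. g (x - h))" if "g \<in> borel_measurable borel" for g :: "'a \<Rightarrow> complex"
    using lborel_integral_affine[OF that, of 1 "- h"] by simp
  have plus_fun_conv: "(+) (- h) = (\<lambda>x. x - h)" by auto
  have d: "distr lborel borel (\<lambda>x. x - h) = (lborel :: 'a measure)"
    using lborel_distr_plus[of "- h"] by (simp add: plus_fun_conv)
  show i: "integrable lborel (\<lambda>x. f (x - h))"
    using f by (subst (asm) d[symmetric]) (simp add: integrable_distr_eq)
  have i1: "integrable lborel (\<lambda>x. cis (- (\<xi> \<bullet> x)) * complex_of_real (f x))"
    by (rule Bochner_Integration.integrable_bound[OF f]) (auto simp: norm_mult)
  have i2: "integrable lborel (\<lambda>x. cis (- (\<xi> \<bullet> x)) * complex_of_real (f (x - h)))"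
    by (rule Bochner_Integration.integrable_bound[OF i]) (auto simp: norm_mult)
  have "cis (- (\<xi> \<bullet> h)) * fourier f \<xi> = (LINT x|lborel. cis (- (\<xi> \<bullet> h)) * (cis (- (\<xi> \<bullet> x)) * complex_of_real (f x)))"
    by (simp add: fourier_def)
  also have "\<dots> = (LINT x|lborel. cis (- (\<xi> \<bullet> h)) * (cis (- (\<xi> \<bullet> (x - h))) * complex_of_real (f (x - h))))"
    by (rule e) measurable
  also have "\<dots> = (LINT x|lborel. cis (- (\<xi> \<bullet> x)) * complex_of_real (f (x - h)))"
    by (intro Bochner_Integration.integral_cong refl) (simp add: mult.assoc[symmetric] cis_mult inner_diff_right)
  finally show "fourier (\<lambda>x. f x - f (x - h)) \<xi> = (1 - cis (- (\<xi> \<bullet> h))) * fourier f \<xi>"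
    using i1 i2 by (simp add: fourier_def algebra_simps)
qed

lemma cmod_one_minus_cis: "(cmod (1 - cis x))\<^sup>2 = 2 - 2 * cos x"
proof -
  have "(cmod (1 - cis x))\<^sup>2 = (1 - cos x)\<^sup>2 + (sin x)\<^sup>2" by (simp add: cmod_power2)
  also have "\<dots> = 2 - 2 * cos x" using sin_cos_squared_add[of x] by (simp add: power2_eq_square algebra_simps)
  finally show ?thesis .
qed

lemma trans_sq_fourier:
  fixes f :: "'a::euclidean_space \<Rightarrow> real"
  assumes f: "f \<in> test_functions"
  shows "ennreal ((2 * pi) ^ DIM('a)) * trans_sq f h
    = (\<integral>\<^sup>+\<xi>. ennreal (2 - 2 * cos (\<xi> \<bullet> h)) * ennreal ((cmod (fourier f \<xi>))\<^sup>2) \<partial>lborel)"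
proof -
  note fi = test_functions_integrable[OF f]
  obtain B where B: "B > 0" "\<And>x. \<bar>f x\<bar> \<le> B" using test_functions_bounded[OF f] by metis
  have c: "continuous_on UNIV f" by (rule test_functions_continuous[OF f])
  have "continuous_on UNIV (\<lambda>x. f (x - h))"
    by (rule continuous_on_compose2[OF c]) (auto intro!: continuous_intros)
  then have c2: "continuous_on UNIV (\<lambda>x. f x - f (x - h))" using c by (intro continuous_intros)
  have "\<bar>f x - f (x - h)\<bar> \<le> 2 * B" for x using B(2)[of x] B(2)[of "x - h"] by linarith
  from plancherel[OF c2 _ this] fourier_diff_trans(2)[OF fi] fi
  have "ennreal ((2 * pi) ^ DIM('a)) * trans_sq f h = (\<integral>\<^sup>+\<xi>. ennreal ((cmod (fourier (\<lambda>x. f x - f (x - h)) \<xi>))\<^sup>2) \<partial>lborel)"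
    by (simp add: trans_sq_def)
  also have "\<dots> = (\<integral>\<^sup>+\<xi>. ennreal (2 - 2 * cos (\<xi> \<bullet> h)) * ennreal ((cmod (fourier f \<xi>))\<^sup>2) \<partial>lborel)"
    by (simp add: fourier_diff_trans(1)[OF fi] norm_mult power_mult_distrib cmod_one_minus_cis ennreal_mult')
  finally show ?thesis .
qed

text \<open>The Lipschitz bound gives the factor |h|^2 for small h, the sup bound the factor 1 for
  large h, and the increment lives on two balls of fixed volume. Such a bound is integrable against
  \<open>levy_weight\<close>.\<close>

lemma trans_sq_test_bound:
  fixes f :: "'a::euclidean_space \<Rightarrow> real"
  assumes f: "f \<in> test_functions"
  obtains K where "K > 0" "\<And>h. trans_sq f h \<le> ennreal (K * min 1 ((norm h)\<^sup>2))"
proof -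
  obtain R where R: "R > 0" "\<And>x. norm x \<ge> R \<Longrightarrow> f x = 0" using test_functions_support[OF f] by metis
  obtain B where B: "B > 0" "\<And>x. \<bar>f x\<bar> \<le> B" using test_functions_bounded[OF f] by metis
  obtain L where L: "L > 0" "\<And>x y. \<bar>f x - f y\<bar> \<le> L * norm (x - y)" using test_functions_Lipschitz[OF f] by metis
  define D where "D = max (2 * B) L"
  define V where "V = unit_ball_vol (real DIM('a)) * R ^ DIM('a)"
  have V: "V \<ge> 0" using R by (simp add: V_def)
  have eV: "emeasure lborel (cball y R) = ennreal V" for y :: 'a
    unfolding V_def using R by (intro emeasure_cball) simp
  have D: "(f x - f (x - h))\<^sup>2 \<le> D\<^sup>2 * min 1 ((norm h)\<^sup>2)" for x h
  proof -
    have "\<bar>f x - f (x - h)\<bar> \<le> 2 * B" using B(2)[of x] B(2)[of "x - h"] by linarith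
    then have 1: "\<bar>f x - f (x - h)\<bar> \<le> D" by (simp add: D_def)
    have "L * norm h \<le> D * norm h" by (intro mult_right_mono) (auto simp: D_def)
    then have 2: "\<bar>f x - f (x - h)\<bar> \<le> D * norm h" using L(2)[of x "x - h"] by simp
    have "(f x - f (x - h))\<^sup>2 \<le> D\<^sup>2" using power_mono[OF 1, of 2] by simp
    moreover have "(f x - f (x - h))\<^sup>2 \<le> D\<^sup>2 * (norm h)\<^sup>2" using power_mono[OF 2, of 2] by (simp add: power_mult_distrib)
    ultimately show ?thesis by (simp add: min_def)
  qed
  show ?thesis
  proof (rule that[of "D\<^sup>2 * (2 * V + 1)"])
    show "D\<^sup>2 * (2 * V + 1) > 0" using L(1) V by (auto simp: D_def intro!: mult_pos_pos)
    fix h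
    have "trans_sq f h \<le> (\<integral>\<^sup>+x. ennreal (D\<^sup>2 * min 1 ((norm h)\<^sup>2)) * indicator (cball 0 R \<union> cball h R) x \<partial>lborel)"
      unfolding trans_sq_def
    proof (intro nn_integral_mono)
      fix x
      show "ennreal ((f x - f (x - h))\<^sup>2) \<le> ennreal (D\<^sup>2 * min 1 ((norm h)\<^sup>2)) * indicator (cball 0 R \<union> cball h R) x"
      proof (cases "x \<in> cball 0 R \<union> cball h R")
        case False
        then have "f x = 0" "f (x - h) = 0" using R(2) by (auto simp: dist_norm norm_minus_commute)
        then show ?thesis by simp
      next
        case True
        then show ?thesis using D[of x h] by (auto intro: ennreal_leI)
      qed
    qed
    also have "\<dots> = ennreal (D\<^sup>2 * min 1 ((norm h)\<^sup>2)) * emeasure lborel (cball 0 R \<union> cball h R)"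
      by (subst nn_integral_cmult_indicator) auto
    also have "\<dots> \<le> ennreal (D\<^sup>2 * min 1 ((norm h)\<^sup>2)) * ennreal (2 * V + 1)"
    proof (rule mult_left_mono)
      have "emeasure lborel (cball 0 R \<union> cball h R) \<le> emeasure lborel (cball (0::'a) R) + emeasure lborel (cball h R)"
        by (rule emeasure_subadditive) auto
      also have "\<dots> = ennreal (2 * V)" using V by (simp add: eV ennreal_plus[symmetric] del: ennreal_plus)
      also have "\<dots> \<le> ennreal (2 * V + 1)" by (intro ennreal_leI) simp
      finally show "emeasure lborel (cball 0 R \<union> cball h R) \<le> ennreal (2 * V + 1)" .
    qed simp
    also have "\<dots> = ennreal (D\<^sup>2 * (2 * V + 1) * min 1 ((norm h)\<^sup>2))"
      using V by (subst ennreal_mult[symmetric]) (auto simp: mult_ac)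
    finally show "trans_sq f h \<le> ennreal (D\<^sup>2 * (2 * V + 1) * min 1 ((norm h)\<^sup>2))" .
  qed
qed

text \<open>Here \<open>\<nu>\<close> is the spectral measure, regarded as a Borel measure on the whole space that lives on the unit sphere.\<close>

locale levy =
  fixes \<nu> :: "'a::euclidean_space measure" and \<alpha> c\<^sub>0 :: real
  assumes sets_nu[measurable_cong]: "sets \<nu> = sets borel"
    and finite_nu: "finite_measure \<nu>"
    and unit: "AE \<theta> in \<nu>. norm \<theta> = 1"
    and alpha: "0 < \<alpha>" "\<alpha> < 2"
    and dim: "DIM('a) \<ge> 2"
    and c0: "c\<^sub>0 > 0"
    and nondeg: "\<And>\<zeta>. norm \<zeta> = 1 \<Longrightarrow> ennreal c\<^sub>0 \<le> (\<integral>\<^sup>+\<theta>. ennreal (\<bar>\<zeta> \<bullet> \<theta>\<bar> powr \<alpha>) \<partial>\<nu>)"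
begin

interpretation nu: finite_measure \<nu> by (rule finite_nu)
interpretation nu_pair: pair_sigma_finite lborel \<nu> ..

text \<open>Directions are integrated last, whereas \<open>energy\<close> integrates them first;
  this exposes \<open>ray_energy\<close>. The two are identified in
  \<open>energy_eq_E\<close>.\<close>

definition E :: "('a \<Rightarrow> real) \<Rightarrow> ennreal" where
  "E u = (\<integral>\<^sup>+\<theta>. ray_energy \<alpha> u \<theta> \<partial>\<nu>) / 2"

lemma two_E: "2 * E u = (\<integral>\<^sup>+\<theta>. ray_energy \<alpha> u \<theta> \<partial>\<nu>)"
  unfolding E_def by (subst mult.commute, subst ennreal_divide_times, subst ennreal_divide_self) auto

text \<open>Up to \<open>levy_symbol \<alpha> 1\<close> and Plancherel's constant, the multiplier of
  twice the energy. It is homogeneous of degree \<alpha> and comparable to |\<xi>|^\<alpha>: from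
  below by non-degeneracy, from above by the finite total mass.\<close>

definition symbol :: "'a \<Rightarrow> ennreal" where
  "symbol \<xi> = (\<integral>\<^sup>+\<theta>. ennreal (\<bar>\<xi> \<bullet> \<theta>\<bar> powr \<alpha>) \<partial>\<nu>)"

lemma symbol_ge: "ennreal c\<^sub>0 * ennreal (norm \<xi> powr \<alpha>) \<le> symbol \<xi>"
proof (cases "\<xi> = 0")
  case False
  define \<zeta> where "\<zeta> = \<xi> /\<^sub>R norm \<xi>"
  have z: "norm \<zeta> = 1" using False by (simp add: \<zeta>_def)
  have "symbol \<xi> = (\<integral>\<^sup>+\<theta>. ennreal (norm \<xi> powr \<alpha>) * ennreal (\<bar>\<zeta> \<bullet> \<theta>\<bar> powr \<alpha>) \<partial>\<nu>)"
    unfolding symbol_def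
  proof (intro nn_integral_cong)
    fix \<theta>
    have "\<bar>\<xi> \<bullet> \<theta>\<bar> = norm \<xi> * \<bar>\<zeta> \<bullet> \<theta>\<bar>" using False by (simp add: \<zeta>_def abs_mult)
    then show "ennreal (\<bar>\<xi> \<bullet> \<theta>\<bar> powr \<alpha>) = ennreal (norm \<xi> powr \<alpha>) * ennreal (\<bar>\<zeta> \<bullet> \<theta>\<bar> powr \<alpha>)"
      by (simp add: powr_mult ennreal_mult)
  qed
  also have "\<dots> = ennreal (norm \<xi> powr \<alpha>) * (\<integral>\<^sup>+\<theta>. ennreal (\<bar>\<zeta> \<bullet> \<theta>\<bar> powr \<alpha>) \<partial>\<nu>)"
    by (rule nn_integral_cmult) measurable
  finally show ?thesis using mult_left_mono[OF nondeg[OF z], of "ennreal (norm \<xi> powr \<alpha>)"]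
    by (simp add: mult.commute)
qed (simp add: symbol_def)

lemma symbol_le: "symbol \<xi> \<le> ennreal (norm \<xi> powr \<alpha>) * emeasure \<nu> UNIV"
proof -
  have "symbol \<xi> \<le> (\<integral>\<^sup>+\<theta>. ennreal (norm \<xi> powr \<alpha>) \<partial>\<nu>)"
    unfolding symbol_def
  proof (rule nn_integral_mono_AE)
    show "AE \<theta> in \<nu>. ennreal (\<bar>\<xi> \<bullet> \<theta>\<bar> powr \<alpha>) \<le> ennreal (norm \<xi> powr \<alpha>)"
      using unit
    proof eventually_elim
      case (elim \<theta>)
      have "\<bar>\<xi> \<bullet> \<theta>\<bar> \<le> norm \<xi>" using Cauchy_Schwarz_ineq2[of \<xi> \<theta>] elim by simp
      then show ?case using alpha by (intro ennreal_leI powr_mono2) auto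
    qed
  qed
  also have "\<dots> = ennreal (norm \<xi> powr \<alpha>) * emeasure \<nu> UNIV"
    using sets_eq_imp_space_eq[OF sets_nu] by simp
  finally show ?thesis .
qed

lemma symbol_measurable[measurable]: "symbol \<in> borel_measurable borel"
  unfolding symbol_def by measurable

text \<open>The square of \<open>hdot_norm\<close> as a nonnegative integral: unlike the Bochner
  integral there, it does not become 0 when the integrand fails to be integrable.\<close>

definition hdot_sq :: "('a \<Rightarrow> real) \<Rightarrow> ennreal" where
  "hdot_sq f = (\<integral>\<^sup>+\<xi>. ennreal (norm \<xi> powr \<alpha>) * ennreal ((cmod (fourier f \<xi>))\<^sup>2) \<partial>lborel)"

text \<open>Plancherel for each increment; then the r-integral is taken first at fixed frequency and
  gives \<open>levy_symbol\<close> at \<xi> \<bullet> \<theta>, which is homogeneous. Integrating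
  over \<theta> gives \<open>symbol\<close>.\<close>

lemma E_fourier:
  assumes f: "f \<in> test_functions"
  shows "ennreal ((2 * pi) ^ DIM('a)) * (2 * E f)
    = levy_symbol \<alpha> 1 * (\<integral>\<^sup>+\<xi>. symbol \<xi> * ennreal ((cmod (fourier f \<xi>))\<^sup>2) \<partial>lborel)"
proof -
  have [measurable]: "f \<in> borel_measurable borel" using f by (rule test_functions_borel)
  let ?q = "\<lambda>\<xi>. ennreal ((cmod (fourier f \<xi>))\<^sup>2)"
  let ?c = "ennreal ((2 * pi) ^ DIM('a))"
  have ray: "?c * ray_energy \<alpha> f \<theta> = levy_symbol \<alpha> 1 * (\<integral>\<^sup>+\<xi>. ennreal (\<bar>\<xi> \<bullet> \<theta>\<bar> powr \<alpha>) * ?q \<xi> \<partial>lborel)" for \<theta>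
  proof -
    have "?c * ray_energy \<alpha> f \<theta> = (\<integral>\<^sup>+r. ?c * (levy_weight \<alpha> r * trans_sq f (r *\<^sub>R \<theta>)) \<partial>lborel)"
      unfolding ray_energy_def by (rule nn_integral_cmult[symmetric]) measurable
    also have "\<dots> = (\<integral>\<^sup>+r. levy_weight \<alpha> r * (\<integral>\<^sup>+\<xi>. ennreal (2 - 2 * cos (\<xi> \<bullet> (r *\<^sub>R \<theta>))) * ?q \<xi> \<partial>lborel) \<partial>lborel)"
      by (intro nn_integral_cong) (simp only: trans_sq_fourier[OF f, symmetric] mult.left_commute)
    also have "\<dots> = (\<integral>\<^sup>+r. (\<integral>\<^sup>+\<xi>. levy_weight \<alpha> r * (ennreal (2 - 2 * cos (\<xi> \<bullet> (r *\<^sub>R \<theta>))) * ?q \<xi>) \<partial>lborel) \<partial>lborel)"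
      by (intro nn_integral_cong nn_integral_cmult[symmetric]) measurable
    also have "\<dots> = (\<integral>\<^sup>+\<xi>. (\<integral>\<^sup>+r. levy_weight \<alpha> r * (ennreal (2 - 2 * cos (\<xi> \<bullet> (r *\<^sub>R \<theta>))) * ?q \<xi>) \<partial>lborel) \<partial>lborel)"
      by (rule lborel_pair.Fubini') measurable
    also have "\<dots> = (\<integral>\<^sup>+\<xi>. levy_symbol \<alpha> (\<xi> \<bullet> \<theta>) * ?q \<xi> \<partial>lborel)"
      unfolding levy_symbol_def
      by (subst nn_integral_multc[symmetric]) (auto simp: mult.assoc)
    also have "\<dots> = (\<integral>\<^sup>+\<xi>. levy_symbol \<alpha> 1 * (ennreal (\<bar>\<xi> \<bullet> \<theta>\<bar> powr \<alpha>) * ?q \<xi>) \<partial>lborel)"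
      by (intro nn_integral_cong, subst levy_symbol_scale[OF alpha(1)]) (simp add: mult_ac)
    also have "\<dots> = levy_symbol \<alpha> 1 * (\<integral>\<^sup>+\<xi>. ennreal (\<bar>\<xi> \<bullet> \<theta>\<bar> powr \<alpha>) * ?q \<xi> \<partial>lborel)"
      by (rule nn_integral_cmult) measurable
    finally show ?thesis .
  qed
  have "?c * (2 * E f) = (\<integral>\<^sup>+\<theta>. ?c * ray_energy \<alpha> f \<theta> \<partial>\<nu>)"
    unfolding two_E by (rule nn_integral_cmult[symmetric]) measurable
  also have "\<dots> = levy_symbol \<alpha> 1 * (\<integral>\<^sup>+\<theta>. (\<integral>\<^sup>+\<xi>. ennreal (\<bar>\<xi> \<bullet> \<theta>\<bar> powr \<alpha>) * ?q \<xi> \<partial>lborel) \<partial>\<nu>)"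
    unfolding ray by (rule nn_integral_cmult) measurable
  also have "(\<integral>\<^sup>+\<theta>. (\<integral>\<^sup>+\<xi>. ennreal (\<bar>\<xi> \<bullet> \<theta>\<bar> powr \<alpha>) * ?q \<xi> \<partial>lborel) \<partial>\<nu>)
    = (\<integral>\<^sup>+\<xi>. (\<integral>\<^sup>+\<theta>. ennreal (\<bar>\<xi> \<bullet> \<theta>\<bar> powr \<alpha>) * ?q \<xi> \<partial>\<nu>) \<partial>lborel)"
    by (rule nu_pair.Fubini') measurable
  also have "\<dots> = (\<integral>\<^sup>+\<xi>. symbol \<xi> * ?q \<xi> \<partial>lborel)"
    unfolding symbol_def by (intro nn_integral_cong nn_integral_multc) measurable
  finally show ?thesis .
qed

lemma E_test_finite:
  assumes f: "f \<in> test_functions"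
  shows "E f < \<infinity>"
proof -
  obtain K where K: "K > 0" "\<And>h. trans_sq f h \<le> ennreal (K * min 1 ((norm h)\<^sup>2))"
    using trans_sq_test_bound[OF f] by metis
  let ?L = "\<integral>\<^sup>+r. levy_weight \<alpha> r * ennreal (min 1 (r\<^sup>2)) \<partial>lborel"
  have "(\<integral>\<^sup>+\<theta>. ray_energy \<alpha> f \<theta> \<partial>\<nu>) \<le> (\<integral>\<^sup>+\<theta>. ennreal K * ?L \<partial>\<nu>)"
  proof (rule nn_integral_mono_AE)
    show "AE \<theta> in \<nu>. ray_energy \<alpha> f \<theta> \<le> ennreal K * ?L"
      using unit
    proof eventually_elim
      case (elim \<theta>)
      have "ray_energy \<alpha> f \<theta> \<le> (\<integral>\<^sup>+r. ennreal K * (levy_weight \<alpha> r * ennreal (min 1 (r\<^sup>2))) \<partial>lborel)"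
        unfolding ray_energy_def
      proof (intro nn_integral_mono)
        fix r
        have "trans_sq f (r *\<^sub>R \<theta>) \<le> ennreal K * ennreal (min 1 (r\<^sup>2))"
          using K(2)[of "r *\<^sub>R \<theta>"] K(1) elim by (simp add: ennreal_mult')
        from mult_left_mono[OF this, of "levy_weight \<alpha> r"]
        show "levy_weight \<alpha> r * trans_sq f (r *\<^sub>R \<theta>) \<le> ennreal K * (levy_weight \<alpha> r * ennreal (min 1 (r\<^sup>2)))"
          by (simp add: mult.left_commute)
      qed
      also have "\<dots> = ennreal K * ?L" by (rule nn_integral_cmult) measurable
      finally show ?case .
    qed
  qed
  also have "\<dots> = ennreal K * ?L * emeasure \<nu> UNIV"
    using sets_eq_imp_space_eq[OF sets_nu] by simp
  also have "\<dots> < \<infinity>"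
    using nn_integral_min_levy_weight_finite[OF alpha] nu.emeasure_finite[of UNIV]
    by (simp add: ennreal_mult_eq_top_iff less_top[symmetric])
  finally show ?thesis
    by (simp add: E_def ennreal_divide_eq_top_iff less_top[symmetric])
qed

text \<open>Both inequalities compare multipliers under the integral of \<open>E_fourier\<close>.
  The passage to real numbers needs finiteness on both sides: for \<open>E f\<close> it is
  \<open>E_test_finite\<close>, for \<open>hdot_sq f\<close> it comes out of the lower bound
  itself.\<close>

lemma hdot_norm_equiv:
  obtains c C where "c > 0" "C > 0"
    "\<And>f. f \<in> test_functions \<Longrightarrow> c * (hdot_norm \<alpha> f)\<^sup>2 \<le> enn2real (E f)"
    "\<And>f. f \<in> test_functions \<Longrightarrow> enn2real (E f) \<le> C * (hdot_norm \<alpha> f)\<^sup>2"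
proof -
  define L where "L = enn2real (levy_symbol \<alpha> 1)"
  have L: "levy_symbol \<alpha> 1 = ennreal L" "L > 0"
    using levy_symbol_finite[OF alpha] levy_symbol_pos[of \<alpha>] by (auto simp: L_def enn2real_positive_iff)
  define m where "m = measure \<nu> UNIV"
  have m: "emeasure \<nu> UNIV = ennreal m" "m \<ge> 0" by (auto simp: m_def nu.emeasure_eq_measure)
  \<comment> \<open>Plancherel's constant, times 2 because \<open>E_fourier\<close> speaks of twice
    the energy. The \<open>m + 1\<close> below makes the upper constant visibly positive.\<close>
  define P where "P = (2 * pi) ^ DIM('a) * 2"
  have P: "P > 0" by (simp add: P_def)
  show ?thesis
  proof (rule that[of "L * c\<^sub>0 / P" "L * (m + 1) / P"])
    show "L * c\<^sub>0 / P > 0" "L * (m + 1) / P > 0" using L P c0 m by auto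
    fix f :: "'a \<Rightarrow> real" assume f: "f \<in> test_functions"
    have [measurable]: "f \<in> borel_measurable borel" using f by (rule test_functions_borel)
    define e where "e = enn2real (E f)"
    have e: "E f = ennreal e" "e \<ge> 0" using E_test_finite[OF f] by (auto simp: e_def)
    let ?q = "\<lambda>\<xi>. ennreal ((cmod (fourier f \<xi>))\<^sup>2)"
    have eq: "ennreal (P * e) = ennreal L * (\<integral>\<^sup>+\<xi>. symbol \<xi> * ?q \<xi> \<partial>lborel)"
      using E_fourier[OF f] e(2) by (simp add: e(1) L(1) P_def ennreal_mult mult.assoc)
    have "ennreal (L * c\<^sub>0) * hdot_sq f = ennreal L * (\<integral>\<^sup>+\<xi>. ennreal c\<^sub>0 * ennreal (norm \<xi> powr \<alpha>) * ?q \<xi> \<partial>lborel)"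
      unfolding hdot_sq_def using L c0 by (simp add: ennreal_mult mult.assoc nn_integral_cmult)
    also have "\<dots> \<le> ennreal L * (\<integral>\<^sup>+\<xi>. symbol \<xi> * ?q \<xi> \<partial>lborel)"
      by (intro mult_left_mono nn_integral_mono mult_right_mono symbol_ge) auto
    finally have lo: "ennreal (L * c\<^sub>0) * hdot_sq f \<le> ennreal (P * e)" by (simp add: eq)
    have "ennreal (P * e) \<le> ennreal L * (\<integral>\<^sup>+\<xi>. ennreal m * (ennreal (norm \<xi> powr \<alpha>) * ?q \<xi>) \<partial>lborel)"
      unfolding eq using symbol_le
      by (intro mult_left_mono nn_integral_mono) (auto simp: m(1) mult.assoc[symmetric] mult.commute[of "ennreal m"] intro!: mult_right_mono)
    also have "\<dots> = ennreal (L * m) * hdot_sq f"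
      unfolding hdot_sq_def using L m by (simp add: ennreal_mult mult.assoc nn_integral_cmult)
    finally have up: "ennreal (P * e) \<le> ennreal (L * m) * hdot_sq f" .
    have Hfin: "hdot_sq f < \<infinity>"
    proof (rule ccontr)
      assume "\<not> hdot_sq f < \<infinity>"
      then have "hdot_sq f = \<top>" by (simp add: less_top[symmetric])
      then show False using lo L c0 by (simp add: ennreal_mult_top top_unique)
    qed
    define d where "d = enn2real (hdot_sq f)"
    have d: "hdot_sq f = ennreal d" "d \<ge> 0" using Hfin by (auto simp: d_def)
    have int: "integrable lborel (\<lambda>\<xi>. norm \<xi> powr \<alpha> * (cmod (fourier f \<xi>))\<^sup>2)"
      using Hfin by (intro integrableI_bounded) (auto simp: hdot_sq_def ennreal_mult)
    have "ennreal (LINT \<xi>|lborel. norm \<xi> powr \<alpha> * (cmod (fourier f \<xi>))\<^sup>2) = hdot_sq f"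
      using int by (subst nn_integral_eq_integral[symmetric]) (auto simp: hdot_sq_def ennreal_mult)
    then have "(LINT \<xi>|lborel. norm \<xi> powr \<alpha> * (cmod (fourier f \<xi>))\<^sup>2) = d"
      using d by (simp add: ennreal_inj)
    then have hd: "(hdot_norm \<alpha> f)\<^sup>2 = d" using d by (simp add: hdot_norm_def)
    have "L * c\<^sub>0 * d \<le> P * e"
      using lo d L c0 P e by (simp add: ennreal_mult[symmetric])
    then show "L * c\<^sub>0 / P * (hdot_norm \<alpha> f)\<^sup>2 \<le> enn2real (E f)"
      using P by (simp add: hd e_def[symmetric] field_simps)
    have "P * e \<le> L * m * d"
      using up d L m P e by (simp add: ennreal_mult[symmetric])
    also have "\<dots> \<le> L * (m + 1) * d" using d L by (intro mult_right_mono) auto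
    finally show "enn2real (E f) \<le> L * (m + 1) / P * (hdot_norm \<alpha> f)\<^sup>2"
      using P by (simp add: hd e_def[symmetric] field_simps)
  qed
qed

end

section \<open>Directions adapted to a function\<close>

lemma nn_integral_translate:
  fixes f :: "'a::euclidean_space \<Rightarrow> ennreal"
  assumes "f \<in> borel_measurable borel"
  shows "(\<integral>\<^sup>+x. f (x - h) \<partial>lborel) = (\<integral>\<^sup>+x. f x \<partial>lborel)"
  using nn_integral_lborel_affine[OF assms, of 1 "- h"] by simp

text \<open>Serves to pass from averages over a parallelepiped to averages over a ball. The constant
  depends on \<kappa> alone, hence is the same for all the frames adapted to different
  functions.\<close>

lemma nn_integral_linear_le:
  fixes T :: "'a::euclidean_space \<Rightarrow> 'a" and f :: "'a \<Rightarrow> ennreal"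
  assumes T: "linear T" and \<kappa>: "\<kappa> > 0" "\<And>z. \<kappa> * norm z \<le> norm (T z)"
    and [measurable]: "f \<in> borel_measurable borel"
  shows "(\<integral>\<^sup>+z. f (T z) \<partial>lborel) \<le> ennreal ((1 / \<kappa>) ^ DIM('a)) * (\<integral>\<^sup>+y. f y \<partial>lborel)"
proof -
  have "inj T"
  proof (subst linear_injective_0[OF T], intro allI impI)
    fix z assume "T z = 0"
    then show "z = 0" using \<kappa>(2)[of z] \<kappa>(1) by (simp add: mult_le_0_iff)
  qed
  then have surj: "surj T" by (rule linear_inj_imp_surj[OF T])
  have [measurable]: "T \<in> borel_measurable borel"
    using linear_continuous_on[of T UNIV] T by (intro borel_measurable_continuous_onI) (simp add: linear_conv_bounded_linear)
  \<comment> \<open>Since \<open>T\<close> is onto, translation invariance makes \<open>\<integral> h (T z + y) dz\<close> independent of \<open>y\<close>; averaging over a unit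
     ball in \<open>y\<close> computes the Jacobian without determinants.\<close>
  have inv: "(\<integral>\<^sup>+z. h (y + T z) \<partial>lborel) = (\<integral>\<^sup>+z. h (T z) \<partial>lborel)"
    if [measurable]: "h \<in> borel_measurable borel" for h :: "'a \<Rightarrow> ennreal" and y
  proof -
    obtain w where "y = T w" using surj by (metis surjD)
    then have "(\<integral>\<^sup>+z. h (y + T z) \<partial>lborel) = (\<integral>\<^sup>+z. h (T (z - (- w))) \<partial>lborel)"
      by (simp add: linear_add[OF T] add.commute)
    also have "\<dots> = (\<integral>\<^sup>+z. h (T z) \<partial>lborel)" by (rule nn_integral_translate) measurable
    finally show ?thesis .
  qed
  define B where "B = cball (0::'a) 1"
  define g where "g y = (indicator B y :: ennreal)" for y
  have [measurable]: "g \<in> borel_measurable borel" unfolding g_def B_def by (intro borel_measurable_indicator) simp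
  define V where "V = unit_ball_vol (real DIM('a))"
  have V: "V > 0" by (simp add: V_def)
  have Vr: "emeasure lborel (cball (0::'a) r) = ennreal (V * r ^ DIM('a))" if "r > 0" for r
    unfolding V_def using that by (intro emeasure_cball) simp
  define I where "I = (\<integral>\<^sup>+z. f (T z) \<partial>lborel)"
  define G where "G = (\<integral>\<^sup>+z. g (- T z) \<partial>lborel)"
  have gV: "(\<integral>\<^sup>+y. g y \<partial>lborel) = ennreal V"
    using Vr[of 1] by (simp add: g_def B_def)
  have "ennreal V * I = (\<integral>\<^sup>+y. g y * I \<partial>lborel)"
    by (simp add: nn_integral_multc gV)
  also have "\<dots> = (\<integral>\<^sup>+y. (\<integral>\<^sup>+z. g y * f (y + T z) \<partial>lborel) \<partial>lborel)"
    by (intro nn_integral_cong) (simp add: nn_integral_cmult inv I_def)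
  also have "\<dots> = (\<integral>\<^sup>+z. (\<integral>\<^sup>+y. g y * f (y + T z) \<partial>lborel) \<partial>lborel)"
    by (rule lborel_pair.Fubini') measurable
  also have "\<dots> = (\<integral>\<^sup>+z. (\<integral>\<^sup>+y. g (y - T z) * f y \<partial>lborel) \<partial>lborel)"
  proof (rule nn_integral_cong)
    fix z
    have "(\<integral>\<^sup>+y. g (y - T z) * f (y - T z + T z) \<partial>lborel) = (\<integral>\<^sup>+y. g y * f (y + T z) \<partial>lborel)"
      by (rule nn_integral_translate[where f="\<lambda>y. g y * f (y + T z)"]) measurable
    then show "(\<integral>\<^sup>+y. g y * f (y + T z) \<partial>lborel) = (\<integral>\<^sup>+y. g (y - T z) * f y \<partial>lborel)" by simp
  qed
  also have "\<dots> = (\<integral>\<^sup>+y. (\<integral>\<^sup>+z. g (y - T z) * f y \<partial>lborel) \<partial>lborel)"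
    by (rule lborel_pair.Fubini') measurable
  also have "\<dots> = (\<integral>\<^sup>+y. G * f y \<partial>lborel)"
  proof (rule nn_integral_cong)
    fix y
    have "(\<integral>\<^sup>+z. g (- (- y + T z)) \<partial>lborel) = G"
      unfolding G_def by (rule inv[where h="\<lambda>x. g (- x)"]) measurable
    then show "(\<integral>\<^sup>+z. g (y - T z) * f y \<partial>lborel) = G * f y" by (simp add: nn_integral_multc)
  qed
  also have "\<dots> = G * (\<integral>\<^sup>+y. f y \<partial>lborel)" by (rule nn_integral_cmult) measurable
  \<comment> \<open>Here \<kappa> becomes quantitative: \<open>T z\<close> in the unit ball forces
    \<open>z\<close> into the ball of radius 1/\<kappa>.\<close>
  also have "G \<le> (\<integral>\<^sup>+z. indicator (cball (0::'a) (1 / \<kappa>)) z \<partial>lborel)"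
    unfolding G_def
  proof (rule nn_integral_mono)
    fix z
    have "norm z \<le> 1 / \<kappa>" if "norm (T z) \<le> 1"
      using \<kappa>(2)[of z] \<kappa>(1) that by (simp add: field_simps)
    then show "g (- T z) \<le> indicator (cball 0 (1 / \<kappa>)) z"
      by (simp add: g_def B_def indicator_def)
  qed
  also have "\<dots> = ennreal V * ennreal ((1 / \<kappa>) ^ DIM('a))"
    using Vr[of "1 / \<kappa>"] \<kappa>(1) V by (simp add: ennreal_mult)
  finally have "ennreal V * I \<le> ennreal V * ennreal ((1 / \<kappa>) ^ DIM('a)) * (\<integral>\<^sup>+y. f y \<partial>lborel)"
    by (simp add: mult_right_mono)
  then have "ennreal (1 / V) * (ennreal V * I) \<le> ennreal (1 / V) * (ennreal V * (ennreal ((1 / \<kappa>) ^ DIM('a)) * (\<integral>\<^sup>+y. f y \<partial>lborel)))"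
    unfolding mult.assoc by (rule mult_left_mono) simp
  moreover have cancel: "ennreal (1 / V) * (ennreal V * c) = c" for c
    using V by (simp add: mult.assoc[symmetric] ennreal_mult[symmetric])
  ultimately show ?thesis unfolding cancel I_def by simp
qed

lemma trans_sq_uminus:
  assumes [measurable]: "u \<in> borel_measurable borel"
  shows "trans_sq u (- h) = trans_sq u h"
proof -
  have "trans_sq u h = (\<integral>\<^sup>+x. ennreal ((u (x - - h) - u (x - - h - h))\<^sup>2) \<partial>lborel)"
    unfolding trans_sq_def by (rule nn_integral_translate[symmetric]) measurable
  then show ?thesis by (simp add: trans_sq_def power2_commute)
qed

lemma trans_sq_zero[simp]: "trans_sq u 0 = 0"
  by (simp add: trans_sq_def)

lemma trans_sq_add:
  assumes [measurable]: "u \<in> borel_measurable borel"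
  shows "trans_sq u (h + k) \<le> 2 * trans_sq u h + 2 * trans_sq u k"
proof -
  have "trans_sq u (h + k) \<le> (\<integral>\<^sup>+x. 2 * ennreal ((u x - u (x - h))\<^sup>2) + 2 * ennreal ((u (x - h) - u (x - h - k))\<^sup>2) \<partial>lborel)"
    unfolding trans_sq_def
  proof (rule nn_integral_mono)
    fix x
    have "(u x - u (x - (h + k)))\<^sup>2 \<le> 2 * (u x - u (x - h))\<^sup>2 + 2 * (u (x - h) - u (x - h - k))\<^sup>2"
      using sum_squares_bound[of "u x - u (x - h)" "u (x - h) - u (x - h - k)"]
      by (simp add: power2_eq_square algebra_simps)
    then have "ennreal ((u x - u (x - (h + k)))\<^sup>2) \<le> ennreal (2 * (u x - u (x - h))\<^sup>2 + 2 * (u (x - h) - u (x - h - k))\<^sup>2)"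
      by (rule ennreal_leI)
    then show "ennreal ((u x - u (x - (h + k)))\<^sup>2) \<le> 2 * ennreal ((u x - u (x - h))\<^sup>2) + 2 * ennreal ((u (x - h) - u (x - h - k))\<^sup>2)"
      by (simp add: ennreal_plus ennreal_mult)
  qed
  also have "\<dots> = 2 * trans_sq u h + 2 * (\<integral>\<^sup>+x. ennreal ((u (x - h) - u (x - h - k))\<^sup>2) \<partial>lborel)"
    unfolding trans_sq_def by (subst nn_integral_add) (auto simp: nn_integral_cmult)
  also have "(\<integral>\<^sup>+x. ennreal ((u (x - h) - u (x - h - k))\<^sup>2) \<partial>lborel) = trans_sq u k"
    unfolding trans_sq_def by (rule nn_integral_translate) measurable
  finally show ?thesis .
qed

text \<open>Each use of (a+b)^2 \<le> 2a^2 + 2b^2 doubles the constant. The loss is harmless, since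
  the number of summands will always be the dimension.\<close>

lemma trans_sq_sum:
  assumes [measurable]: "u \<in> borel_measurable borel" and "finite F"
  shows "trans_sq u (\<Sum>i\<in>F. h i) \<le> 2 ^ card F * (\<Sum>i\<in>F. trans_sq u (h i))"
  using assms(2)
proof (induction F)
  case (insert i F)
  have "trans_sq u (\<Sum>i\<in>insert i F. h i) \<le> 2 * trans_sq u (h i) + 2 * trans_sq u (\<Sum>i\<in>F. h i)"
    using insert trans_sq_add[OF assms(1)] by simp
  also have "\<dots> \<le> 2 * (2 ^ card F * trans_sq u (h i)) + 2 * (2 ^ card F * (\<Sum>i\<in>F. trans_sq u (h i)))"
  proof (intro add_mono mult_left_mono)
    have "1 * trans_sq u (h i) \<le> 2 ^ card F * trans_sq u (h i)" by (intro mult_right_mono one_le_power) auto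
    then show "trans_sq u (h i) \<le> 2 ^ card F * trans_sq u (h i)" by simp
  qed (use insert in auto)
  also have "\<dots> = 2 ^ card (insert i F) * (\<Sum>i\<in>insert i F. trans_sq u (h i))"
    using insert by (simp add: distrib_left mult.assoc)
  finally show ?case .
qed simp

lemma ray_energy_scale:
  assumes [measurable]: "u \<in> borel_measurable borel" and s: "s > 0"
  shows "(\<integral>\<^sup>+r. levy_weight \<alpha> r * trans_sq u ((r * s) *\<^sub>R \<theta>) \<partial>lborel) = ennreal (s powr \<alpha>) * ray_energy \<alpha> u \<theta>"
proof -
  have "ray_energy \<alpha> u \<theta> = ennreal \<bar>s\<bar> * (\<integral>\<^sup>+r. levy_weight \<alpha> (0 + s * r) * trans_sq u ((0 + s * r) *\<^sub>R \<theta>) \<partial>lborel)"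
    unfolding ray_energy_def using s by (intro nn_integral_real_affine) auto
  also have "\<dots> = ennreal s * (\<integral>\<^sup>+r. ennreal (s powr (- 1 - \<alpha>)) * (levy_weight \<alpha> r * trans_sq u ((r * s) *\<^sub>R \<theta>)) \<partial>lborel)"
  proof -
    have "levy_weight \<alpha> (r * s) = ennreal (s powr (- 1 - \<alpha>)) * levy_weight \<alpha> r" for r
      using levy_weight_scale[OF s, of \<alpha> r] by (simp add: mult.commute)
    then show ?thesis using s by (simp add: mult.assoc mult.commute[of s])
  qed
  also have "\<dots> = ennreal s * ennreal (s powr (- 1 - \<alpha>)) * (\<integral>\<^sup>+r. levy_weight \<alpha> r * trans_sq u ((r * s) *\<^sub>R \<theta>) \<partial>lborel)"
    by (subst nn_integral_cmult) (auto simp: mult.assoc)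
  also have "ennreal s * ennreal (s powr (- 1 - \<alpha>)) = ennreal (s powr (- \<alpha>))"
    using s by (simp add: ennreal_mult[symmetric] powr_mult_base)
  finally have "ennreal (s powr \<alpha>) * ray_energy \<alpha> u \<theta> = ennreal (s powr \<alpha>) * ennreal (s powr (- \<alpha>)) * (\<integral>\<^sup>+r. levy_weight \<alpha> r * trans_sq u ((r * s) *\<^sub>R \<theta>) \<partial>lborel)"
    by (simp only: mult.assoc)
  also have "ennreal (s powr \<alpha>) * ennreal (s powr (- \<alpha>)) = 1"
    using s by (simp add: ennreal_mult[symmetric] powr_add[symmetric])
  finally show ?thesis by simp
qed

text \<open>A step of length r splits as s + (r - s) for every s in (0, r). Averaging over s
  replaces the value at the single point r by an integral over shorter steps, where
  \<open>levy_weight\<close> is at least r^(-1-\<alpha>). The factor 4 is 2 + 2, from the two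
  halves.\<close>

lemma trans_sq_le_ray_energy:
  assumes [measurable]: "u \<in> borel_measurable borel" and r: "r > 0" and "\<alpha> > 0"
  shows "trans_sq u (r *\<^sub>R \<theta>) \<le> ennreal (4 * r powr \<alpha>) * ray_energy \<alpha> u \<theta>"
proof -
  let ?w = "\<lambda>s. trans_sq u (s *\<^sub>R \<theta>)"
  have "ennreal r * ?w r = (\<integral>\<^sup>+s. ?w r * indicator {0<..<r} s \<partial>lborel)"
    using r by (subst nn_integral_cmult_indicator) (auto simp: mult.commute)
  also have "\<dots> \<le> (\<integral>\<^sup>+s. 2 * (?w s * indicator {0<..<r} s) + 2 * (?w (r - s) * indicator {0<..<r} s) \<partial>lborel)"
  proof (rule nn_integral_mono)
    fix s
    show "?w r * indicator {0<..<r} s \<le> 2 * (?w s * indicator {0<..<r} s) + 2 * (?w (r - s) * indicator {0<..<r} s)"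
      using trans_sq_add[OF assms(1), of "s *\<^sub>R \<theta>" "(r - s) *\<^sub>R \<theta>"]
      by (auto simp: indicator_def scaleR_left.diff)
  qed
  also have "\<dots> = 2 * (\<integral>\<^sup>+s. ?w s * indicator {0<..<r} s \<partial>lborel) + 2 * (\<integral>\<^sup>+s. ?w (r - s) * indicator {0<..<r} s \<partial>lborel)"
    by (subst nn_integral_add) (auto simp: nn_integral_cmult)
  also have "(\<integral>\<^sup>+s. ?w (r - s) * indicator {0<..<r} s \<partial>lborel) = (\<integral>\<^sup>+s. ?w s * indicator {0<..<r} s \<partial>lborel)"
  proof -
    have "(\<integral>\<^sup>+s. ?w s * indicator {0<..<r} s \<partial>lborel) = ennreal \<bar>-1\<bar> * (\<integral>\<^sup>+s. ?w (r + -1 * s) * indicator {0<..<r} (r + -1 * s) \<partial>lborel)"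
      by (rule nn_integral_real_affine) auto
    also have "\<dots> = (\<integral>\<^sup>+s. ?w (r - s) * indicator {0<..<r} s \<partial>lborel)"
      by (auto intro!: nn_integral_cong simp: indicator_def)
    finally show ?thesis by simp
  qed
  also have "2 * (\<integral>\<^sup>+s. ?w s * indicator {0<..<r} s \<partial>lborel) + 2 * (\<integral>\<^sup>+s. ?w s * indicator {0<..<r} s \<partial>lborel)
      = 4 * (\<integral>\<^sup>+s. ?w s * indicator {0<..<r} s \<partial>lborel)"
    by (simp add: distrib_right[symmetric])
  also have "\<dots> \<le> 4 * (\<integral>\<^sup>+s. ennreal (r powr (1 + \<alpha>)) * (levy_weight \<alpha> s * ?w s) \<partial>lborel)"
  proof (intro mult_left_mono nn_integral_mono)
    fix s
    show "?w s * indicator {0<..<r} s \<le> ennreal (r powr (1 + \<alpha>)) * (levy_weight \<alpha> s * ?w s)"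
    proof (cases "s \<in> {0<..<r}")
      case True
      have "1 = s powr (1 + \<alpha>) * s powr (- 1 - \<alpha>)" using True by (simp add: powr_add[symmetric])
      also have "\<dots> \<le> r powr (1 + \<alpha>) * s powr (- 1 - \<alpha>)"
        using True assms by (intro mult_right_mono powr_mono2) auto
      finally have "ennreal 1 \<le> ennreal (r powr (1 + \<alpha>)) * levy_weight \<alpha> s"
        using True unfolding levy_weight_def by (auto simp: ennreal_mult[symmetric] simp del: ennreal_1 intro!: ennreal_leI)
      from mult_right_mono[OF this, of "?w s"] show ?thesis using True by (simp add: mult.assoc)
    qed simp
  qed simp
  also have "\<dots> = 4 * (ennreal (r powr (1 + \<alpha>)) * ray_energy \<alpha> u \<theta>)"
    unfolding ray_energy_def by (subst nn_integral_cmult) auto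
  finally have "ennreal (1 / r) * (ennreal r * ?w r) \<le> ennreal (1 / r) * (4 * (ennreal (r powr (1 + \<alpha>)) * ray_energy \<alpha> u \<theta>))"
    by (intro mult_left_mono) auto
  moreover have "ennreal (1 / r) * (ennreal r * ?w r) = ?w r"
    using r by (simp add: mult.assoc[symmetric] ennreal_mult[symmetric])
  moreover have "ennreal (1 / r) * (4 * (ennreal (r powr (1 + \<alpha>)) * ray_energy \<alpha> u \<theta>)) = ennreal (4 * r powr \<alpha>) * ray_energy \<alpha> u \<theta>"
  proof -
    have "ennreal (1 / r) * (4 * ennreal (r powr (1 + \<alpha>))) = ennreal (1 / r * (4 * r powr (1 + \<alpha>)))"
      using r by (subst ennreal_mult) (simp_all add: ennreal_mult)
    also have "1 / r * (4 * r powr (1 + \<alpha>)) = 4 * r powr \<alpha>" using r by (simp add: powr_add)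
    finally show ?thesis by (simp only: mult.assoc[symmetric])
  qed
  ultimately show ?thesis by simp
qed

text \<open>Think of a = u(x), with F the mean squared deviation from a and H the mean square of u
  over a cell of size t. Beyond the scale where H has fallen to a^2/4, F stays above a^2/4; one
  dyadic interval there has weight of order t^(-\<alpha>), which is a power of a^2/M. Hence the
  exponent 2 + 2\<alpha>/\<beta>.\<close>

lemma hedberg:
  fixes F H :: "real \<Rightarrow> ennreal" and a M \<alpha> \<beta> :: real
  assumes \<alpha>: "\<alpha> > 0" and \<beta>: "\<beta> > 0" and M: "M > 0"
    and [measurable]: "F \<in> borel_measurable borel"
    and dec: "\<And>t. t > 0 \<Longrightarrow> ennreal (a\<^sup>2) \<le> 2 * F t + 2 * H t"
    and H: "\<And>t. t > 0 \<Longrightarrow> H t \<le> ennreal (M * t powr (- \<beta>))"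
  shows "ennreal (\<bar>a\<bar> powr (2 + 2 * \<alpha> / \<beta>))
    \<le> ennreal (2 powr (3 + \<alpha>) * (4 * M) powr (\<alpha> / \<beta>)) * (\<integral>\<^sup>+t. levy_weight \<alpha> t * F t \<partial>lborel)"
proof (cases "a = 0")
  case False
  \<comment> \<open>Solves M t0^(-\<beta>) = a^2/4, so that from t0 on the term 2 H takes up at most
    half of a^2.\<close>
  define t0 where "t0 = (4 * M / a\<^sup>2) powr (1 / \<beta>)"
  have t0: "t0 > 0" using False M by (simp add: t0_def)
  have t0b: "t0 powr (- \<beta>) = a\<^sup>2 / (4 * M)"
    using False M \<beta> by (simp add: t0_def powr_powr powr_minus_divide)
  have t0a: "t0 powr (- \<alpha>) = (a\<^sup>2) powr (\<alpha> / \<beta>) / (4 * M) powr (\<alpha> / \<beta>)"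
  proof -
    have "t0 powr (- \<alpha>) = (4 * M / a\<^sup>2) powr (- (\<alpha> / \<beta>))" by (simp add: t0_def powr_powr)
    then show ?thesis using False M by (simp add: powr_divide powr_minus_divide)
  qed
  have F: "ennreal (a\<^sup>2 / 4) \<le> F t" if "t \<ge> t0" for t
  proof -
    have t: "t > 0" using that t0 by linarith
    have "t powr (- \<beta>) \<le> t0 powr (- \<beta>)" using that t0 \<beta> by (intro powr_mono2') auto
    then have "M * t powr (- \<beta>) \<le> a\<^sup>2 / 4" using M by (simp add: t0b field_simps)
    then have "H t \<le> ennreal (a\<^sup>2 / 4)" using H[OF t] ennreal_leI order_trans by blast
    then have "2 * H t \<le> 2 * ennreal (a\<^sup>2 / 4)" by (rule mult_left_mono) simp
    also have "\<dots> = ennreal (a\<^sup>2 / 2)" by (subst ennreal_numeral[symmetric], subst ennreal_mult[symmetric]) auto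
    finally have *: "ennreal (a\<^sup>2) \<le> 2 * F t + ennreal (a\<^sup>2 / 2)" using dec[OF t] by (meson add_left_mono order_trans)
    show ?thesis
    proof (cases "F t")
      case (real f)
      then have "2 * F t = ennreal (2 * f)" by (simp add: ennreal_mult)
      with * real have "a\<^sup>2 \<le> 2 * f + a\<^sup>2 / 2" by (simp add: ennreal_plus[symmetric] del: ennreal_plus)
      then show ?thesis using real by (auto intro: ennreal_leI)
    qed simp
  qed
  have "ennreal ((2 * t0) powr (- 1 - \<alpha>) * (a\<^sup>2 / 4)) * emeasure lborel {t0..2 * t0} =
      (\<integral>\<^sup>+t. ennreal ((2 * t0) powr (- 1 - \<alpha>) * (a\<^sup>2 / 4)) * indicator {t0..2 * t0} t \<partial>lborel)"
    by (subst nn_integral_cmult_indicator) auto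
  also have "\<dots> \<le> (\<integral>\<^sup>+t. levy_weight \<alpha> t * F t \<partial>lborel)"
  proof (rule nn_integral_mono)
    fix t
    show "ennreal ((2 * t0) powr (- 1 - \<alpha>) * (a\<^sup>2 / 4)) * indicator {t0..2 * t0} t \<le> levy_weight \<alpha> t * F t"
    proof (cases "t \<in> {t0..2 * t0}")
      case True
      then have "(2 * t0) powr (- 1 - \<alpha>) \<le> t powr (- 1 - \<alpha>)"
        using t0 \<alpha> by (intro powr_mono2') auto
      then have "ennreal ((2 * t0) powr (- 1 - \<alpha>)) \<le> levy_weight \<alpha> t"
        using True t0 by (auto simp: levy_weight_def intro: ennreal_leI)
      then have "ennreal ((2 * t0) powr (- 1 - \<alpha>)) * ennreal (a\<^sup>2 / 4) \<le> levy_weight \<alpha> t * F t"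
        using True F[of t] by (intro mult_mono) auto
      then show ?thesis using True by (simp add: ennreal_mult[symmetric])
    qed simp
  qed
  finally have "ennreal ((2 * t0) powr (- 1 - \<alpha>) * (a\<^sup>2 / 4) * t0) \<le> (\<integral>\<^sup>+t. levy_weight \<alpha> t * F t \<partial>lborel)"
    using t0 by (subst ennreal_mult) auto
  then have le: "ennreal (2 powr (3 + \<alpha>) * (4 * M) powr (\<alpha> / \<beta>)) * ennreal ((2 * t0) powr (- 1 - \<alpha>) * (a\<^sup>2 / 4) * t0)
    \<le> ennreal (2 powr (3 + \<alpha>) * (4 * M) powr (\<alpha> / \<beta>)) * (\<integral>\<^sup>+t. levy_weight \<alpha> t * F t \<partial>lborel)"
    by (intro mult_left_mono) auto
  have "(2 * t0) powr (- 1 - \<alpha>) * t0 = 2 powr (- 1 - \<alpha>) * t0 powr (- \<alpha>)"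
  proof -
    have "t0 powr (- \<alpha>) = t0 powr (- 1 - \<alpha>) * t0 powr 1" unfolding powr_add[symmetric] by simp
    then show ?thesis using t0 by (simp add: powr_mult)
  qed
  then have "2 powr (3 + \<alpha>) * (4 * M) powr (\<alpha> / \<beta>) * ((2 * t0) powr (- 1 - \<alpha>) * (a\<^sup>2 / 4) * t0)
     = (2 powr (3 + \<alpha>) * 2 powr (- 1 - \<alpha>) / 4) * ((4 * M) powr (\<alpha> / \<beta>) * t0 powr (- \<alpha>)) * a\<^sup>2"
    by (simp add: mult_ac)
  also have "2 powr (3 + \<alpha>) * 2 powr (- 1 - \<alpha>) / 4 = (1::real)"
    by (simp add: powr_add[symmetric])
  also have "(4 * M) powr (\<alpha> / \<beta>) * t0 powr (- \<alpha>) = (a\<^sup>2) powr (\<alpha> / \<beta>)"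
    using M by (simp add: t0a)
  also have "1 * (a\<^sup>2) powr (\<alpha> / \<beta>) * a\<^sup>2 = \<bar>a\<bar> powr (2 + 2 * \<alpha> / \<beta>)"
  proof -
    have abs_a: "\<bar>a\<bar> powr 2 = a\<^sup>2" using False by simp
    then have a2: "(a\<^sup>2) powr (\<alpha> / \<beta>) = (\<bar>a\<bar> powr 2) powr (\<alpha> / \<beta>)" by simp
    note abs_a
    moreover have "(\<bar>a\<bar> powr 2) powr (\<alpha> / \<beta>) = \<bar>a\<bar> powr (2 * \<alpha> / \<beta>)" by (simp only: powr_powr times_divide_eq_right)
    ultimately show ?thesis unfolding a2 powr_add[of "\<bar>a\<bar>" 2 "2 * \<alpha> / \<beta>"] by (simp only: mult_1 mult.commute)
  qed
  finally have "ennreal (2 powr (3 + \<alpha>) * (4 * M) powr (\<alpha> / \<beta>)) * ennreal ((2 * t0) powr (- 1 - \<alpha>) * (a\<^sup>2 / 4) * t0)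
    = ennreal (\<bar>a\<bar> powr (2 + 2 * \<alpha> / \<beta>))"
    using t0 by (simp add: ennreal_mult[symmetric])
  with le show ?thesis by simp
qed simp

lemma finite_min_pos:
  fixes f :: "'b \<Rightarrow> ennreal"
  assumes "finite A" "\<And>x. x \<in> A \<Longrightarrow> f x > 0"
  obtains a :: real where "a > 0" "\<And>x. x \<in> A \<Longrightarrow> ennreal a \<le> f x"
proof -
  \<comment> \<open>The inserted 1 makes the minimum exist for empty \<open>A\<close> and keeps it
    finite.\<close>
  define m where "m = Min (insert 1 (f ` A))"
  have m: "m > 0" "m \<le> 1" "\<And>x. x \<in> A \<Longrightarrow> m \<le> f x"
    using assms by (auto simp: m_def)
  have mt: "m < \<top>" by (rule le_less_trans[OF m(2)]) simp
  then have e: "ennreal (enn2real m) = m" by simp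
  show ?thesis
    by (rule that[of "enn2real m"]) (use m mt in \<open>auto simp: e enn2real_positive_iff\<close>)
qed

lemma norm_le_of_mem_cube: "z \<in> cbox 0 One \<Longrightarrow> norm z \<le> real DIM('a)" for z :: "'a::euclidean_space"
proof -
  assume z: "z \<in> cbox 0 One"
  have "norm z \<le> (\<Sum>b\<in>Basis. \<bar>z \<bullet> b\<bar>)" by (rule norm_le_l1)
  also have "\<dots> \<le> (\<Sum>b\<in>(Basis::'a set). 1)" using z by (intro sum_mono) (auto simp: mem_box)
  finally show ?thesis by simp
qed

lemma frame_linear:
  fixes \<theta> :: "'a::euclidean_space \<Rightarrow> 'a"
  shows "linear (\<lambda>z. \<Sum>b\<in>Basis. (z \<bullet> b) *\<^sub>R \<theta> b)"
proof (rule linearI)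
  fix x y :: 'a and r :: real
  show "(\<Sum>b\<in>Basis. ((x + y) \<bullet> b) *\<^sub>R \<theta> b) = (\<Sum>b\<in>Basis. (x \<bullet> b) *\<^sub>R \<theta> b) + (\<Sum>b\<in>Basis. (y \<bullet> b) *\<^sub>R \<theta> b)"
    by (simp only: inner_add_left scaleR_left_distrib sum.distrib)
  show "(\<Sum>b\<in>Basis. ((r *\<^sub>R x) \<bullet> b) *\<^sub>R \<theta> b) = r *\<^sub>R (\<Sum>b\<in>Basis. (x \<bullet> b) *\<^sub>R \<theta> b)"
    by (simp only: scaleR_sum_right inner_scaleR_left scaleR_scaleR)
qed

context levy
begin

interpretation nu: finite_measure \<nu> by (rule finite_nu)

text \<open>The support of the measure has full mass, so if it lay in a hyperplane, the unit normal
  would violate non-degeneracy. It therefore contains a basis. Invertibility survives small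
  perturbations, so each direction may be moved within a small ball, which has positive measure,
  with one \<kappa> for all choices.\<close>

lemma spanning_directions:
  obtains \<theta>\<^sub>0 :: "'a \<Rightarrow> 'a" and \<epsilon> \<kappa> :: real where "\<epsilon> > 0" "\<kappa> > 0" "\<epsilon> \<le> 1"
    "\<forall>b\<in>Basis. emeasure \<nu> (ball (\<theta>\<^sub>0 b) \<epsilon>) > 0"
    "\<forall>\<theta> z. (\<forall>b\<in>Basis. \<theta> b \<in> ball (\<theta>\<^sub>0 b) \<epsilon>) \<longrightarrow> \<kappa> * norm z \<le> norm (\<Sum>b\<in>Basis. (z \<bullet> b) *\<^sub>R \<theta> b)"
proof -
  define S where "S = {x. \<forall>e>0. emeasure \<nu> (ball x e) > 0}"
  \<comment> \<open>The complement of the support \<open>S\<close> is a union of null balls;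
    Lindelof's theorem reduces it to countably many of them.\<close>
  define \<F> where "\<F> = {ball x e |x e. emeasure \<nu> (ball x e) = 0}"
  obtain \<F>' where F: "\<F>' \<subseteq> \<F>" "countable \<F>'" "\<Union>\<F>' = \<Union>\<F>"
    using Lindelof[of \<F>] by (auto simp: \<F>_def)
  have "\<Union>\<F>' \<in> null_sets \<nu>"
    using F(1) by (intro null_sets_UN'[OF F(2), of "\<lambda>x. x", simplified]) (auto simp: \<F>_def null_sets_def sets_nu)
  moreover have "- S \<subseteq> \<Union>\<F>'"
  proof
    fix x assume "x \<in> - S"
    then obtain e where "e > 0" "emeasure \<nu> (ball x e) = 0" by (auto simp: S_def)
    then show "x \<in> \<Union>\<F>'" unfolding F(3) \<F>_def by force
  qed
  ultimately have aeS: "AE \<theta> in \<nu>. \<theta> \<in> S"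
    by (intro AE_I[of _ _ "\<Union>\<F>'"]) (auto simp: null_sets_def)
  have span: "span S = UNIV"
  proof (rule ccontr)
    assume "span S \<noteq> UNIV"
    then obtain a where a: "a \<noteq> 0" "\<forall>x\<in>span S. a \<bullet> x = 0" using span_not_UNIV_orthogonal by blast
    define \<zeta> where "\<zeta> = a /\<^sub>R norm a"
    have "norm \<zeta> = 1" using a by (simp add: \<zeta>_def)
    from nondeg[OF this] have "ennreal c\<^sub>0 \<le> (\<integral>\<^sup>+\<theta>. ennreal (\<bar>\<zeta> \<bullet> \<theta>\<bar> powr \<alpha>) \<partial>\<nu>)" .
    also have "\<dots> = (\<integral>\<^sup>+\<theta>. 0 \<partial>\<nu>)"
    proof (rule nn_integral_cong_AE)
      show "AE \<theta> in \<nu>. ennreal (\<bar>\<zeta> \<bullet> \<theta>\<bar> powr \<alpha>) = 0"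
        using aeS by eventually_elim (use a(2) span_base in \<open>auto simp: \<zeta>_def\<close>)
    qed
    finally show False using c0 by simp
  qed
  obtain B where B: "B \<subseteq> S" "independent B" "S \<subseteq> span B" "card B = dim S" using basis_exists[of S] by metis
  have dimS: "dim S = DIM('a)" using span by (metis dim_UNIV dim_span)
  have spanB: "span B = UNIV" using B(3) span by (metis span_mono span_span top.extremum_uniqueI)
  have "finite B" using B(2) independent_imp_finite by blast
  then obtain \<theta>\<^sub>0 where bij: "bij_betw \<theta>\<^sub>0 (Basis::'a set) B"
    using finite_same_card_bij[of "Basis::'a set" B] B(4) dimS by auto
  define T where "T = (\<lambda>z. \<Sum>b\<in>Basis. (z \<bullet> b) *\<^sub>R \<theta>\<^sub>0 b)"
  have linT: "linear T"
    unfolding T_def by (rule frame_linear)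
  have Tb: "T b = \<theta>\<^sub>0 b" if "b \<in> Basis" for b
  proof -
    have "T b = (\<Sum>c\<in>Basis. if c = b then \<theta>\<^sub>0 b else 0)"
      unfolding T_def using that by (intro sum.cong) (auto simp: inner_Basis)
    then show ?thesis using that by simp
  qed
  have "B \<subseteq> range T"
    using bij Tb by (auto simp: bij_betw_def image_iff) (metis imageE rangeI)
  then have "span B \<subseteq> range T"
    by (rule span_minimal) (simp add: linear_subspace_image[OF linT] subspace_UNIV)
  then have "surj T" using spanB by auto
  then have "inj T" by (rule linear_surj_imp_inj[OF linT])
  then obtain k where k: "k > 0" "\<And>z. k * norm z \<le> norm (T z)"
    using linear_inj_bounded_below_pos[OF linT] by metis
  \<comment> \<open>Moving each of the N basis vectors by \<epsilon> changes \<open>T z\<close> by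
    at most N \<epsilon> |z|, which is kept at half of the lower bound k |z|.\<close>
  define \<epsilon> where "\<epsilon> = min 1 (k / (2 * real DIM('a)))"
  have e: "\<epsilon> > 0" "\<epsilon> \<le> 1" "real DIM('a) * \<epsilon> \<le> k / 2"
  proof -
    show "\<epsilon> > 0" using k(1) by (simp add: \<epsilon>_def)
    have "real DIM('a) * \<epsilon> \<le> real DIM('a) * (k / (2 * real DIM('a)))"
      by (intro mult_left_mono) (auto simp: \<epsilon>_def)
    then show "real DIM('a) * \<epsilon> \<le> k / 2" by simp
  qed (simp add: \<epsilon>_def)
  show ?thesis
  proof (rule that[of \<epsilon> "k / 2" \<theta>\<^sub>0])
    show "\<epsilon> > 0" "k / 2 > 0" "\<epsilon> \<le> 1" using e k by auto
    show "\<forall>b\<in>Basis. emeasure \<nu> (ball (\<theta>\<^sub>0 b) \<epsilon>) > 0"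
    proof
      fix b :: 'a assume b: "b \<in> Basis"
      have "\<theta>\<^sub>0 b \<in> S" using bij b B(1) by (auto simp: bij_betw_def)
      then show "emeasure \<nu> (ball (\<theta>\<^sub>0 b) \<epsilon>) > 0" using e by (simp add: S_def)
    qed
    show "\<forall>\<theta> z. (\<forall>b\<in>Basis. \<theta> b \<in> ball (\<theta>\<^sub>0 b) \<epsilon>) \<longrightarrow> k / 2 * norm z \<le> norm (\<Sum>b\<in>Basis. (z \<bullet> b) *\<^sub>R \<theta> b)"
    proof (intro allI impI)
    fix \<theta> :: "'a \<Rightarrow> 'a" and z assume th: "\<forall>b\<in>Basis. \<theta> b \<in> ball (\<theta>\<^sub>0 b) \<epsilon>"
    have "norm (T z - (\<Sum>b\<in>Basis. (z \<bullet> b) *\<^sub>R \<theta> b)) = norm (\<Sum>b\<in>Basis. (z \<bullet> b) *\<^sub>R (\<theta>\<^sub>0 b - \<theta> b))"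
      by (simp add: T_def sum_subtractf scaleR_diff_right)
    also have "\<dots> \<le> (\<Sum>b\<in>(Basis::'a set). norm z * \<epsilon>)"
    proof (rule sum_norm_le)
      fix b :: 'a assume b: "b \<in> Basis"
      have "dist (\<theta>\<^sub>0 b) (\<theta> b) < \<epsilon>" using th b by auto
      then have "norm (\<theta>\<^sub>0 b - \<theta> b) \<le> \<epsilon>" by (simp add: dist_norm)
      then show "norm ((z \<bullet> b) *\<^sub>R (\<theta>\<^sub>0 b - \<theta> b)) \<le> norm z * \<epsilon>"
        using Basis_le_norm[OF b, of z] by (auto intro!: mult_mono)
    qed
    also have "\<dots> = norm z * (real DIM('a) * \<epsilon>)" by simp
    also have "\<dots> \<le> norm z * (k / 2)" using e by (intro mult_left_mono) auto
    finally have "norm (T z - (\<Sum>b\<in>Basis. (z \<bullet> b) *\<^sub>R \<theta> b)) \<le> norm z * (k / 2)" .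
    then show "k / 2 * norm z \<le> norm (\<Sum>b\<in>Basis. (z \<bullet> b) *\<^sub>R \<theta> b)"
      using k(2)[of z] norm_triangle_ineq2[of "T z" "\<Sum>b\<in>Basis. (z \<bullet> b) *\<^sub>R \<theta> b"]
      by (simp add: algebra_simps)
    qed
  qed
qed

text \<open>Markov's inequality: the mean of \<open>ray_energy\<close> over \<open>A\<close> is at
  most 2 E u / a. The threshold is twice that, so failure on all of \<open>A\<close> gives 4 E u
  \<le> 2 E u; the values 0 and infinity, which this leaves, are excluded by the strict
  inequality.\<close>

lemma ex_low_ray_energy:
  assumes [measurable]: "u \<in> borel_measurable borel" "A \<in> sets borel"
    and a: "a > 0" "ennreal a \<le> emeasure \<nu> A"
  shows "\<exists>\<theta>\<in>A. norm \<theta> = 1 \<and> ray_energy \<alpha> u \<theta> \<le> ennreal (4 / a) * E u"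
proof (rule ccontr)
  assume neg: "\<not> ?thesis"
  have gt: "AE \<theta> in \<nu>. \<theta> \<in> A \<longrightarrow> ennreal (4 / a) * E u < ray_energy \<alpha> u \<theta>"
    using unit by eventually_elim (use neg in auto)
  have ne: "\<not> (AE \<theta> in \<nu>. \<theta> \<notin> A)"
  proof
    assume "AE \<theta> in \<nu>. \<theta> \<notin> A"
    then have "emeasure \<nu> A = 0"
      by (subst (asm) AE_iff_null) (auto simp: sets_nu sets_eq_imp_space_eq[OF sets_nu])
    then show False using a by simp
  qed
  have "ennreal (4 / a) * E u * emeasure \<nu> A = (\<integral>\<^sup>+\<theta>. ennreal (4 / a) * E u * indicator A \<theta> \<partial>\<nu>)"
    by (subst nn_integral_cmult_indicator) auto
  also have "\<dots> \<le> (\<integral>\<^sup>+\<theta>. ray_energy \<alpha> u \<theta> \<partial>\<nu>)"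
    by (rule nn_integral_mono_AE) (use gt in \<open>eventually_elim, auto simp: indicator_def\<close>)
  also have "\<dots> = 2 * E u" by (simp add: two_E)
  finally have "ennreal (4 / a) * E u * emeasure \<nu> A \<le> 2 * E u" .
  then have "ennreal (4 / a) * E u * ennreal a \<le> 2 * E u"
    using a(2) by (meson mult_left_mono order_trans zero_le)
  moreover have "ennreal (4 / a) * E u * ennreal a = 4 * E u"
  proof -
    have "ennreal (4 / a) * ennreal a = 4" using a(1) by (simp add: ennreal_mult[symmetric])
    then show ?thesis by (metis mult.assoc mult.commute)
  qed
  ultimately have le: "4 * E u \<le> 2 * E u" by simp
  show False
  proof (cases "E u")
    case top
    have "AE \<theta> in \<nu>. \<theta> \<notin> A" using gt by eventually_elim (use top a(1) in \<open>auto simp: ennreal_mult_top\<close>)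
    then show False using ne by simp
  next
    case (real e)
    have "ennreal (4 * e) \<le> ennreal (2 * e)" using le real by (simp add: ennreal_mult)
    then have "e = 0" using real by simp
    then have "(\<integral>\<^sup>+\<theta>. ray_energy \<alpha> u \<theta> \<partial>\<nu>) = 0" using real two_E[of u] by simp
    then have "AE \<theta> in \<nu>. ray_energy \<alpha> u \<theta> = 0" by (subst (asm) nn_integral_0_iff_AE) auto
    then have "AE \<theta> in \<nu>. \<theta> \<notin> A" using gt by eventually_elim auto
    then show False using ne by simp
  qed
qed

text \<open>The directions depend on \<open>u\<close>, but the constants \<open>\<kappa>\<close> and \<open>C\<close> do not.\<close>

lemma adapted_frame:
  obtains \<kappa> C :: real where "\<kappa> > 0" "C > 0"
    "\<And>u. u \<in> borel_measurable borel \<Longrightarrow> \<exists>\<theta>::'a \<Rightarrow> 'a. (\<forall>b\<in>Basis. norm (\<theta> b) = 1 \<and> ray_energy \<alpha> u (\<theta> b) \<le> ennreal C * E u)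
       \<and> (\<forall>z. \<kappa> * norm z \<le> norm (\<Sum>b\<in>Basis. (z \<bullet> b) *\<^sub>R \<theta> b))"
proof -
  obtain \<theta>\<^sub>0 :: "'a \<Rightarrow> 'a" and \<epsilon> \<kappa> :: real where d: "\<epsilon> > 0" "\<kappa> > 0" "\<epsilon> \<le> 1"
    "\<forall>b\<in>Basis. emeasure \<nu> (ball (\<theta>\<^sub>0 b) \<epsilon>) > 0"
    "\<forall>\<theta> z. (\<forall>b\<in>Basis. \<theta> b \<in> ball (\<theta>\<^sub>0 b) \<epsilon>) \<longrightarrow> \<kappa> * norm z \<le> norm (\<Sum>b\<in>Basis. (z \<bullet> b) *\<^sub>R \<theta> b)"
    by (rule spanning_directions) (rule that)
  obtain a :: real where a: "a > 0" "\<And>b. b \<in> Basis \<Longrightarrow> ennreal a \<le> emeasure \<nu> (ball (\<theta>\<^sub>0 b) \<epsilon>)"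
    using finite_min_pos[of "Basis::'a set" "\<lambda>b. emeasure \<nu> (ball (\<theta>\<^sub>0 b) \<epsilon>)"] d(4) by auto
  show ?thesis
  proof (rule that[of \<kappa> "4 / a"])
    fix u :: "'a \<Rightarrow> real" assume u: "u \<in> borel_measurable borel"
    have "\<forall>b\<in>Basis. \<exists>\<theta>. \<theta> \<in> ball (\<theta>\<^sub>0 b) \<epsilon> \<and> norm \<theta> = 1 \<and> ray_energy \<alpha> u \<theta> \<le> ennreal (4 / a) * E u"
      using ex_low_ray_energy[OF u borel_open[OF open_ball] a(1) a(2)] by blast
    then obtain \<theta> where \<theta>: "\<And>b. b \<in> Basis \<Longrightarrow> \<theta> b \<in> ball (\<theta>\<^sub>0 b) \<epsilon> \<and> norm (\<theta> b) = 1 \<and> ray_energy \<alpha> u (\<theta> b) \<le> ennreal (4 / a) * E u"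
      by metis
    then show "\<exists>\<theta>::'a \<Rightarrow> 'a. (\<forall>b\<in>Basis. norm (\<theta> b) = 1 \<and> ray_energy \<alpha> u (\<theta> b) \<le> ennreal (4 / a) * E u)
       \<and> (\<forall>z. \<kappa> * norm z \<le> norm (\<Sum>b\<in>Basis. (z \<bullet> b) *\<^sub>R \<theta> b))"
      using d(5) by blast
  qed (use d a in auto)
qed

text \<open>Write h in the frame adapted to u, with coefficients at most |h|/\<kappa>, and add up
  the steps in single directions. The frame depends on u, the bound only on \<kappa> and C.\<close>

lemma translation_modulus:
  obtains C :: real where "C > 0"
    "\<And>u h. u \<in> borel_measurable borel \<Longrightarrow> trans_sq u h \<le> ennreal (C * norm h powr \<alpha>) * E u"
proof -
  obtain \<kappa> C :: real where kC: "\<kappa> > 0" "C > 0"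
    "\<And>u. u \<in> borel_measurable borel \<Longrightarrow> \<exists>\<theta>::'a \<Rightarrow> 'a. (\<forall>b\<in>Basis. norm (\<theta> b) = 1 \<and> ray_energy \<alpha> u (\<theta> b) \<le> ennreal C * E u)
       \<and> (\<forall>z. \<kappa> * norm z \<le> norm (\<Sum>b\<in>Basis. (z \<bullet> b) *\<^sub>R \<theta> b))" by (rule adapted_frame) (rule that)
  define n where "n = DIM('a)"
  \<comment> \<open>2^n is from \<open>trans_sq_sum\<close>, n counts the summands, 4 is from
    \<open>trans_sq_le_ray_energy\<close>, and the power of 1/\<kappa> from the length of each
    step.\<close>
  define K where "K = 2 ^ n * (real n * (4 * (1 / \<kappa>) powr \<alpha> * C))"
  show ?thesis
  proof (rule that[of K])
    show "K > 0" using kC by (simp add: K_def n_def)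
    fix u :: "'a \<Rightarrow> real" and h :: 'a assume u[measurable]: "u \<in> borel_measurable borel"
    obtain \<theta> :: "'a \<Rightarrow> 'a" where \<theta>: "\<And>b. b \<in> Basis \<Longrightarrow> ray_energy \<alpha> u (\<theta> b) \<le> ennreal C * E u"
      "\<And>z. \<kappa> * norm z \<le> norm (\<Sum>b\<in>Basis. (z \<bullet> b) *\<^sub>R \<theta> b)" using kC(3)[OF u] by metis
    define T where "T = (\<lambda>z. \<Sum>b\<in>Basis. (z \<bullet> b) *\<^sub>R \<theta> b)"
    have lin: "linear T" unfolding T_def by (rule frame_linear)
    have "inj T"
    proof (subst linear_injective_0[OF lin], intro allI impI)
      fix z assume "T z = 0"
      then show "z = 0" using \<theta>(2)[of z] kC(1) by (simp add: T_def mult_le_0_iff)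
    qed
    then have "surj T" by (rule linear_inj_imp_surj[OF lin])
    then obtain z where z: "h = T z" by (metis surjD)
    have zn: "norm z \<le> norm h * (1 / \<kappa>)" using \<theta>(2)[of z] kC(1) by (simp add: z T_def field_simps)
    have one: "trans_sq u ((z \<bullet> b) *\<^sub>R \<theta> b) \<le> ennreal (4 * (norm h powr \<alpha> * (1 / \<kappa>) powr \<alpha>)) * (ennreal C * E u)"
      if b: "b \<in> Basis" for b
    proof -
      have zb: "\<bar>z \<bullet> b\<bar> \<le> norm h * (1 / \<kappa>)" using Basis_le_norm[OF b, of z] zn by linarith
      have "trans_sq u ((z \<bullet> b) *\<^sub>R \<theta> b) = trans_sq u (\<bar>z \<bullet> b\<bar> *\<^sub>R \<theta> b)"
        using trans_sq_uminus[OF u, of "(z \<bullet> b) *\<^sub>R \<theta> b"] by (cases "z \<bullet> b \<ge> 0") auto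
      also have "\<dots> \<le> ennreal (4 * \<bar>z \<bullet> b\<bar> powr \<alpha>) * ray_energy \<alpha> u (\<theta> b)"
      proof (cases "z \<bullet> b = 0")
        case False
        then show ?thesis using alpha(1) by (intro trans_sq_le_ray_energy[OF u]) auto
      qed simp
      also have "\<dots> \<le> ennreal (4 * (norm h powr \<alpha> * (1 / \<kappa>) powr \<alpha>)) * (ennreal C * E u)"
      proof (intro mult_mono ennreal_leI mult_left_mono \<theta>(1)[OF b])
        show "\<bar>z \<bullet> b\<bar> powr \<alpha> \<le> norm h powr \<alpha> * (1 / \<kappa>) powr \<alpha>"
          unfolding powr_mult[symmetric] using zb alpha by (intro powr_mono2) auto
      qed auto
      finally show ?thesis .
    qed
    have "trans_sq u h \<le> 2 ^ n * (\<Sum>b\<in>Basis. trans_sq u ((z \<bullet> b) *\<^sub>R \<theta> b))"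
      unfolding z T_def n_def by (rule trans_sq_sum[OF u]) simp
    also have "\<dots> \<le> 2 ^ n * (\<Sum>b\<in>(Basis::'a set). ennreal (4 * (norm h powr \<alpha> * (1 / \<kappa>) powr \<alpha>)) * (ennreal C * E u))"
      by (intro mult_left_mono sum_mono one) auto
    also have "\<dots> = ennreal (2 ^ n) * (ennreal (real n) * (ennreal (4 * (norm h powr \<alpha> * (1 / \<kappa>) powr \<alpha>)) * (ennreal C * E u)))"
      by (simp add: n_def ennreal_of_nat_eq_real_of_nat ennreal_power[symmetric])
    also have "\<dots> = ennreal (K * norm h powr \<alpha>) * E u"
    proof -
      have "ennreal (K * norm h powr \<alpha>) = ennreal (2 ^ n * (real n * (4 * (norm h powr \<alpha> * (1 / \<kappa>) powr \<alpha>) * C)))"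
        by (simp add: K_def mult_ac)
      also have "\<dots> = ennreal (2 ^ n) * (ennreal (real n) * (ennreal (4 * (norm h powr \<alpha> * (1 / \<kappa>) powr \<alpha>)) * ennreal C))"
        by (simp only: ennreal_mult' zero_le_power zero_le_numeral of_nat_0_le_iff powr_ge_zero mult_nonneg_nonneg)
      finally show ?thesis by (simp only: mult.assoc)
    qed
    finally show "trans_sq u h \<le> ennreal (K * norm h powr \<alpha>) * E u" .
  qed
qed

end

section \<open>A refined Sobolev inequality\<close>

lemma cball_measurable[measurable]: "cball (x::'a::metric_space) r \<in> sets borel"
  by (intro borel_closed closed_cball)

text \<open>\<beta>/2 is the amplitude exponent of the scaling that leaves both the energy and the
  p-norm invariant. By \<open>p_eq\<close> the exponent in \<open>hedberg\<close> is then exactly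
  the critical one.\<close>

locale levy_critical = levy +
  fixes \<beta> p :: real
  assumes beta_def: "\<beta> = real DIM('a) - \<alpha>"
    and p_def: "p = crit_exponent DIM('a) \<alpha>"
begin

interpretation nu: finite_measure \<nu> by (rule finite_nu)

lemma beta_pos: "\<beta> > 0" using dim alpha by (simp add: beta_def)

lemma p_eq: "p = 2 + 2 * \<alpha> / \<beta>"
  using beta_pos by (simp add: beta_def p_def crit_exponent_def field_simps)

lemma p_gt_2: "p > 2" unfolding p_eq using beta_pos alpha by simp

lemma beta_p: "\<beta> * p = 2 * real DIM('a)" "2 / p = \<beta> / real DIM('a)"
  using beta_pos by (auto simp: beta_def p_def crit_exponent_def field_simps)

text \<open>\<open>hedberg\<close> is applied at each x to means over the points x - t T z with z in
  the unit cube. After integration in x, an increment along t T z splits into steps t (z \<bullet>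
  b) in the frame directions; since 0 \<le> z \<bullet> b \<le> 1, rescaling t costs a factor at
  most 1 and leaves a one-dimensional energy.\<close>

lemma refined_sobolev:
  obtains C R :: real where "C > 0" "R > 0"
    "\<And>u M. u \<in> borel_measurable borel \<Longrightarrow> M > 0 \<Longrightarrow>
       (\<And>x t. t > 0 \<Longrightarrow> (\<integral>\<^sup>+y. indicator (cball 0 R) y * ennreal ((u (x - t *\<^sub>R y))\<^sup>2) \<partial>lborel) \<le> ennreal (M * t powr (- \<beta>))) \<Longrightarrow>
       (\<integral>\<^sup>+x. ennreal (\<bar>u x\<bar> powr p) \<partial>lborel) \<le> ennreal (C * M powr (\<alpha> / \<beta>)) * E u"
proof -
  obtain \<kappa> C0 :: real where kC: "\<kappa> > 0" "C0 > 0"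
    "\<And>u. u \<in> borel_measurable borel \<Longrightarrow> \<exists>\<theta>::'a \<Rightarrow> 'a. (\<forall>b\<in>Basis. norm (\<theta> b) = 1 \<and> ray_energy \<alpha> u (\<theta> b) \<le> ennreal C0 * E u)
       \<and> (\<forall>z. \<kappa> * norm z \<le> norm (\<Sum>b\<in>Basis. (z \<bullet> b) *\<^sub>R \<theta> b))" by (rule adapted_frame) (rule that)
  define n where "n = DIM('a)"
  define Q where "Q = (1 / \<kappa>) ^ n"
  have Q: "Q > 0" using kC by (simp add: Q_def)
  define C where "C = 2 powr (3 + \<alpha>) * (4 * Q) powr (\<alpha> / \<beta>) * (2 ^ n * (real n * C0))"
  have n0: "n > 0" by (simp add: n_def)
  show ?thesis
  proof (rule that[of C "real n"])
    show "C > 0" using kC Q n0 by (simp add: C_def)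
    show "real n > 0" using n0 by simp
    fix u :: "'a \<Rightarrow> real" and M :: real
    assume u[measurable]: "u \<in> borel_measurable borel" and M: "M > 0"
      and mor: "\<And>x t. t > 0 \<Longrightarrow> (\<integral>\<^sup>+y. indicator (cball 0 (real n)) y * ennreal ((u (x - t *\<^sub>R y))\<^sup>2) \<partial>lborel) \<le> ennreal (M * t powr (- \<beta>))"
    obtain \<theta> :: "'a \<Rightarrow> 'a" where \<theta>: "\<And>b. b \<in> Basis \<Longrightarrow> norm (\<theta> b) = 1" "\<And>b. b \<in> Basis \<Longrightarrow> ray_energy \<alpha> u (\<theta> b) \<le> ennreal C0 * E u"
      "\<And>z. \<kappa> * norm z \<le> norm (\<Sum>b\<in>Basis. (z \<bullet> b) *\<^sub>R \<theta> b)" using kC(3)[OF u] by metis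
    define T where "T = (\<lambda>z. \<Sum>b\<in>Basis. (z \<bullet> b) *\<^sub>R \<theta> b)"
    have lin: "linear T" unfolding T_def by (rule frame_linear)
    have [measurable]: "T \<in> borel_measurable borel"
      using linear_continuous_on[of T UNIV] lin by (intro borel_measurable_continuous_onI) (simp add: linear_conv_bounded_linear)
    define c where "c z = (indicator (cbox 0 One) z :: ennreal)" for z :: 'a
    have [measurable]: "c \<in> borel_measurable borel" unfolding c_def by (intro borel_measurable_indicator) simp
    have c1: "(\<integral>\<^sup>+z. c z \<partial>lborel) = 1"
      by (simp add: c_def emeasure_lborel_cbox_eq)
    \<comment> \<open>Unit directions map the unit cube into the ball of radius n; hence the choice
      of \<open>real n\<close> for the radius \<open>R\<close>.\<close>
    have Tn: "norm (T z) \<le> real n" if "z \<in> cbox 0 One" for z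
    proof -
      have "norm (T z) \<le> (\<Sum>b\<in>(Basis::'a set). 1)"
        unfolding T_def
      proof (rule sum_norm_le)
        fix b :: 'a assume "b \<in> Basis"
        then show "norm ((z \<bullet> b) *\<^sub>R \<theta> b) \<le> 1" using that \<theta>(1) by (auto simp: mem_box)
      qed
      then show ?thesis by (simp add: n_def)
    qed
    \<comment> \<open>Over the parallelepiped at scale t: \<open>F\<close> is the mean squared
      deviation from u(x), \<open>H\<close> the mean square.\<close>
    define F where "F x t = (\<integral>\<^sup>+z. c z * ennreal ((u x - u (x - t *\<^sub>R T z))\<^sup>2) \<partial>lborel)" for x t
    define H where "H x t = (\<integral>\<^sup>+z. c z * ennreal ((u (x - t *\<^sub>R T z))\<^sup>2) \<partial>lborel)" for x t
    have Fm[measurable]: "(\<lambda>(x, t). F x t) \<in> borel_measurable (borel \<Otimes>\<^sub>M borel)" unfolding F_def by measurable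
    have H: "H x t \<le> ennreal (Q * M * t powr (- \<beta>))" if t: "t > 0" for x t
    proof -
      have "H x t \<le> (\<integral>\<^sup>+z. indicator (cball 0 (real n)) (T z) * ennreal ((u (x - t *\<^sub>R T z))\<^sup>2) \<partial>lborel)"
        unfolding H_def using Tn by (intro nn_integral_mono) (auto simp: c_def indicator_def)
      also have "\<dots> \<le> ennreal ((1 / \<kappa>) ^ DIM('a)) * (\<integral>\<^sup>+y. indicator (cball 0 (real n)) y * ennreal ((u (x - t *\<^sub>R y))\<^sup>2) \<partial>lborel)"
        using \<theta>(3) by (intro nn_integral_linear_le[OF lin kC(1), where f="\<lambda>y. indicator (cball 0 (real n)) y * ennreal ((u (x - t *\<^sub>R y))\<^sup>2)"])
          (auto simp: T_def)
      also have "\<dots> \<le> ennreal Q * ennreal (M * t powr (- \<beta>))"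
        unfolding Q_def n_def[symmetric] using mor[OF t, of x] by (intro mult_left_mono) auto
      finally show ?thesis using Q M by (simp add: ennreal_mult mult.assoc)
    qed
    have dec: "ennreal ((u x)\<^sup>2) \<le> 2 * F x t + 2 * H x t" for x t
    proof -
      have "ennreal ((u x)\<^sup>2) = (\<integral>\<^sup>+z. c z * ennreal ((u x)\<^sup>2) \<partial>lborel)"
        by (simp add: nn_integral_multc c1)
      also have "\<dots> \<le> (\<integral>\<^sup>+z. 2 * (c z * ennreal ((u x - u (x - t *\<^sub>R T z))\<^sup>2)) + 2 * (c z * ennreal ((u (x - t *\<^sub>R T z))\<^sup>2)) \<partial>lborel)"
      proof (rule nn_integral_mono)
        fix z
        let ?y = "u (x - t *\<^sub>R T z)"
        have "(u x)\<^sup>2 \<le> 2 * (u x - ?y)\<^sup>2 + 2 * ?y\<^sup>2"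
          using sum_squares_bound[of "u x - ?y" ?y] by (simp add: power2_eq_square algebra_simps)
        then have "ennreal ((u x)\<^sup>2) \<le> ennreal (2 * (u x - ?y)\<^sup>2 + 2 * ?y\<^sup>2)" by (rule ennreal_leI)
        then have "ennreal ((u x)\<^sup>2) \<le> 2 * ennreal ((u x - ?y)\<^sup>2) + 2 * ennreal (?y\<^sup>2)"
          by (simp add: ennreal_plus ennreal_mult)
        from mult_left_mono[OF this, of "c z"]
        show "c z * ennreal ((u x)\<^sup>2) \<le> 2 * (c z * ennreal ((u x - ?y)\<^sup>2)) + 2 * (c z * ennreal (?y\<^sup>2))"
          by (simp add: distrib_left mult.left_commute)
      qed
      also have "\<dots> = 2 * F x t + 2 * H x t"
        unfolding F_def H_def by (subst nn_integral_add) (auto simp: nn_integral_cmult)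
      finally show ?thesis .
    qed
    define K where "K = ennreal (2 powr (3 + \<alpha>) * (4 * (Q * M)) powr (\<alpha> / \<beta>))"
    have pt: "ennreal (\<bar>u x\<bar> powr p) \<le> K * (\<integral>\<^sup>+t. levy_weight \<alpha> t * F x t \<partial>lborel)" for x
      unfolding K_def p_eq using Q M
      by (intro hedberg[where H="H x"] alpha beta_pos dec H) auto
    have one: "(\<integral>\<^sup>+t. levy_weight \<alpha> t * trans_sq u ((t * s) *\<^sub>R \<theta> b) \<partial>lborel) \<le> ennreal C0 * E u"
      if "0 \<le> s" "s \<le> 1" "b \<in> Basis" for s b
    proof (cases "s = 0")
      case False
      then have "(\<integral>\<^sup>+t. levy_weight \<alpha> t * trans_sq u ((t * s) *\<^sub>R \<theta> b) \<partial>lborel) = ennreal (s powr \<alpha>) * ray_energy \<alpha> u (\<theta> b)"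
        using that by (intro ray_energy_scale[OF u]) auto
      also have "\<dots> \<le> 1 * ray_energy \<alpha> u (\<theta> b)"
        using that alpha powr_le1[of \<alpha> s] by (intro mult_right_mono) auto
      finally show ?thesis using \<theta>(2)[OF that(3)] by simp
    qed simp
    have Fint: "(\<integral>\<^sup>+x. F x t \<partial>lborel) = (\<integral>\<^sup>+z. c z * trans_sq u (t *\<^sub>R T z) \<partial>lborel)" for t
    proof -
      have "(\<integral>\<^sup>+x. F x t \<partial>lborel) = (\<integral>\<^sup>+z. (\<integral>\<^sup>+x. c z * ennreal ((u x - u (x - t *\<^sub>R T z))\<^sup>2) \<partial>lborel) \<partial>lborel)"
        unfolding F_def by (rule lborel_pair.Fubini') measurable
      then show ?thesis unfolding trans_sq_def by (simp add: nn_integral_cmult)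
    qed
    have "(\<integral>\<^sup>+x. ennreal (\<bar>u x\<bar> powr p) \<partial>lborel) \<le> (\<integral>\<^sup>+x. K * (\<integral>\<^sup>+t. levy_weight \<alpha> t * F x t \<partial>lborel) \<partial>lborel)"
      by (intro nn_integral_mono pt)
    also have "\<dots> = K * (\<integral>\<^sup>+x. (\<integral>\<^sup>+t. levy_weight \<alpha> t * F x t \<partial>lborel) \<partial>lborel)"
      by (rule nn_integral_cmult) measurable
    also have "(\<integral>\<^sup>+x. (\<integral>\<^sup>+t. levy_weight \<alpha> t * F x t \<partial>lborel) \<partial>lborel) = (\<integral>\<^sup>+t. (\<integral>\<^sup>+x. levy_weight \<alpha> t * F x t \<partial>lborel) \<partial>lborel)"
      by (rule lborel_pair.Fubini') measurable
    also have "\<dots> = (\<integral>\<^sup>+t. levy_weight \<alpha> t * (\<integral>\<^sup>+z. c z * trans_sq u (t *\<^sub>R T z) \<partial>lborel) \<partial>lborel)"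
      by (intro nn_integral_cong) (simp add: nn_integral_cmult Fint)
    also have "\<dots> \<le> (\<integral>\<^sup>+t. levy_weight \<alpha> t * (\<integral>\<^sup>+z. c z * (2 ^ n * (\<Sum>b\<in>Basis. trans_sq u ((t * (z \<bullet> b)) *\<^sub>R \<theta> b))) \<partial>lborel) \<partial>lborel)"
    proof (intro nn_integral_mono mult_left_mono)
      fix t z
      have "t *\<^sub>R T z = (\<Sum>b\<in>Basis. (t * (z \<bullet> b)) *\<^sub>R \<theta> b)" by (simp add: T_def scaleR_sum_right)
      then show "trans_sq u (t *\<^sub>R T z) \<le> 2 ^ n * (\<Sum>b\<in>Basis. trans_sq u ((t * (z \<bullet> b)) *\<^sub>R \<theta> b))"
        unfolding n_def by (simp only:) (rule trans_sq_sum[OF u finite_Basis])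
    qed auto
    also have "\<dots> = (\<integral>\<^sup>+t. (\<integral>\<^sup>+z. 2 ^ n * (c z * (\<Sum>b\<in>Basis. levy_weight \<alpha> t * trans_sq u ((t * (z \<bullet> b)) *\<^sub>R \<theta> b))) \<partial>lborel) \<partial>lborel)"
    proof (rule nn_integral_cong)
      fix t
      have "levy_weight \<alpha> t * (\<integral>\<^sup>+z. c z * (2 ^ n * (\<Sum>b\<in>Basis. trans_sq u ((t * (z \<bullet> b)) *\<^sub>R \<theta> b))) \<partial>lborel)
        = (\<integral>\<^sup>+z. levy_weight \<alpha> t * (c z * (2 ^ n * (\<Sum>b\<in>Basis. trans_sq u ((t * (z \<bullet> b)) *\<^sub>R \<theta> b)))) \<partial>lborel)"
        by (rule nn_integral_cmult[symmetric]) measurable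
      also have "\<dots> = (\<integral>\<^sup>+z. 2 ^ n * (c z * (\<Sum>b\<in>Basis. levy_weight \<alpha> t * trans_sq u ((t * (z \<bullet> b)) *\<^sub>R \<theta> b))) \<partial>lborel)"
        by (intro nn_integral_cong) (simp only: sum_distrib_left[symmetric] mult_ac)
      finally show "levy_weight \<alpha> t * (\<integral>\<^sup>+z. c z * (2 ^ n * (\<Sum>b\<in>Basis. trans_sq u ((t * (z \<bullet> b)) *\<^sub>R \<theta> b))) \<partial>lborel)
        = (\<integral>\<^sup>+z. 2 ^ n * (c z * (\<Sum>b\<in>Basis. levy_weight \<alpha> t * trans_sq u ((t * (z \<bullet> b)) *\<^sub>R \<theta> b))) \<partial>lborel)" .
    qed
    also have "\<dots> = (\<integral>\<^sup>+z. (\<integral>\<^sup>+t. 2 ^ n * (c z * (\<Sum>b\<in>Basis. levy_weight \<alpha> t * trans_sq u ((t * (z \<bullet> b)) *\<^sub>R \<theta> b))) \<partial>lborel) \<partial>lborel)"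
      by (rule lborel_pair.Fubini') measurable
    also have "\<dots> = (\<integral>\<^sup>+z. 2 ^ n * (c z * (\<Sum>b\<in>Basis. (\<integral>\<^sup>+t. levy_weight \<alpha> t * trans_sq u ((t * (z \<bullet> b)) *\<^sub>R \<theta> b) \<partial>lborel))) \<partial>lborel)"
      by (intro nn_integral_cong) (simp add: nn_integral_cmult nn_integral_sum)
    also have "\<dots> \<le> (\<integral>\<^sup>+z. (2 ^ n * (\<Sum>b\<in>(Basis::'a set). ennreal C0 * E u)) * c z \<partial>lborel)"
    proof (rule nn_integral_mono)
      fix z
      show "2 ^ n * (c z * (\<Sum>b\<in>Basis. (\<integral>\<^sup>+t. levy_weight \<alpha> t * trans_sq u ((t * (z \<bullet> b)) *\<^sub>R \<theta> b) \<partial>lborel)))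
        \<le> (2 ^ n * (\<Sum>b\<in>(Basis::'a set). ennreal C0 * E u)) * c z"
      proof (cases "z \<in> cbox 0 One")
        case True
        then have "(\<Sum>b\<in>Basis. (\<integral>\<^sup>+t. levy_weight \<alpha> t * trans_sq u ((t * (z \<bullet> b)) *\<^sub>R \<theta> b) \<partial>lborel)) \<le> (\<Sum>b\<in>(Basis::'a set). ennreal C0 * E u)"
          by (intro sum_mono one) (auto simp: mem_box)
        then show ?thesis using True by (simp add: c_def mult_left_mono del: sum_constant)
      qed (simp add: c_def)
    qed
    also have "\<dots> = 2 ^ n * (\<Sum>b\<in>(Basis::'a set). ennreal C0 * E u)"
      by (subst nn_integral_cmult) (simp_all add: c1)
    also have "\<dots> = ennreal (2 ^ n * (real n * C0)) * E u"
      using kC(2) by (simp add: n_def ennreal_mult ennreal_of_nat_eq_real_of_nat ennreal_power[symmetric] mult.assoc)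
    finally have "(\<integral>\<^sup>+x. ennreal (\<bar>u x\<bar> powr p) \<partial>lborel) \<le> K * (ennreal (2 ^ n * (real n * C0)) * E u)"
      by (simp add: mult_left_mono)
    also have "\<dots> = ennreal (C * M powr (\<alpha> / \<beta>)) * E u"
    proof -
      have "C * M powr (\<alpha> / \<beta>) = 2 powr (3 + \<alpha>) * (4 * (Q * M)) powr (\<alpha> / \<beta>) * (2 ^ n * (real n * C0))"
        using Q M by (simp add: C_def powr_mult mult_ac)
      then have "ennreal (C * M powr (\<alpha> / \<beta>)) = K * ennreal (2 ^ n * (real n * C0))"
        using kC(2) by (simp add: K_def ennreal_mult'')
      then show ?thesis by (simp only: mult.assoc)
    qed
    finally show "(\<integral>\<^sup>+x. ennreal (\<bar>u x\<bar> powr p) \<partial>lborel) \<le> ennreal (C * M powr (\<alpha> / \<beta>)) * E u" .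
  qed
qed

end

section \<open>Nonvanishing, the Sobolev inequality and critical scaling\<close>

context levy_critical
begin

text \<open>As a predicate, the nested premise of \<open>refined_sobolev\<close> can stand in the
  object-level statement \<open>refined_sobolev_ex\<close>, from which the constants are then
  obtained.\<close>

definition morrey_le :: "real \<Rightarrow> real \<Rightarrow> ('a \<Rightarrow> real) \<Rightarrow> bool" where
  "morrey_le R M u \<longleftrightarrow> (\<forall>x t. t > 0 \<longrightarrow>
     (\<integral>\<^sup>+y. indicator (cball 0 R) y * ennreal ((u (x - t *\<^sub>R y))\<^sup>2) \<partial>lborel) \<le> ennreal (M * t powr (- \<beta>)))"

lemma refined_sobolev_ex:
  "\<exists>C>0. \<exists>R>0. \<forall>u M. u \<in> borel_measurable borel \<longrightarrow> M > 0 \<longrightarrow> morrey_le R M u \<longrightarrow>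
     (\<integral>\<^sup>+x. ennreal (\<bar>u x\<bar> powr p) \<partial>lborel) \<le> ennreal (C * M powr (\<alpha> / \<beta>)) * E u"
proof (rule refined_sobolev)
  fix C R :: real assume a: "C > 0" "R > 0"
    "\<And>u M. u \<in> borel_measurable borel \<Longrightarrow> M > 0 \<Longrightarrow>
       (\<And>x t. t > 0 \<Longrightarrow> (\<integral>\<^sup>+y. indicator (cball 0 R) y * ennreal ((u (x - t *\<^sub>R y))\<^sup>2) \<partial>lborel) \<le> ennreal (M * t powr (- \<beta>))) \<Longrightarrow>
       (\<integral>\<^sup>+x. ennreal (\<bar>u x\<bar> powr p) \<partial>lborel) \<le> ennreal (C * M powr (\<alpha> / \<beta>)) * E u"
  show ?thesis
    by (intro exI[of _ C] exI[of _ R] conjI allI impI a) (auto simp: morrey_le_def)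
qed

text \<open>If every cell carried at most m t^(-\<beta>), the refined inequality would bound the
  p-th power integral by C m^(\<alpha>/\<beta>) K; the constant m is chosen to make this
  1/2.\<close>

lemma nonvanishing:
  assumes K: "K > 0"
  obtains m R :: real where "m > 0" "R > 0"
    "\<And>u. u \<in> borel_measurable borel \<Longrightarrow> (\<integral>\<^sup>+x. ennreal (\<bar>u x\<bar> powr p) \<partial>lborel) = 1 \<Longrightarrow> E u \<le> ennreal K \<Longrightarrow>
      \<exists>x t. t > 0 \<and> ennreal (m * t powr (- \<beta>)) < (\<integral>\<^sup>+y. indicator (cball 0 R) y * ennreal ((u (x - t *\<^sub>R y))\<^sup>2) \<partial>lborel)"
proof -
  obtain C R :: real where CR: "C > 0" "R > 0"
    "\<forall>u M. u \<in> borel_measurable borel \<longrightarrow> M > 0 \<longrightarrow> morrey_le R M u \<longrightarrow>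
       (\<integral>\<^sup>+x. ennreal (\<bar>u x\<bar> powr p) \<partial>lborel) \<le> ennreal (C * M powr (\<alpha> / \<beta>)) * E u"
    using refined_sobolev_ex by auto
  define m where "m = (1 / (2 * C * K)) powr (\<beta> / \<alpha>)"
  have m: "m > 0" using CR K by (simp add: m_def)
  have mm: "m powr (\<alpha> / \<beta>) = 1 / (2 * C * K)"
    using CR K alpha beta_pos by (simp add: m_def powr_powr)
  show ?thesis
  proof (rule that[OF m CR(2)], rule ccontr)
    fix u :: "'a \<Rightarrow> real" assume u: "u \<in> borel_measurable borel" "(\<integral>\<^sup>+x. ennreal (\<bar>u x\<bar> powr p) \<partial>lborel) = 1" "E u \<le> ennreal K"
      and neg: "\<nexists>x t. t > 0 \<and> ennreal (m * t powr (- \<beta>)) < (\<integral>\<^sup>+y. indicator (cball 0 R) y * ennreal ((u (x - t *\<^sub>R y))\<^sup>2) \<partial>lborel)"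
    have "1 \<le> ennreal (C * m powr (\<alpha> / \<beta>)) * E u"
      unfolding u(2)[symmetric]
      by (rule CR(3)[rule_format, OF u(1) m], unfold morrey_le_def, intro allI impI leI) (use neg in blast)
    also have "\<dots> \<le> ennreal (C * m powr (\<alpha> / \<beta>)) * ennreal K" using u(3) by (rule mult_left_mono) simp
    also have "\<dots> = ennreal (C * m powr (\<alpha> / \<beta>) * K)" using CR K by (simp add: ennreal_mult)
    also have "C * m powr (\<alpha> / \<beta>) * K = 1 / 2" using CR K by (simp add: mm)
    finally show False by (simp add: ennreal_ge_1 del: ennreal_half)
  qed
qed

text \<open>The p-norm controls the Morrey quantity, so the refined inequality feeds back on itself:
  A is at most a constant times A^(\<alpha>/N) E u. One may divide because A is finite, and 1 -
  \<alpha>/N = 2/p.\<close>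

lemma sobolev:
  obtains C :: real where "C > 0"
    "\<And>u A. u \<in> borel_measurable borel \<Longrightarrow> A \<ge> 0 \<Longrightarrow> (\<integral>\<^sup>+x. ennreal (\<bar>u x\<bar> powr p) \<partial>lborel) = ennreal A \<Longrightarrow> ennreal (A powr (2 / p)) \<le> ennreal C * E u"
proof -
  obtain C R :: real where CR: "C > 0" "R > 0"
    "\<forall>u M. u \<in> borel_measurable borel \<longrightarrow> M > 0 \<longrightarrow> morrey_le R M u \<longrightarrow>
       (\<integral>\<^sup>+x. ennreal (\<bar>u x\<bar> powr p) \<partial>lborel) \<le> ennreal (C * M powr (\<alpha> / \<beta>)) * E u"
    using refined_sobolev_ex by auto
  define V where "V = unit_ball_vol (real DIM('a)) * R ^ DIM('a)"
  have V: "V > 0" using CR by (simp add: V_def)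
  have eV: "emeasure lborel (cball (0::'a) R) = ennreal V"
    unfolding V_def using CR by (intro emeasure_cball) simp
  show ?thesis
  proof (rule that[of "C * (V + 1) powr (\<alpha> / \<beta>)"])
    show "C * (V + 1) powr (\<alpha> / \<beta>) > 0" using CR V by simp
    fix u :: "'a \<Rightarrow> real" and A :: real
    assume u[measurable]: "u \<in> borel_measurable borel" and A0: "A \<ge> 0" and A: "(\<integral>\<^sup>+x. ennreal (\<bar>u x\<bar> powr p) \<partial>lborel) = ennreal A"
    show "ennreal (A powr (2 / p)) \<le> ennreal (C * (V + 1) powr (\<alpha> / \<beta>)) * E u"
    proof (cases "A = 0")
      case False
      then have Ap: "A > 0" using A0 by simp
      define M where "M = (V + 1) * A powr (2 / p)"
      have M: "M > 0" using V Ap by (simp add: M_def)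
      have "ennreal A \<le> ennreal (C * M powr (\<alpha> / \<beta>)) * E u"
        unfolding A[symmetric]
      proof (rule CR(3)[rule_format, OF u M], unfold morrey_le_def, intro allI impI)
        fix x :: 'a and t :: real assume t: "t > 0"
        \<comment> \<open>A truncation level: with l^p = t^(-N) A, the values of u below and above l
          both contribute multiples of A^(2/p) t^(-\<beta>), by factors V and 1. This explains V + 1
          in \<open>M\<close>.\<close>
        define l where "l = (t powr (- real DIM('a)) * A) powr (1 / p)"
        have l: "l > 0" using t Ap by (simp add: l_def)
        have lp: "l powr p = t powr (- real DIM('a)) * A" using t Ap p_gt_2 by (simp add: l_def powr_powr)
        have l2: "l\<^sup>2 = A powr (2 / p) * t powr (- \<beta>)"
        proof -
          have "l\<^sup>2 = l powr 2" using l by simp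
          also have "\<dots> = (t powr (- real DIM('a)) * A) powr (2 / p)" by (simp add: l_def powr_powr)
          also have "\<dots> = A powr (2 / p) * t powr (- real DIM('a) * (2 / p))"
            using t Ap by (simp add: powr_mult powr_powr)
          also have "- real DIM('a) * (2 / p) = - \<beta>" unfolding beta_p(2) by simp
          finally show ?thesis .
        qed
        \<comment> \<open>Below l the square is at most l^2; above it, 2 - p < 0 allows |a|^(2-p) to
          be replaced by l^(2-p).\<close>
        have pt: "a\<^sup>2 \<le> l\<^sup>2 + l powr (2 - p) * \<bar>a\<bar> powr p" for a :: real
        proof (cases "\<bar>a\<bar> \<le> l")
          case True
          then have "a\<^sup>2 \<le> l\<^sup>2" using power_mono[of "\<bar>a\<bar>" l 2] by simp
          then show ?thesis using l by (simp add: add_increasing2)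
        next
          case False
          have "a\<^sup>2 = \<bar>a\<bar> powr (2 - p) * \<bar>a\<bar> powr p"
            using False l by (simp add: powr_add[symmetric])
          also have "\<dots> \<le> l powr (2 - p) * \<bar>a\<bar> powr p"
            using False l p_gt_2 by (intro mult_right_mono powr_mono2') auto
          finally show ?thesis by (simp add: add_increasing)
        qed
        have "(\<integral>\<^sup>+y. indicator (cball 0 R) y * ennreal ((u (x - t *\<^sub>R y))\<^sup>2) \<partial>lborel)
          \<le> (\<integral>\<^sup>+y. ennreal (l\<^sup>2) * indicator (cball 0 R) y + ennreal (l powr (2 - p)) * ennreal (\<bar>u (x + (- t) *\<^sub>R y)\<bar> powr p) \<partial>lborel)"
        proof (rule nn_integral_mono)
          fix y
          have "ennreal ((u (x - t *\<^sub>R y))\<^sup>2) \<le> ennreal (l\<^sup>2) + ennreal (l powr (2 - p)) * ennreal (\<bar>u (x - t *\<^sub>R y)\<bar> powr p)"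
            using ennreal_leI[OF pt[of "u (x - t *\<^sub>R y)"]] by (simp add: ennreal_mult)
          then show "indicator (cball 0 R) y * ennreal ((u (x - t *\<^sub>R y))\<^sup>2)
            \<le> ennreal (l\<^sup>2) * indicator (cball 0 R) y + ennreal (l powr (2 - p)) * ennreal (\<bar>u (x + (- t) *\<^sub>R y)\<bar> powr p)"
            by (auto simp: indicator_def)
        qed
        also have "\<dots> = ennreal (l\<^sup>2) * ennreal V + ennreal (l powr (2 - p)) * (\<integral>\<^sup>+y. ennreal (\<bar>u (x + (- t) *\<^sub>R y)\<bar> powr p) \<partial>lborel)"
          by (subst nn_integral_add) (auto simp: nn_integral_cmult eV)
        also have "(\<integral>\<^sup>+y. ennreal (\<bar>u (x + (- t) *\<^sub>R y)\<bar> powr p) \<partial>lborel) = ennreal (t powr (- real DIM('a)) * A)"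
        proof -
          have "ennreal A = ennreal (\<bar>- t\<bar> ^ DIM('a)) * (\<integral>\<^sup>+y. ennreal (\<bar>u (x + (- t) *\<^sub>R y)\<bar> powr p) \<partial>lborel)"
            unfolding A[symmetric] using t by (intro nn_integral_lborel_affine) auto
          then have "ennreal (t powr (- real DIM('a))) * ennreal A
             = ennreal (t powr (- real DIM('a))) * ennreal (\<bar>- t\<bar> ^ DIM('a)) * (\<integral>\<^sup>+y. ennreal (\<bar>u (x + (- t) *\<^sub>R y)\<bar> powr p) \<partial>lborel)"
            by (simp only: mult.assoc)
          also have "ennreal (t powr (- real DIM('a))) * ennreal (\<bar>- t\<bar> ^ DIM('a)) = 1"
            using t by (simp add: ennreal_mult[symmetric] powr_minus powr_realpow)
          finally show ?thesis using Ap by (simp add: ennreal_mult)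
        qed
        also have "ennreal (l\<^sup>2) * ennreal V + ennreal (l powr (2 - p)) * ennreal (t powr (- real DIM('a)) * A) = ennreal (l\<^sup>2 * V + l powr (2 - p) * (l powr p))"
          unfolding lp using V Ap by (simp add: ennreal_mult)
        also have "l\<^sup>2 * V + l powr (2 - p) * (l powr p) = M * t powr (- \<beta>)"
        proof -
          have "l powr (2 - p) * (l powr p) = l\<^sup>2" using l by (simp add: powr_add[symmetric])
          then show ?thesis by (simp add: l2 M_def algebra_simps)
        qed
        finally show "(\<integral>\<^sup>+y. indicator (cball 0 R) y * ennreal ((u (x - t *\<^sub>R y))\<^sup>2) \<partial>lborel) \<le> ennreal (M * t powr (- \<beta>))" .
      qed
      also have "M powr (\<alpha> / \<beta>) = (V + 1) powr (\<alpha> / \<beta>) * A powr (\<alpha> / real DIM('a))"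
      proof -
        have "2 / p * (\<alpha> / \<beta>) = \<alpha> / real DIM('a)" unfolding beta_p(2) using beta_pos by simp
        then show ?thesis using V Ap by (simp add: M_def powr_mult powr_powr)
      qed
      finally have le: "ennreal A \<le> ennreal (C * ((V + 1) powr (\<alpha> / \<beta>) * A powr (\<alpha> / real DIM('a)))) * E u" .
      have e: "A powr (- (\<alpha> / real DIM('a))) * A = A powr (2 / p)"
      proof -
        have "A powr (- (\<alpha> / real DIM('a))) * A powr 1 = A powr (- (\<alpha> / real DIM('a)) + 1)" by (simp only: powr_add)
        also have "- (\<alpha> / real DIM('a)) + 1 = 2 / p" unfolding beta_p(2) by (simp add: beta_def diff_divide_distrib)
        finally show ?thesis using Ap by simp
      qed
      have "ennreal (A powr (2 / p)) = ennreal (A powr (- (\<alpha> / real DIM('a)))) * ennreal A"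
        using Ap by (simp only: e[symmetric]) (simp add: ennreal_mult)
      also have "\<dots> \<le> ennreal (A powr (- (\<alpha> / real DIM('a)))) * (ennreal (C * ((V + 1) powr (\<alpha> / \<beta>) * A powr (\<alpha> / real DIM('a)))) * E u)"
        using le by (rule mult_left_mono) simp
      also have "\<dots> = ennreal (A powr (- (\<alpha> / real DIM('a))) * (C * ((V + 1) powr (\<alpha> / \<beta>) * A powr (\<alpha> / real DIM('a))))) * E u"
        using CR(1) by (simp add: ennreal_mult mult.assoc)
      also have "A powr (- (\<alpha> / real DIM('a))) * (C * ((V + 1) powr (\<alpha> / \<beta>) * A powr (\<alpha> / real DIM('a)))) = C * (V + 1) powr (\<alpha> / \<beta>)"
      proof -
        have "A powr (- (\<alpha> / real DIM('a))) * A powr (\<alpha> / real DIM('a)) = 1" using Ap by (simp add: powr_add[symmetric])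
        moreover have "A powr (- (\<alpha> / real DIM('a))) * (C * ((V + 1) powr (\<alpha> / \<beta>) * A powr (\<alpha> / real DIM('a))))
          = C * (V + 1) powr (\<alpha> / \<beta>) * (A powr (- (\<alpha> / real DIM('a))) * A powr (\<alpha> / real DIM('a)))"
          by (simp only: mult_ac)
        ultimately show ?thesis by (simp only: mult_1_right)
      qed
      finally show ?thesis .
    qed (use p_gt_2 in simp)
  qed
qed

text \<open>Reflected as well as scaled, to match the arguments x - t y of the Morrey integrals. The
  energy does not see the reflection, because \<open>trans_sq\<close> is even in the step.\<close>

definition rescale :: "'a \<Rightarrow> real \<Rightarrow> ('a \<Rightarrow> real) \<Rightarrow> 'a \<Rightarrow> real" where
  "rescale x t u y = t powr (\<beta> / 2) * u (x - t *\<^sub>R y)"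

lemma rescale_measurable[measurable]:
  assumes [measurable]: "u \<in> borel_measurable borel"
  shows "rescale x t u \<in> borel_measurable borel"
  unfolding rescale_def[abs_def] by measurable

lemma rescale_Lp:
  assumes [measurable]: "u \<in> borel_measurable borel" and t: "t > 0"
  shows "(\<integral>\<^sup>+y. ennreal (\<bar>rescale x t u y\<bar> powr p) \<partial>lborel) = (\<integral>\<^sup>+y. ennreal (\<bar>u y\<bar> powr p) \<partial>lborel)"
proof -
  have "\<beta> / 2 * p = real DIM('a)" using beta_p(1) by (simp add: field_simps)
  then have tp: "(t powr (\<beta> / 2)) powr p = t ^ DIM('a)" unfolding powr_powr using t by (simp only: powr_realpow)
  have "(\<integral>\<^sup>+y. ennreal (\<bar>u y\<bar> powr p) \<partial>lborel) = ennreal (\<bar>- t\<bar> ^ DIM('a)) * (\<integral>\<^sup>+y. ennreal (\<bar>u (x + (- t) *\<^sub>R y)\<bar> powr p) \<partial>lborel)"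
    using t by (intro nn_integral_lborel_affine) auto
  also have "\<dots> = (\<integral>\<^sup>+y. ennreal (t ^ DIM('a)) * ennreal (\<bar>u (x - t *\<^sub>R y)\<bar> powr p) \<partial>lborel)"
    using t by (subst nn_integral_cmult) auto
  also have "\<dots> = (\<integral>\<^sup>+y. ennreal (\<bar>rescale x t u y\<bar> powr p) \<partial>lborel)"
    using t by (intro nn_integral_cong) (simp add: rescale_def abs_mult powr_mult tp ennreal_mult)
  finally show ?thesis by simp
qed

text \<open>For each increment the squared amplitude gives t^\<beta> and the change of variables
  t^(-N), together t^(-\<alpha>); stretching the step length in the radial integral gives t^\<alpha>
  back.\<close>

lemma rescale_E:
  assumes [measurable]: "u \<in> borel_measurable borel" and t: "t > 0"
  shows "E (rescale x t u) = E u"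
proof -
  have ts: "trans_sq (rescale x t u) h = ennreal (t powr (- \<alpha>)) * trans_sq u (t *\<^sub>R h)" for h
  proof -
    have tb: "t powr \<beta> = (t powr (\<beta> / 2))\<^sup>2" by (simp add: power2_eq_square powr_add[symmetric])
    let ?g = "\<lambda>y. ennreal ((u y - u (y - (- (t *\<^sub>R h))))\<^sup>2)"
    have "trans_sq u (t *\<^sub>R h) = trans_sq u (- (t *\<^sub>R h))" by (rule trans_sq_uminus[symmetric]) measurable
    also have "\<dots> = ennreal (\<bar>- t\<bar> ^ DIM('a)) * (\<integral>\<^sup>+y. ?g (x + (- t) *\<^sub>R y) \<partial>lborel)"
      unfolding trans_sq_def using t by (intro nn_integral_lborel_affine) auto
    finally have "ennreal (t powr (- \<alpha>)) * trans_sq u (t *\<^sub>R h) = ennreal (t powr (- \<alpha>)) * (ennreal (t ^ DIM('a)) * (\<integral>\<^sup>+y. ?g (x + (- t) *\<^sub>R y) \<partial>lborel))"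
      using t by simp
    also have "\<dots> = ennreal (t powr (- \<alpha>) * t ^ DIM('a)) * (\<integral>\<^sup>+y. ?g (x + (- t) *\<^sub>R y) \<partial>lborel)"
      using t by (simp add: ennreal_mult mult.assoc)
    also have "t powr (- \<alpha>) * t ^ DIM('a) = t powr \<beta>"
      using t by (simp add: powr_realpow[symmetric] powr_add[symmetric] beta_def)
    also have "ennreal (t powr \<beta>) * (\<integral>\<^sup>+y. ?g (x + (- t) *\<^sub>R y) \<partial>lborel) = (\<integral>\<^sup>+y. ennreal (t powr \<beta>) * ?g (x + (- t) *\<^sub>R y) \<partial>lborel)"
      by (rule nn_integral_cmult[symmetric]) measurable
    also have "\<dots> = trans_sq (rescale x t u) h"
      unfolding trans_sq_def
    proof (rule nn_integral_cong)
      fix y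
      have "rescale x t u y - rescale x t u (y - h) = t powr (\<beta> / 2) * (u (x + (- t) *\<^sub>R y) - u (x + (- t) *\<^sub>R y - (- (t *\<^sub>R h))))"
        by (simp add: rescale_def algebra_simps)
      then show "ennreal (t powr \<beta>) * ?g (x + (- t) *\<^sub>R y) = ennreal ((rescale x t u y - rescale x t u (y - h))\<^sup>2)"
        by (simp add: tb power_mult_distrib ennreal_mult)
    qed
    finally show ?thesis by simp
  qed
  have "ray_energy \<alpha> (rescale x t u) \<theta> = ray_energy \<alpha> u \<theta>" for \<theta>
  proof -
    have "ray_energy \<alpha> (rescale x t u) \<theta> = (\<integral>\<^sup>+r. ennreal (t powr (- \<alpha>)) * (levy_weight \<alpha> r * trans_sq u ((r * t) *\<^sub>R \<theta>)) \<partial>lborel)"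
      unfolding ray_energy_def ts by (simp add: mult.left_commute mult.commute[of t])
    also have "\<dots> = ennreal (t powr (- \<alpha>)) * (ennreal (t powr \<alpha>) * ray_energy \<alpha> u \<theta>)"
      by (subst nn_integral_cmult) (auto simp: ray_energy_scale[OF assms])
    also have "\<dots> = ray_energy \<alpha> u \<theta>"
      using t by (simp add: mult.assoc[symmetric] ennreal_mult[symmetric] powr_add[symmetric])
    finally show ?thesis .
  qed
  then show ?thesis by (simp add: E_def)
qed

lemma rescale_test: "u \<in> test_functions \<Longrightarrow> t > 0 \<Longrightarrow> rescale x t u \<in> test_functions"
  using test_functions_affine[of u "- t" "t powr (\<beta> / 2)" x] unfolding rescale_def by simp

end

section \<open>Local compactness\<close>

lemma diagonal_convergent:
  fixes a :: "nat \<Rightarrow> nat \<Rightarrow> real"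
  assumes b: "\<And>n i. \<bar>a n i\<bar> \<le> B i"
  shows "\<exists>r::nat \<Rightarrow> nat. strict_mono r \<and> (\<forall>i. convergent (\<lambda>n. a (r n) i))"
proof -
  interpret subseqs "\<lambda>i s. convergent (\<lambda>n. a (s n) i)"
  proof
    fix i and s :: "nat \<Rightarrow> nat"
    have "\<And>n. a (s n) i \<in> {- B i..B i}" using b abs_le_iff by (auto simp: abs_le_iff minus_le_iff)
    from compact_imp_seq_compact[OF compact_Icc, unfolded seq_compact_def, rule_format, of "\<lambda>n. a (s n) i", OF this]
    obtain l r where "strict_mono (r::nat \<Rightarrow> nat)" "((\<lambda>n. a (s n) i) \<circ> r) \<longlonglongrightarrow> l" by auto
    then show "\<exists>r'. strict_mono r' \<and> convergent (\<lambda>n. a ((s \<circ> r') n) i)"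
      by (auto simp: o_def convergent_def)
  qed
  have "convergent (\<lambda>n. a (diagseq n) i)" for i
  proof -
    \<comment> \<open>From index i + 1 on, the diagonal sequence is a subsequence of the one chosen
      at stage i.\<close>
    have "convergent (\<lambda>n. a ((diagseq \<circ> ((+) (Suc i))) n) i)"
    proof (rule diagseq_holds)
      fix r s :: "nat \<Rightarrow> nat" and n
      assume r: "strict_mono r" "convergent (\<lambda>m. a (s m) n)"
      then obtain L where "(\<lambda>m. a (s m) n) \<longlonglongrightarrow> L" by (auto simp: convergent_def)
      from LIMSEQ_subseq_LIMSEQ[OF this r(1)]
      show "convergent (\<lambda>m. a ((s \<circ> r) m) n)" by (auto simp: convergent_def o_def)
    qed
    then have "convergent (\<lambda>n. a (diagseq (n + Suc i)) i)" by (simp add: o_def add.commute)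
    then show ?thesis by (rule convergent_ignore_initial_segment[THEN iffD1])
  qed
  then show ?thesis using subseq_diagseq by blast
qed

section \<open>Averages over cubes\<close>

definition cube_measure :: "'a::euclidean_space measure" where
  "cube_measure = density lborel (indicator (cbox 0 One))"

lemma cube_measure_sets[measurable_cong, simp]: "sets cube_measure = sets borel"
  by (simp add: cube_measure_def)

lemma cube_measure_prob: "prob_space (cube_measure :: 'a::euclidean_space measure)"
proof
  have "emeasure (cube_measure :: 'a measure) (space cube_measure) = (\<integral>\<^sup>+z. indicator (cbox 0 (One::'a)) z \<partial>lborel)"
    by (simp add: cube_measure_def emeasure_density)
  also have "\<dots> = emeasure lborel (cbox 0 (One::'a))" by simp
  also have "\<dots> = 1" unfolding emeasure_lborel_cbox_eq by simp
  finally show "emeasure (cube_measure :: 'a measure) (space cube_measure) = 1" .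
qed

lemma nn_integral_cube_measure:
  fixes f :: "'a::euclidean_space \<Rightarrow> ennreal"
  assumes [measurable]: "f \<in> borel_measurable borel"
  shows "(\<integral>\<^sup>+z. f z \<partial>cube_measure) = (\<integral>\<^sup>+z. indicator (cbox 0 One) z * f z \<partial>lborel)"
  unfolding cube_measure_def by (rule nn_integral_density) auto

lemma nn_integral_cube_measure_le:
  fixes f :: "'a::euclidean_space \<Rightarrow> ennreal"
  assumes [measurable]: "f \<in> borel_measurable borel" and t: "t > 0"
  shows "(\<integral>\<^sup>+z. f (x - t *\<^sub>R z) \<partial>cube_measure) \<le> ennreal ((1 / t) ^ DIM('a)) * (\<integral>\<^sup>+y. f y \<partial>lborel)"
proof -
  have "(\<integral>\<^sup>+z. f (x - t *\<^sub>R z) \<partial>cube_measure) \<le> (\<integral>\<^sup>+z. f (x + (- t) *\<^sub>R z) \<partial>lborel)"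
    by (subst nn_integral_cube_measure, measurable) (auto intro!: nn_integral_mono simp: indicator_def)
  also have "\<dots> = ennreal ((1 / t) ^ DIM('a)) * (ennreal (\<bar>- t\<bar> ^ DIM('a)) * (\<integral>\<^sup>+z. f (x + (- t) *\<^sub>R z) \<partial>lborel))"
  proof -
    have "ennreal ((1 / t) ^ DIM('a)) * ennreal (\<bar>- t\<bar> ^ DIM('a)) = 1"
      using t by (simp add: ennreal_mult[symmetric] power_mult_distrib[symmetric])
    then show ?thesis by (simp only: mult.assoc[symmetric] mult_1)
  qed
  also have "ennreal (\<bar>- t\<bar> ^ DIM('a)) * (\<integral>\<^sup>+z. f (x + (- t) *\<^sub>R z) \<partial>lborel) = (\<integral>\<^sup>+y. f y \<partial>lborel)"
    using t by (intro nn_integral_lborel_affine[symmetric]) auto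
  finally show ?thesis .
qed

text \<open>Jensen's inequality for the square, in the form that a variance is nonnegative.\<close>

lemma (in prob_space) square_integral_le:
  assumes [measurable]: "f \<in> borel_measurable M" and b: "\<And>x. \<bar>f x\<bar> \<le> B"
  shows "ennreal ((LINT x|M. f x)\<^sup>2) \<le> (\<integral>\<^sup>+x. ennreal ((f x)\<^sup>2) \<partial>M)"
proof -
  have i1: "integrable M f" by (rule integrable_const_bound[of _ B]) (use b in auto)
  have i2: "integrable M (\<lambda>x. (f x)\<^sup>2)"
  proof (rule integrable_const_bound[of _ "B\<^sup>2"])
    show "AE x in M. norm ((f x)\<^sup>2) \<le> B\<^sup>2" using power_mono[OF b, where n=2] by (intro AE_I2) simp
  qed measurable
  have "(LINT x|M. f x)\<^sup>2 \<le> (LINT x|M. (f x)\<^sup>2)"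
    using variance_eq[OF i1 i2] variance_positive[where X=f] by linarith
  then have "ennreal ((LINT x|M. f x)\<^sup>2) \<le> ennreal (LINT x|M. (f x)\<^sup>2)" by (rule ennreal_leI)
  also have "\<dots> = (\<integral>\<^sup>+x. ennreal ((f x)\<^sup>2) \<partial>M)"
    using i2 by (intro nn_integral_eq_integral[symmetric]) auto
  finally show ?thesis .
qed

definition cube_avg :: "('a::euclidean_space \<Rightarrow> real) \<Rightarrow> real \<Rightarrow> 'a \<Rightarrow> real" where
  "cube_avg u t x = (LINT z|cube_measure. u (x - t *\<^sub>R z))"

lemma cube_avg_measurable[measurable]:
  assumes [measurable]: "u \<in> borel_measurable borel"
  shows "cube_avg u t \<in> borel_measurable borel"
proof -
  interpret prob_space "cube_measure :: 'a measure" by (rule cube_measure_prob)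
  show ?thesis unfolding cube_avg_def[abs_def] by measurable
qed

text \<open>|a| \<le> 1 + |a|^p turns the p-th power bound into a pointwise bound for averages that
  depends on t alone, hence is uniform along a sequence; \<open>B\<close> secures
  integrability.\<close>

lemma cube_avg_bound:
  fixes u :: "'a::euclidean_space \<Rightarrow> real"
  assumes [measurable]: "u \<in> borel_measurable borel" and t: "t > 0" and p: "p \<ge> 1"
    and b: "\<And>x. \<bar>u x\<bar> \<le> B" and Lp: "(\<integral>\<^sup>+x. ennreal (\<bar>u x\<bar> powr p) \<partial>lborel) \<le> 1"
  shows "\<bar>cube_avg u t x\<bar> \<le> 1 + (1 / t) ^ DIM('a)"
proof -
  interpret prob_space "cube_measure :: 'a measure" by (rule cube_measure_prob)
  have pt: "\<bar>a\<bar> \<le> 1 + \<bar>a\<bar> powr p" for a :: real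
  proof (cases "\<bar>a\<bar> \<le> 1")
    case False
    then have "\<bar>a\<bar> powr 1 \<le> \<bar>a\<bar> powr p" using p by (intro powr_mono) auto
    then show ?thesis using False by simp
  qed (simp add: add_increasing2)
  have "ennreal \<bar>cube_avg u t x\<bar> \<le> (\<integral>\<^sup>+z. ennreal \<bar>u (x - t *\<^sub>R z)\<bar> \<partial>cube_measure)"
  proof -
    have "integrable cube_measure (\<lambda>z. u (x - t *\<^sub>R z))"
      by (rule integrable_const_bound[of _ B]) (use b in auto)
    from integral_norm_bound_ennreal[OF this] show ?thesis by (simp add: cube_avg_def)
  qed
  also have "\<dots> \<le> (\<integral>\<^sup>+z. 1 + ennreal (\<bar>u (x - t *\<^sub>R z)\<bar> powr p) \<partial>cube_measure)"
  proof (rule nn_integral_mono)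
    fix z
    show "ennreal \<bar>u (x - t *\<^sub>R z)\<bar> \<le> 1 + ennreal (\<bar>u (x - t *\<^sub>R z)\<bar> powr p)"
      using ennreal_leI[OF pt[of "u (x - t *\<^sub>R z)"]] by simp
  qed
  also have "\<dots> = 1 + (\<integral>\<^sup>+z. ennreal (\<bar>u (x - t *\<^sub>R z)\<bar> powr p) \<partial>cube_measure)"
    by (subst nn_integral_add) (auto simp: emeasure_space_1)
  also have "\<dots> \<le> 1 + ennreal ((1 / t) ^ DIM('a)) * (\<integral>\<^sup>+x. ennreal (\<bar>u x\<bar> powr p) \<partial>lborel)"
    by (intro add_left_mono nn_integral_cube_measure_le[where f="\<lambda>y. ennreal (\<bar>u y\<bar> powr p)"] t) measurable
  also have "\<dots> \<le> 1 + ennreal ((1 / t) ^ DIM('a)) * 1"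
    using Lp by (intro add_left_mono mult_left_mono) auto
  also have "\<dots> = ennreal (1 + (1 / t) ^ DIM('a))" using t by simp
  finally show ?thesis using t by (subst (asm) ennreal_le_iff) (auto intro: add_nonneg_nonneg)
qed

text \<open>Averaging turns an L^2 modulus of translation into a pointwise modulus of continuity, at
  the price of the density t^(-N).\<close>

lemma cube_avg_equicont:
  fixes u :: "'a::euclidean_space \<Rightarrow> real"
  assumes [measurable]: "u \<in> borel_measurable borel" and t: "t > 0" and b: "\<And>x. \<bar>u x\<bar> \<le> B"
  shows "ennreal ((cube_avg u t x - cube_avg u t y)\<^sup>2) \<le> ennreal ((1 / t) ^ DIM('a)) * trans_sq u (x - y)"
proof -
  interpret prob_space "cube_measure :: 'a measure" by (rule cube_measure_prob)
  have i: "integrable cube_measure (\<lambda>z. u (x - t *\<^sub>R z))" for x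
    by (rule integrable_const_bound[of _ B]) (use b in auto)
  have "cube_avg u t x - cube_avg u t y = (LINT z|cube_measure. u (x - t *\<^sub>R z) - u (y - t *\<^sub>R z))"
    unfolding cube_avg_def by (rule Bochner_Integration.integral_diff[symmetric]) (rule i)+
  moreover have "\<bar>u (x - t *\<^sub>R z) - u (y - t *\<^sub>R z)\<bar> \<le> 2 * B" for z
    using b[of "x - t *\<^sub>R z"] b[of "y - t *\<^sub>R z"] by linarith
  ultimately have "ennreal ((cube_avg u t x - cube_avg u t y)\<^sup>2) \<le> (\<integral>\<^sup>+z. ennreal ((u (x - t *\<^sub>R z) - u (y - t *\<^sub>R z))\<^sup>2) \<partial>cube_measure)"
    using square_integral_le[of "\<lambda>z. u (x - t *\<^sub>R z) - u (y - t *\<^sub>R z)" "2 * B"] by simp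
  also have "\<dots> = (\<integral>\<^sup>+z. ennreal ((u (x - t *\<^sub>R z) - u (x - t *\<^sub>R z - (x - y)))\<^sup>2) \<partial>cube_measure)"
    by (simp add: algebra_simps)
  also have "\<dots> \<le> ennreal ((1 / t) ^ DIM('a)) * trans_sq u (x - y)"
    unfolding trans_sq_def
    by (rule nn_integral_cube_measure_le[where f="\<lambda>z. ennreal ((u z - u (z - (x - y)))\<^sup>2)"]) (use t in auto)
  finally show ?thesis .
qed

text \<open>By Jensen and Fubini the squared error is at most the mean of \<open>trans_sq\<close>
  over shifts t z, and z in the unit cube has norm at most N. The bound is uniform over all
  functions with the same modulus.\<close>

lemma cube_avg_approx:
  fixes u :: "'a::euclidean_space \<Rightarrow> real"
  assumes [measurable]: "u \<in> borel_measurable borel" and t: "t > 0" and b: "\<And>x. \<bar>u x\<bar> \<le> B"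
    and C: "C \<ge> 0" "\<alpha> > 0" and modu: "\<And>h. trans_sq u h \<le> ennreal (C * norm h powr \<alpha>)"
  shows "(\<integral>\<^sup>+x. ennreal ((u x - cube_avg u t x)\<^sup>2) \<partial>lborel) \<le> ennreal (C * (t * real DIM('a)) powr \<alpha>)"
proof -
  interpret Q: prob_space "cube_measure :: 'a measure" by (rule cube_measure_prob)
  interpret P: pair_sigma_finite "lborel :: 'a measure" "cube_measure :: 'a measure" ..
  have i: "integrable cube_measure (\<lambda>z. u (x - t *\<^sub>R z))" for x
    by (rule Q.integrable_const_bound[of _ B]) (use b in auto)
  have "(\<integral>\<^sup>+x. ennreal ((u x - cube_avg u t x)\<^sup>2) \<partial>lborel) \<le> (\<integral>\<^sup>+x. (\<integral>\<^sup>+z. ennreal ((u x - u (x - t *\<^sub>R z))\<^sup>2) \<partial>cube_measure) \<partial>lborel)"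
  proof (rule nn_integral_mono)
    fix x
    have "(LINT z|cube_measure. u x - u (x - t *\<^sub>R z)) = u x - cube_avg u t x"
      unfolding cube_avg_def using i by (subst Bochner_Integration.integral_diff) (auto simp: Q.prob_space)
    moreover have "\<bar>u x - u (x - t *\<^sub>R z)\<bar> \<le> 2 * B" for z
      using b[of "x - t *\<^sub>R z"] b[of x] by linarith
    ultimately show "ennreal ((u x - cube_avg u t x)\<^sup>2) \<le> (\<integral>\<^sup>+z. ennreal ((u x - u (x - t *\<^sub>R z))\<^sup>2) \<partial>cube_measure)"
      using Q.square_integral_le[of "\<lambda>z. u x - u (x - t *\<^sub>R z)" "2 * B"] by simp
  qed
  also have "\<dots> = (\<integral>\<^sup>+z. (\<integral>\<^sup>+x. ennreal ((u x - u (x - t *\<^sub>R z))\<^sup>2) \<partial>lborel) \<partial>cube_measure)"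
    by (rule P.Fubini'[symmetric]) measurable
  also have "\<dots> = (\<integral>\<^sup>+z. trans_sq u (t *\<^sub>R z) \<partial>cube_measure)"
    by (simp add: trans_sq_def)
  also have "\<dots> = (\<integral>\<^sup>+z. indicator (cbox 0 One) z * trans_sq u (t *\<^sub>R z) \<partial>lborel)"
    by (rule nn_integral_cube_measure) measurable
  also have "\<dots> \<le> (\<integral>\<^sup>+z. ennreal (C * (t * real DIM('a)) powr \<alpha>) * indicator (cbox 0 (One::'a)) z \<partial>lborel)"
  proof (rule nn_integral_mono)
    fix z :: 'a
    show "indicator (cbox 0 One) z * trans_sq u (t *\<^sub>R z) \<le> ennreal (C * (t * real DIM('a)) powr \<alpha>) * indicator (cbox 0 One) z"
    proof (cases "z \<in> cbox 0 One")
      case True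
      have "norm (t *\<^sub>R z) \<le> t * real DIM('a)" using norm_le_of_mem_cube[OF True] t by (simp add: mult_left_mono)
      then have "C * norm (t *\<^sub>R z) powr \<alpha> \<le> C * (t * real DIM('a)) powr \<alpha>"
        using C by (intro mult_left_mono powr_mono2) auto
      then have "trans_sq u (t *\<^sub>R z) \<le> ennreal (C * (t * real DIM('a)) powr \<alpha>)"
        using modu[of "t *\<^sub>R z"] by (meson ennreal_leI order_trans)
      then show ?thesis using True by simp
    qed simp
  qed
  also have "\<dots> = ennreal (C * (t * real DIM('a)) powr \<alpha>)"
    by (subst nn_integral_cmult_indicator) (auto simp: emeasure_lborel_cbox_eq)
  finally show ?thesis .
qed

lemma square_sum_le: "ennreal ((a + b)\<^sup>2) \<le> 2 * ennreal (a\<^sup>2) + 2 * ennreal ((b::real)\<^sup>2)"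
proof -
  have "(a + b)\<^sup>2 \<le> 2 * a\<^sup>2 + 2 * b\<^sup>2"
    using sum_squares_bound[of a b] by (simp add: power2_eq_square algebra_simps)
  from ennreal_leI[OF this] show ?thesis by (simp add: ennreal_mult)
qed

lemma nn_integral_L2_triangle:
  fixes f g h :: "'b \<Rightarrow> real"
  assumes [measurable]: "f \<in> borel_measurable M" "g \<in> borel_measurable M" "h \<in> borel_measurable M" "\<rho> \<in> borel_measurable M"
  shows "(\<integral>\<^sup>+x. \<rho> x * ennreal ((f x - h x)\<^sup>2) \<partial>M) \<le> 2 * (\<integral>\<^sup>+x. \<rho> x * ennreal ((f x - g x)\<^sup>2) \<partial>M) + 2 * (\<integral>\<^sup>+x. \<rho> x * ennreal ((g x - h x)\<^sup>2) \<partial>M)"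
proof -
  have "(\<integral>\<^sup>+x. \<rho> x * ennreal ((f x - h x)\<^sup>2) \<partial>M) \<le> (\<integral>\<^sup>+x. 2 * (\<rho> x * ennreal ((f x - g x)\<^sup>2)) + 2 * (\<rho> x * ennreal ((g x - h x)\<^sup>2)) \<partial>M)"
  proof (rule nn_integral_mono)
    fix x
    have "ennreal ((f x - h x)\<^sup>2) \<le> 2 * ennreal ((f x - g x)\<^sup>2) + 2 * ennreal ((g x - h x)\<^sup>2)"
      using square_sum_le[of "f x - g x" "g x - h x"] by simp
    from mult_left_mono[OF this, of "\<rho> x"]
    show "\<rho> x * ennreal ((f x - h x)\<^sup>2) \<le> 2 * (\<rho> x * ennreal ((f x - g x)\<^sup>2)) + 2 * (\<rho> x * ennreal ((g x - h x)\<^sup>2))"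
      by (simp add: distrib_left mult.left_commute)
  qed
  also have "\<dots> = 2 * (\<integral>\<^sup>+x. \<rho> x * ennreal ((f x - g x)\<^sup>2) \<partial>M) + 2 * (\<integral>\<^sup>+x. \<rho> x * ennreal ((g x - h x)\<^sup>2) \<partial>M)"
    by (subst nn_integral_add) (auto simp: nn_integral_cmult)
  finally show ?thesis .
qed

lemma ennreal_pos_below:
  fixes e :: ennreal
  assumes "e > 0"
  obtains e' :: real where "e' > 0" "ennreal e' < e"
proof (cases e)
  case (real x)
  then show ?thesis using assms that[of "x / 2"] by (simp add: ennreal_lessI)
next
  case top
  then show ?thesis using that[of 1] by simp
qed

lemma gauss_nn_integral_finite: "(\<integral>\<^sup>+x. ennreal (gauss (x::'a::euclidean_space)) \<partial>lborel) < \<infinity>"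
  using gauss_integrable[where 'a='a] by (subst nn_integral_eq_integral) auto

text \<open>The averages at each scale 1/(k+1) are bounded and equicontinuous uniformly in n, so a
  diagonal sequence makes them converge everywhere; in L^2 they approximate the functions themselves
  uniformly in n. The Gaussian weight gives a finite measure with the null sets of Lebesgue measure
  and replaces an exhaustion by balls.\<close>

theorem rellich:
  fixes w :: "nat \<Rightarrow> 'a::euclidean_space \<Rightarrow> real"
  assumes [measurable]: "\<And>n. w n \<in> borel_measurable borel"
    and bdd: "\<And>n x. \<bar>w n x\<bar> \<le> B n"
    and p: "p \<ge> 1" and Lp: "\<And>n. (\<integral>\<^sup>+x. ennreal (\<bar>w n x\<bar> powr p) \<partial>lborel) \<le> 1"
    and C: "C \<ge> 0" "\<alpha> > 0" and modu: "\<And>n h. trans_sq (w n) h \<le> ennreal (C * norm h powr \<alpha>)"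
  shows "\<exists>r g. strict_mono (r::nat \<Rightarrow> nat) \<and> g \<in> borel_measurable borel \<and> (AE x in lborel. (\<lambda>n. w (r n) x) \<longlonglongrightarrow> g x)
    \<and> (\<lambda>n. \<integral>\<^sup>+x. ennreal (gauss x) * ennreal ((w (r n) x - g x)\<^sup>2) \<partial>lborel) \<longlonglongrightarrow> 0"
proof -
  define t where "t k = 1 / real (Suc k)" for k
  have t: "t k > 0" for k by (simp add: t_def)
  define b where "b k = 1 + (1 / t k) ^ DIM('a)" for k
  have b: "\<bar>cube_avg (w n) (t k) x\<bar> \<le> b k" for n k x
    unfolding b_def by (rule cube_avg_bound[OF _ t p bdd Lp]) measurable
  obtain D :: "'a set" where D: "countable D" "\<And>X. open X \<Longrightarrow> X \<noteq> {} \<Longrightarrow> \<exists>d\<in>D. d \<in> X"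
    by (rule countable_dense_setE) (rule that)
  have Dne: "D \<noteq> {}" using D(2)[of UNIV] by auto
  define q where "q = from_nat_into D"
  obtain r where r: "strict_mono (r::nat \<Rightarrow> nat)"
    and rc: "\<forall>i. convergent (\<lambda>n. cube_avg (w (r n)) (t (fst (prod_decode i))) (q (snd (prod_decode i))))"
    using diagonal_convergent[of "\<lambda>n i. cube_avg (w n) (t (fst (prod_decode i))) (q (snd (prod_decode i)))" "\<lambda>i. b (fst (prod_decode i))"] b
    by blast
  define v where "v n = w (r n)" for n
  have [measurable]: "v n \<in> borel_measurable borel" for n by (simp add: v_def)
  define A where "A n k x = cube_avg (v n) (t k) x" for n k x
  have [measurable]: "A n k \<in> borel_measurable borel" for n k unfolding A_def[abs_def] by measurable
  have Ab: "\<bar>A n k x\<bar> \<le> b k" for n k x unfolding A_def v_def by (rule b)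
  have convD: "convergent (\<lambda>n. A n k d)" if dD: "d \<in> D" for k d
  proof -
    obtain j where j: "q j = d" using from_nat_into_surj[OF D(1) dD] unfolding q_def by blast
    then show ?thesis using rc[rule_format, of "prod_encode (k, j)"] j by (simp add: A_def v_def)
  qed
  have conv: "convergent (\<lambda>n. A n k x)" for k x
    unfolding Cauchy_convergent_iff[symmetric]
  proof (rule CauchyI)
    fix e :: real assume e: "e > 0"
    define c where "c = (1 / t k) ^ DIM('a) * C + 1"
    have c: "c > 0" using C t[of k] by (auto simp: c_def intro!: add_nonneg_pos)
    \<comment> \<open>Solves c \<delta>^\<alpha> = (e/3)^2; the 1 in \<open>c\<close> keeps the
      divisor positive.\<close>
    define \<delta> where "\<delta> = ((e / 3)\<^sup>2 / c) powr (1 / \<alpha>)"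
    have \<delta>: "\<delta> > 0" using e c by (simp add: \<delta>_def)
    obtain d where d: "d \<in> D" "d \<in> ball x \<delta>" using D(2)[of "ball x \<delta>"] \<delta> by auto
    have near: "\<bar>A n k x - A n k d\<bar> \<le> e / 3" for n
    proof -
      have "ennreal ((A n k x - A n k d)\<^sup>2) \<le> ennreal ((1 / t k) ^ DIM('a)) * trans_sq (v n) (x - d)"
        unfolding A_def v_def by (rule cube_avg_equicont[OF _ t bdd]) measurable
      also have "\<dots> \<le> ennreal ((1 / t k) ^ DIM('a)) * ennreal (C * norm (x - d) powr \<alpha>)"
        unfolding v_def by (intro mult_left_mono modu) auto
      also have "\<dots> = ennreal ((1 / t k) ^ DIM('a) * C * norm (x - d) powr \<alpha>)"
        using t[of k] C by (simp add: ennreal_mult mult.assoc)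
      finally have "(A n k x - A n k d)\<^sup>2 \<le> (1 / t k) ^ DIM('a) * C * norm (x - d) powr \<alpha>"
        using t[of k] C by (subst (asm) ennreal_le_iff) auto
      also have "\<dots> \<le> c * norm (x - d) powr \<alpha>" by (intro mult_right_mono) (auto simp: c_def)
      also have "\<dots> \<le> c * \<delta> powr \<alpha>"
        using d(2) c C by (intro mult_left_mono powr_mono2) (auto simp: dist_norm)
      also have "\<delta> powr \<alpha> = (e / 3)\<^sup>2 / c" using C e c by (simp add: \<delta>_def powr_powr)
      also have "c * ((e / 3)\<^sup>2 / c) = (e / 3)\<^sup>2" using c by simp
      finally show ?thesis using e by (simp add: abs_le_square_iff[symmetric])
    qed
    have "Cauchy (\<lambda>n. A n k d)" using convD[OF d(1)] by (simp add: Cauchy_convergent_iff)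
    then obtain N where N: "\<And>m n. m \<ge> N \<Longrightarrow> n \<ge> N \<Longrightarrow> norm (A m k d - A n k d) < e / 3"
      using CauchyD[of "\<lambda>n. A n k d" "e / 3"] e by auto
    show "\<exists>N. \<forall>m\<ge>N. \<forall>n\<ge>N. norm (A m k x - A n k x) < e"
    proof (intro exI allI impI)
      fix m n assume "m \<ge> N" "n \<ge> N"
      then have "\<bar>A m k d - A n k d\<bar> < e / 3" using N by simp
      then show "norm (A m k x - A n k x) < e" using near[of m] near[of n] unfolding real_norm_def by linarith
    qed
  qed
  define a where "a k x = lim (\<lambda>n. A n k x)" for k x
  have [measurable]: "a k \<in> borel_measurable borel" for k unfolding a_def[abs_def] by measurable
  have alim: "(\<lambda>n. A n k x) \<longlonglongrightarrow> a k x" for k x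
    using conv unfolding a_def by (simp add: convergent_LIMSEQ_iff)
  have ab: "\<bar>a k x\<bar> \<le> b k" for k x
    by (rule LIMSEQ_le_const2[OF tendsto_rabs[OF alim]]) (use Ab in auto)
  let ?N = "\<lambda>f g. \<integral>\<^sup>+x. ennreal (gauss x) * ennreal ((f x - g x)\<^sup>2) \<partial>(lborel::'a measure)"
  have Alim: "(\<lambda>n. ?N (A n k) (a k)) \<longlonglongrightarrow> 0" for k
  proof -
    have "(\<lambda>n. ?N (A n k) (a k)) \<longlonglongrightarrow> (\<integral>\<^sup>+x. 0 \<partial>(lborel::'a measure))"
    proof (rule nn_integral_dominated_convergence[where w="\<lambda>x. ennreal ((2 * b k)\<^sup>2) * ennreal (gauss x)"])
      show "AE x in lborel. ennreal (gauss x) * ennreal ((A n k x - a k x)\<^sup>2) \<le> ennreal ((2 * b k)\<^sup>2) * ennreal (gauss x)" for n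
      proof (intro AE_I2)
        fix x
        have "\<bar>A n k x - a k x\<bar> \<le> 2 * b k" using Ab[of n k x] ab[of k x] by linarith
        from power_mono[OF this, of 2] have "(A n k x - a k x)\<^sup>2 \<le> (2 * b k)\<^sup>2" by simp
        then have "ennreal ((A n k x - a k x)\<^sup>2) \<le> ennreal ((2 * b k)\<^sup>2)" by (rule ennreal_leI)
        then show "ennreal (gauss x) * ennreal ((A n k x - a k x)\<^sup>2) \<le> ennreal ((2 * b k)\<^sup>2) * ennreal (gauss x)"
          by (subst mult.commute) (rule mult_right_mono, simp_all)
      qed
      show "(\<integral>\<^sup>+x. ennreal ((2 * b k)\<^sup>2) * ennreal (gauss x) \<partial>(lborel::'a measure)) < \<infinity>"
        using gauss_nn_integral_finite[where 'a='a] by (subst nn_integral_cmult) (auto simp: ennreal_mult_less_top)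
      show "AE x in lborel. (\<lambda>n. ennreal (gauss x) * ennreal ((A n k x - a k x)\<^sup>2)) \<longlonglongrightarrow> 0"
      proof (intro AE_I2)
        fix x
        have "(\<lambda>n. gauss x * (A n k x - a k x)\<^sup>2) \<longlonglongrightarrow> gauss x * (a k x - a k x)\<^sup>2"
          by (intro tendsto_mult tendsto_power tendsto_diff tendsto_const alim)
        then have "(\<lambda>n. ennreal (gauss x * (A n k x - a k x)\<^sup>2)) \<longlonglongrightarrow> ennreal 0"
          by (intro tendsto_ennrealI) simp
        then show "(\<lambda>n. ennreal (gauss x) * ennreal ((A n k x - a k x)\<^sup>2)) \<longlonglongrightarrow> 0"
          by (simp add: ennreal_mult)
      qed
    qed measurable
    then show ?thesis by simp
  qed
  have vA: "?N (v n) (A n k) \<le> ennreal (C * (t k * real DIM('a)) powr \<alpha>)" for n k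
  proof -
    have "?N (v n) (A n k) \<le> (\<integral>\<^sup>+x. ennreal ((v n x - A n k x)\<^sup>2) \<partial>lborel)"
    proof (rule nn_integral_mono)
      fix x
      have "ennreal (gauss x) * ennreal ((v n x - A n k x)\<^sup>2) \<le> 1 * ennreal ((v n x - A n k x)\<^sup>2)"
        by (intro mult_right_mono) (auto simp: gauss_le_1)
      then show "ennreal (gauss x) * ennreal ((v n x - A n k x)\<^sup>2) \<le> ennreal ((v n x - A n k x)\<^sup>2)" by simp
    qed
    also have "\<dots> \<le> ennreal (C * (t k * real DIM('a)) powr \<alpha>)"
      unfolding A_def v_def by (rule cube_avg_approx[OF _ t bdd C modu]) measurable
    finally show ?thesis .
  qed
  have tsmall: "\<exists>k. C * (t k * real DIM('a)) powr \<alpha> < e" if e: "e > 0" for e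
  proof -
    have "(\<lambda>k. t k * real DIM('a)) \<longlonglongrightarrow> 0 * real DIM('a)"
      unfolding t_def by (intro tendsto_mult tendsto_const LIMSEQ_Suc[OF lim_1_over_n])
    then have "(\<lambda>k. C * (t k * real DIM('a)) powr \<alpha>) \<longlonglongrightarrow> C * (0 * real DIM('a)) powr \<alpha>"
      using C(2) t by (intro tendsto_mult tendsto_const tendsto_powr') (auto intro!: always_eventually less_imp_le)
    then have "(\<lambda>k. C * (t k * real DIM('a)) powr \<alpha>) \<longlonglongrightarrow> 0" by simp
    from order_tendstoD(2)[OF this e] show ?thesis by (auto simp: eventually_sequentially)
  qed
  have dbl: "2 * ennreal x + 2 * ennreal x = ennreal (4 * x)" if "x \<ge> 0" for x
    using that by (simp add: ennreal_mult distrib_right[symmetric])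
  have cau: "\<exists>N. \<forall>m\<ge>N. \<forall>n\<ge>N. ?N (v m) (v n) \<le> ennreal e" if e: "e > 0" for e
  proof -
    \<comment> \<open>Two applications of the squared triangle inequality, each costing a factor 4,
      turn e/16 into e.\<close>
    obtain k where k: "C * (t k * real DIM('a)) powr \<alpha> < e / 16" using tsmall[of "e / 16"] e by auto
    obtain N where N: "\<And>n. n \<ge> N \<Longrightarrow> ?N (A n k) (a k) < ennreal (e / 16)"
      using order_tendstoD(2)[OF Alim[of k], of "ennreal (e / 16)"] e by (auto simp: eventually_sequentially)
    have va: "?N (v n) (a k) \<le> ennreal (e / 4)" if "n \<ge> N" for n
    proof -
      have "?N (v n) (a k) \<le> 2 * ?N (v n) (A n k) + 2 * ?N (A n k) (a k)"
        by (rule nn_integral_L2_triangle) measurable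
      also have "\<dots> \<le> 2 * ennreal (e / 16) + 2 * ennreal (e / 16)"
        using order_trans[OF vA[of n k] ennreal_leI[OF less_imp_le[OF k]]] less_imp_le[OF N[OF that]]
        by (intro add_mono mult_left_mono) auto
      also have "\<dots> = ennreal (4 * (e / 16))" using e by (intro dbl) simp
      finally show ?thesis by simp
    qed
    have "?N (v m) (v n) \<le> ennreal e" if "m \<ge> N" "n \<ge> N" for m n
    proof -
      have "?N (v m) (v n) \<le> 2 * ?N (v m) (a k) + 2 * ?N (a k) (v n)"
        by (rule nn_integral_L2_triangle) measurable
      also have "?N (a k) (v n) = ?N (v n) (a k)" by (simp add: power2_commute)
      also have "2 * ?N (v m) (a k) + 2 * ?N (v n) (a k) \<le> 2 * ennreal (e / 4) + 2 * ennreal (e / 4)"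
        by (intro add_mono mult_left_mono va that) auto
      also have "\<dots> = ennreal (4 * (e / 4))" using e by (intro dbl) simp
      finally show ?thesis by simp
    qed
    then show ?thesis by blast
  qed
  define M where "M = density lborel (\<lambda>x::'a. ennreal (gauss x))"
  have [measurable_cong]: "sets M = sets borel" by (simp add: M_def)
  have finM: "finite_measure M"
  proof
    have "emeasure M (space M) = (\<integral>\<^sup>+x. ennreal (gauss (x::'a)) \<partial>lborel)"
      unfolding M_def by (subst emeasure_density) auto
    then show "emeasure M (space M) \<noteq> \<infinity>" using gauss_nn_integral_finite[where 'a='a] by simp
  qed
  interpret finite_measure M by (rule finM)
  have vint: "integrable M (v n)" for n
    by (rule integrable_const_bound[of _ "B (r n)"]) (use bdd in \<open>auto simp: v_def\<close>)
  \<comment> \<open>For a finite measure, Cauchy in L^2 implies Cauchy in L^1, the form from which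
    an almost everywhere convergent subsequence is extracted; |y| \<le> \<delta> + y^2/\<delta> does
    the work of Cauchy-Schwarz.\<close>
  have L1: "\<exists>N. \<forall>i\<ge>N. \<forall>j\<ge>N. (LINT x|M. norm (v i x - v j x)) < e" if e: "e > 0" for e
  proof -
    define m where "m = measure M (space M)"
    have m: "m \<ge> 0" by (simp add: m_def)
    define \<delta> where "\<delta> = e / (2 * (m + 1))"
    have \<delta>: "\<delta> > 0" "\<delta> * m < e / 2" using e m by (auto simp: \<delta>_def field_simps)
    obtain N where N: "\<And>i j. i \<ge> N \<Longrightarrow> j \<ge> N \<Longrightarrow> ?N (v i) (v j) \<le> ennreal (\<delta> * (e / 2))"
      using cau[of "\<delta> * (e / 2)"] \<delta> e by auto
    have "(LINT x|M. norm (v i x - v j x)) < e" if ij: "i \<ge> N" "j \<ge> N" for i j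
    proof -
      have pt: "\<bar>y\<bar> \<le> \<delta> + y\<^sup>2 / \<delta>" for y :: real
      proof (cases "\<bar>y\<bar> \<le> \<delta>")
        case True then show ?thesis using \<delta> by (simp add: add_increasing2)
      next
        case False
        then have "\<bar>y\<bar> * \<delta> \<le> \<bar>y\<bar> * \<bar>y\<bar>" by (intro mult_left_mono) auto
        then have "\<bar>y\<bar> \<le> y\<^sup>2 / \<delta>" using \<delta> by (simp add: field_simps power2_eq_square)
        then show ?thesis using \<delta> by simp
      qed
      have "ennreal (LINT x|M. norm (v i x - v j x)) = (\<integral>\<^sup>+x. ennreal \<bar>v i x - v j x\<bar> \<partial>M)"
        using vint by (subst nn_integral_eq_integral) auto
      also have "\<dots> \<le> (\<integral>\<^sup>+x. ennreal \<delta> + ennreal (1 / \<delta>) * ennreal ((v i x - v j x)\<^sup>2) \<partial>M)"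
      proof (rule nn_integral_mono)
        fix x
        have "ennreal \<bar>v i x - v j x\<bar> \<le> ennreal (\<delta> + 1 / \<delta> * (v i x - v j x)\<^sup>2)"
          using pt[of "v i x - v j x"] by (intro ennreal_leI) simp
        also have "\<dots> = ennreal \<delta> + ennreal (1 / \<delta>) * ennreal ((v i x - v j x)\<^sup>2)"
          using \<delta>(1) by (simp add: ennreal_mult'[symmetric])
        finally show "ennreal \<bar>v i x - v j x\<bar> \<le> ennreal \<delta> + ennreal (1 / \<delta>) * ennreal ((v i x - v j x)\<^sup>2)" .
      qed
      also have "\<dots> = ennreal \<delta> * emeasure M (space M) + ennreal (1 / \<delta>) * (\<integral>\<^sup>+x. ennreal ((v i x - v j x)\<^sup>2) \<partial>M)"
        by (subst nn_integral_add) (auto simp: nn_integral_cmult)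
      also have "(\<integral>\<^sup>+x. ennreal ((v i x - v j x)\<^sup>2) \<partial>M) = ?N (v i) (v j)"
        unfolding M_def by (subst nn_integral_density) auto
      also have "ennreal \<delta> * emeasure M (space M) + ennreal (1 / \<delta>) * ?N (v i) (v j) \<le> ennreal \<delta> * ennreal m + ennreal (1 / \<delta>) * ennreal (\<delta> * (e / 2))"
        unfolding m_def emeasure_eq_measure by (intro add_left_mono mult_left_mono N ij) auto
      also have "\<dots> = ennreal (\<delta> * m + 1 / \<delta> * (\<delta> * (e / 2)))"
        using \<delta>(1) m e by (simp only: ennreal_mult'[symmetric] less_imp_le zero_le_divide_1_iff) (simp add: ennreal_plus[symmetric] del: ennreal_plus)
      also have "1 / \<delta> * (\<delta> * (e / 2)) = e / 2" using \<delta>(1) by simp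
      finally have "(LINT x|M. norm (v i x - v j x)) \<le> \<delta> * m + e / 2"
        using \<delta>(1) m e by (subst (asm) ennreal_le_iff) auto
      then show ?thesis using \<delta>(2) by simp
    qed
    then show ?thesis by blast
  qed
  obtain s where s: "strict_mono (s::nat \<Rightarrow> nat)" "AE x in M. Cauchy (\<lambda>i. v (s i) x)"
    using cauchy_L1_AE_cauchy_subseq[of M v, OF vint L1] by blast
  have ae: "AE x in lborel. Cauchy (\<lambda>i. v (s i) x)"
  proof -
    have "AE x in lborel. 0 < ennreal (gauss (x::'a)) \<longrightarrow> Cauchy (\<lambda>i. v (s i) x)"
      using s(2) unfolding M_def by (subst (asm) AE_density) auto
    then show ?thesis by eventually_elim (auto simp: gauss_pos)
  qed
  define g where "g x = lim (\<lambda>i. v (s i) x)" for x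
  have [measurable]: "g \<in> borel_measurable borel" unfolding g_def[abs_def] by measurable
  have aeg: "AE x in lborel. (\<lambda>i. v (s i) x) \<longlonglongrightarrow> g x"
    using ae by eventually_elim (simp add: g_def convergent_LIMSEQ_iff[symmetric] Cauchy_convergent_iff)
  have smono: "s n \<ge> n" for n using s(1) by (rule seq_suble)
  \<comment> \<open>Fatou in the second index: the Cauchy bound survives when \<open>v (s m)\<close>
    is replaced by its limit.\<close>
  have final: "(\<lambda>n. ?N (v (s n)) g) \<longlonglongrightarrow> 0"
  proof (rule order_tendstoI)
      fix e :: ennreal assume "e > 0"
      then obtain e' :: real where e': "e' > 0" "ennreal e' < e"
        by (rule ennreal_pos_below) (rule that)
      obtain N where N: "\<And>i j. i \<ge> N \<Longrightarrow> j \<ge> N \<Longrightarrow> ?N (v i) (v j) \<le> ennreal e'"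
        using cau[OF e'(1)] by auto
      have "?N (v (s n)) g \<le> ennreal e'" if n: "n \<ge> N" for n
      proof -
        have "?N (v (s n)) g = (\<integral>\<^sup>+x. liminf (\<lambda>m. ennreal (gauss x) * ennreal ((v (s n) x - v (s m) x)\<^sup>2)) \<partial>(lborel::'a measure))"
        proof (rule nn_integral_cong_AE)
          show "AE x in lborel. ennreal (gauss x) * ennreal ((v (s n) x - g x)\<^sup>2) = liminf (\<lambda>m. ennreal (gauss x) * ennreal ((v (s n) x - v (s m) x)\<^sup>2))"
            using aeg
          proof eventually_elim
            case (elim x)
            have "(\<lambda>m. ennreal (gauss x * (v (s n) x - v (s m) x)\<^sup>2)) \<longlonglongrightarrow> ennreal (gauss x * (v (s n) x - g x)\<^sup>2)"
              by (intro tendsto_ennrealI tendsto_mult tendsto_power tendsto_diff tendsto_const elim)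
            then show ?case by (simp add: ennreal_mult lim_imp_Liminf)
          qed
        qed
        also have "\<dots> \<le> liminf (\<lambda>m. ?N (v (s n)) (v (s m)))"
          by (rule nn_integral_liminf) measurable
        also have "\<dots> \<le> ennreal e'"
        proof (rule Liminf_le)
          show "\<forall>\<^sub>F m in sequentially. ?N (v (s n)) (v (s m)) \<le> ennreal e'"
            unfolding eventually_sequentially
          proof (intro exI[of _ N] allI impI)
            fix m assume m: "N \<le> m"
            show "?N (v (s n)) (v (s m)) \<le> ennreal e'"
              using smono[of n] smono[of m] n m by (intro N) linarith+
          qed
        qed simp
        finally show ?thesis .
      qed
      then show "\<forall>\<^sub>F n in sequentially. ?N (v (s n)) g < e"
        using e'(2) by (auto simp: eventually_sequentially intro!: exI[of _ N] intro: le_less_trans)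
  qed simp
  show ?thesis
  proof (intro exI conjI)
    show "strict_mono (r \<circ> s)" using r s(1) by (simp add: strict_mono_o)
    show "AE x in lborel. (\<lambda>n. w ((r \<circ> s) n) x) \<longlonglongrightarrow> g x" using aeg by (simp add: v_def)
    show "(\<lambda>n. ?N (w ((r \<circ> s) n)) g) \<longlonglongrightarrow> 0" using final by (simp add: v_def)
  qed measurable
qed

section \<open>Convexity and limits of the energy\<close>

lemma AE_translate:
  fixes h :: "'a::euclidean_space"
  assumes [measurable]: "Measurable.pred borel P" and "AE x in lborel. P x"
  shows "AE x in lborel. P (x - h)"
proof -
  have "AE x in distr lborel borel ((+) (- h)). P x" using assms(2) unfolding lborel_distr_plus .
  then show ?thesis by (subst (asm) AE_distr_iff) auto
qed

context levy
begin

interpretation nu: finite_measure \<nu> by (rule finite_nu)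
interpretation P1: pair_sigma_finite "lborel :: real measure" \<nu> ..
interpretation P2: pair_sigma_finite "lborel :: 'a measure" "lborel \<Otimes>\<^sub>M \<nu> :: (real \<times> 'a) measure" ..

text \<open>The energy is the squared \<open>L\<^sup>2\<close> norm of the weighted increments of \<open>u\<close>.\<close>

definition incr_space :: "('a \<times> real \<times> 'a) measure" where
  "incr_space = lborel \<Otimes>\<^sub>M (lborel \<Otimes>\<^sub>M \<nu>)"

definition incr :: "('a \<Rightarrow> real) \<Rightarrow> 'a \<times> real \<times> 'a \<Rightarrow> real" where
  "incr u = (\<lambda>(x, r, \<theta>). sqrt (if r > 0 then r powr (- 1 - \<alpha>) else 0) * (u x - u (x - r *\<^sub>R \<theta>)))"

lemma incr_measurable[measurable]:
  assumes [measurable]: "u \<in> borel_measurable borel"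
  shows "incr u \<in> borel_measurable incr_space"
  unfolding incr_def incr_space_def by measurable

lemma incr_sq: "ennreal ((incr u (x, r, \<theta>))\<^sup>2) = levy_weight \<alpha> r * ennreal ((u x - u (x - r *\<^sub>R \<theta>))\<^sup>2)"
  by (simp add: incr_def levy_weight_def power_mult_distrib ennreal_mult)

lemma two_E_incr:
  assumes [measurable]: "u \<in> borel_measurable borel"
  shows "2 * E u = (\<integral>\<^sup>+z. ennreal ((incr u z)\<^sup>2) \<partial>incr_space)"
proof -
  let ?f = "\<lambda>x r \<theta>. levy_weight \<alpha> r * ennreal ((u x - u (x - r *\<^sub>R \<theta>))\<^sup>2)"
  have "2 * E u = (\<integral>\<^sup>+\<theta>. (\<integral>\<^sup>+r. (\<integral>\<^sup>+x. ?f x r \<theta> \<partial>lborel) \<partial>lborel) \<partial>\<nu>)"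
    unfolding two_E ray_energy_def trans_sq_def by (simp add: nn_integral_cmult)
  also have "\<dots> = (\<integral>\<^sup>+y. (\<integral>\<^sup>+x. ?f x (fst y) (snd y) \<partial>lborel) \<partial>(lborel \<Otimes>\<^sub>M \<nu>))"
    by (subst P1.nn_integral_snd[symmetric]) auto
  also have "\<dots> = (\<integral>\<^sup>+z. ?f (fst z) (fst (snd z)) (snd (snd z)) \<partial>incr_space)"
    unfolding incr_space_def by (subst P2.nn_integral_snd[symmetric]) auto
  also have "\<dots> = (\<integral>\<^sup>+z. ennreal ((incr u z)\<^sup>2) \<partial>incr_space)"
    by (intro nn_integral_cong) (metis incr_sq prod.collapse)
  finally show ?thesis .
qed

text \<open>For fixed r and \<theta> the increments converge at x once the functions converge at x
  and at x - r\<theta>, which fails only on two null sets. Fubini turns this into a statement on the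
  product space.\<close>

lemma incr_tendsto_AE:
  assumes [measurable]: "\<And>n. u n \<in> borel_measurable borel" "v \<in> borel_measurable borel"
    and lim: "AE x in lborel. (\<lambda>n::nat. u n x) \<longlonglongrightarrow> v x"
  shows "AE z in incr_space. (\<lambda>n. incr (u n) z) \<longlonglongrightarrow> incr v z"
proof -
  define S where "S x \<longleftrightarrow> (\<lambda>n. u n x) \<longlonglongrightarrow> v x" for x
  have [measurable]: "Measurable.pred borel S"
  proof -
    have "S = (\<lambda>x. (\<lambda>n. u n x - v x) \<longlonglongrightarrow> 0)" unfolding S_def[abs_def] by (simp add: LIM_zero_iff)
    then show ?thesis by (simp only:) (rule measurable_limit, measurable)
  qed
  have "AE y in lborel \<Otimes>\<^sub>M \<nu>. AE x in lborel. S x \<and> S (x - fst y *\<^sub>R snd y)"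
  proof (rule AE_I2)
    fix y :: "real \<times> 'a"
    have "AE x in lborel. S x" using lim by (simp add: S_def)
    moreover from this have "AE x in lborel. S (x - fst y *\<^sub>R snd y)" by (intro AE_translate) measurable
    ultimately show "AE x in lborel. S x \<and> S (x - fst y *\<^sub>R snd y)" by eventually_elim auto
  qed
  moreover have m: "{z \<in> space (lborel \<Otimes>\<^sub>M (lborel \<Otimes>\<^sub>M \<nu>)). (\<lambda>x y. S x \<and> S (x - fst y *\<^sub>R snd y)) (fst z) (snd z)} \<in> sets (lborel \<Otimes>\<^sub>M (lborel \<Otimes>\<^sub>M \<nu>))"
    by measurable
  ultimately have "AE x in lborel. AE y in lborel \<Otimes>\<^sub>M \<nu>. S x \<and> S (x - fst y *\<^sub>R snd y)"
    using P2.AE_commute[OF m] by simp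
  then have "AE z in incr_space. S (fst z) \<and> S (fst z - fst (snd z) *\<^sub>R snd (snd z))"
    unfolding incr_space_def using P2.AE_pair_iff[OF m] by simp
  then show ?thesis
  proof eventually_elim
    case (elim z)
    obtain x r \<theta> where z: "z = (x, r, \<theta>)" by (cases z) auto
    show ?case using elim unfolding z incr_def S_def
      by (auto intro!: tendsto_mult tendsto_diff tendsto_const)
  qed
qed

lemma E_liminf:
  assumes [measurable]: "\<And>n. u n \<in> borel_measurable borel" "v \<in> borel_measurable borel"
    and lim: "AE x in lborel. (\<lambda>n::nat. u n x) \<longlonglongrightarrow> v x"
    and le: "\<forall>\<^sub>F n in sequentially. E (u n) \<le> ennreal e"
  shows "E v \<le> ennreal e"
proof -
  have "2 * E v = (\<integral>\<^sup>+z. liminf (\<lambda>n. ennreal ((incr (u n) z)\<^sup>2)) \<partial>incr_space)"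
    unfolding two_E_incr[OF assms(2)]
  proof (rule nn_integral_cong_AE)
    show "AE z in incr_space. ennreal ((incr v z)\<^sup>2) = liminf (\<lambda>n. ennreal ((incr (u n) z)\<^sup>2))"
      using incr_tendsto_AE[OF assms(1,2) lim]
    proof eventually_elim
      case (elim z)
      have "(\<lambda>n. ennreal ((incr (u n) z)\<^sup>2)) \<longlonglongrightarrow> ennreal ((incr v z)\<^sup>2)"
        by (intro tendsto_ennrealI tendsto_power elim)
      from lim_imp_Liminf[OF sequentially_bot this] show ?case by simp
    qed
  qed
  also have "\<dots> \<le> liminf (\<lambda>n. \<integral>\<^sup>+z. ennreal ((incr (u n) z)\<^sup>2) \<partial>incr_space)"
    by (rule nn_integral_liminf) measurable
  also have "\<dots> = liminf (\<lambda>n. 2 * E (u n))" by (simp add: two_E_incr)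
  also have "\<dots> \<le> 2 * ennreal e"
  proof (rule Liminf_le)
    show "\<forall>\<^sub>F n in sequentially. 2 * E (u n) \<le> 2 * ennreal e"
      using le by eventually_elim (rule mult_left_mono, auto)
  qed simp
  finally have "2 * E v \<le> 2 * ennreal e" .
  then show ?thesis by (simp add: ennreal_mult_le_mult_iff)
qed

lemma incr_cmult: "incr (\<lambda>x. c * u x) z = c * incr u z"
  by (cases z) (simp add: incr_def right_diff_distrib)

lemma incr_diff: "incr (\<lambda>x. u x - v x) z = incr u z - incr v z"
  by (cases z) (simp add: incr_def algebra_simps)

lemma incr_add: "incr (\<lambda>x. u x + v x) z = incr u z + incr v z"
  by (cases z) (simp add: incr_def algebra_simps)

lemma two_mult_cancel: "2 * a = 2 * (b::ennreal) \<Longrightarrow> a = b"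
  by (metis ennreal_mult_cancel_left ennreal_numeral ennreal_less_top infinity_ennreal_def order_less_irrefl zero_neq_numeral)

lemma two_mult_le_cancel: "2 * a \<le> 2 * (b::ennreal) \<Longrightarrow> a \<le> b"
  by (simp add: ennreal_mult_le_mult_iff)

lemma E_cmult:
  assumes [measurable]: "u \<in> borel_measurable borel"
  shows "E (\<lambda>x. c * u x) = ennreal (c\<^sup>2) * E u"
proof (rule two_mult_cancel)
  have "2 * E (\<lambda>x. c * u x) = (\<integral>\<^sup>+z. ennreal (c\<^sup>2) * ennreal ((incr u z)\<^sup>2) \<partial>incr_space)"
    by (subst two_E_incr) (auto simp: incr_cmult power_mult_distrib ennreal_mult)
  also have "\<dots> = 2 * (ennreal (c\<^sup>2) * E u)"
    by (subst nn_integral_cmult) (auto simp: two_E_incr[symmetric] mult.left_commute)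
  finally show "2 * E (\<lambda>x. c * u x) = 2 * (ennreal (c\<^sup>2) * E u)" .
qed

lemma E_minus_commute:
  assumes [measurable]: "u \<in> borel_measurable borel" "v \<in> borel_measurable borel"
  shows "E (\<lambda>x. u x - v x) = E (\<lambda>x. v x - u x)"
  using E_cmult[of "\<lambda>x. u x - v x" "-1"] by simp

text \<open>Written with the midpoint, the operation under which \<open>tail_hull\<close> is
  closed.\<close>

lemma E_parallelogram:
  assumes [measurable]: "u \<in> borel_measurable borel" "v \<in> borel_measurable borel"
  shows "E (\<lambda>x. u x - v x) + 4 * E (\<lambda>x. (u x + v x) / 2) = 2 * E u + 2 * E v"
proof (rule two_mult_cancel)
  have e: "ennreal ((incr (\<lambda>x. u x - v x) z)\<^sup>2) + 4 * ennreal ((incr (\<lambda>x. (u x + v x) / 2) z)\<^sup>2)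
     = 2 * ennreal ((incr u z)\<^sup>2) + 2 * ennreal ((incr v z)\<^sup>2)" for z
  proof -
    have m: "incr (\<lambda>x. (u x + v x) / 2) z = (incr u z + incr v z) / 2"
      using incr_cmult[of "1/2" "\<lambda>x. u x + v x" z] incr_add[of u v z] by simp
    have "(incr u z - incr v z)\<^sup>2 + 4 * ((incr u z + incr v z) / 2)\<^sup>2 = 2 * (incr u z)\<^sup>2 + 2 * (incr v z)\<^sup>2"
      by (simp add: power2_eq_square field_simps)
    then have "ennreal ((incr u z - incr v z)\<^sup>2 + 4 * ((incr u z + incr v z) / 2)\<^sup>2) = ennreal (2 * (incr u z)\<^sup>2 + 2 * (incr v z)\<^sup>2)"
      by (rule arg_cong)
    moreover have "ennreal ((incr u z - incr v z)\<^sup>2 + 4 * ((incr u z + incr v z) / 2)\<^sup>2)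
      = ennreal ((incr u z - incr v z)\<^sup>2) + 4 * ennreal (((incr u z + incr v z) / 2)\<^sup>2)"
      by (subst ennreal_plus) (simp_all add: ennreal_mult)
    moreover have "ennreal (2 * (incr u z)\<^sup>2 + 2 * (incr v z)\<^sup>2) = 2 * ennreal ((incr u z)\<^sup>2) + 2 * ennreal ((incr v z)\<^sup>2)"
      by (subst ennreal_plus) (simp_all add: ennreal_mult)
    ultimately show ?thesis unfolding m incr_diff by simp
  qed
  have "2 * (E (\<lambda>x. u x - v x) + 4 * E (\<lambda>x. (u x + v x) / 2))
    = (\<integral>\<^sup>+z. ennreal ((incr (\<lambda>x. u x - v x) z)\<^sup>2) \<partial>incr_space) + 4 * (\<integral>\<^sup>+z. ennreal ((incr (\<lambda>x. (u x + v x) / 2) z)\<^sup>2) \<partial>incr_space)"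
    by (simp add: two_E_incr[symmetric] distrib_left mult.left_commute)
  also have "\<dots> = (\<integral>\<^sup>+z. ennreal ((incr (\<lambda>x. u x - v x) z)\<^sup>2) + 4 * ennreal ((incr (\<lambda>x. (u x + v x) / 2) z)\<^sup>2) \<partial>incr_space)"
    by (subst nn_integral_add) (auto simp: nn_integral_cmult)
  also have "\<dots> = (\<integral>\<^sup>+z. 2 * ennreal ((incr u z)\<^sup>2) + 2 * ennreal ((incr v z)\<^sup>2) \<partial>incr_space)"
    by (simp only: e)
  also have "\<dots> = 2 * (\<integral>\<^sup>+z. ennreal ((incr u z)\<^sup>2) \<partial>incr_space) + 2 * (\<integral>\<^sup>+z. ennreal ((incr v z)\<^sup>2) \<partial>incr_space)"
    by (subst nn_integral_add) (auto simp: nn_integral_cmult)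
  also have "\<dots> = 2 * (2 * E u + 2 * E v)"
    by (simp add: two_E_incr[symmetric] distrib_left)
  finally show "2 * (E (\<lambda>x. u x - v x) + 4 * E (\<lambda>x. (u x + v x) / 2)) = 2 * (2 * E u + 2 * E v)" .
qed

text \<open>From (a+b)^2 \<le> (1+\<eta>) a^2 + (1+1/\<eta>) b^2: a triangle inequality for the
  energy without square roots, with leading constant as near to 1 as desired.\<close>

lemma E_young:
  assumes [measurable]: "u \<in> borel_measurable borel" "v \<in> borel_measurable borel" and \<eta>: "\<eta> > 0"
  shows "E u \<le> ennreal (1 + \<eta>) * E v + ennreal (1 + 1 / \<eta>) * E (\<lambda>x. u x - v x)"
proof -
  have e: "ennreal ((incr u z)\<^sup>2) \<le> ennreal (1 + \<eta>) * ennreal ((incr v z)\<^sup>2) + ennreal (1 + 1 / \<eta>) * ennreal ((incr (\<lambda>x. u x - v x) z)\<^sup>2)" for z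
  proof -
    define a b where "a = incr v z" and "b = incr u z - incr v z"
    have "0 \<le> (\<eta> * a - b)\<^sup>2 / \<eta>" using \<eta> by simp
    also have "(\<eta> * a - b)\<^sup>2 / \<eta> = \<eta> * a\<^sup>2 + b\<^sup>2 / \<eta> - 2 * a * b"
      using \<eta> by (simp add: power2_eq_square field_simps)
    finally have "2 * a * b \<le> \<eta> * a\<^sup>2 + b\<^sup>2 / \<eta>" by simp
    then have "(a + b)\<^sup>2 \<le> (1 + \<eta>) * a\<^sup>2 + (1 + 1 / \<eta>) * b\<^sup>2"
      by (simp add: power2_sum algebra_simps)
    then have "ennreal ((a + b)\<^sup>2) \<le> ennreal ((1 + \<eta>) * a\<^sup>2 + (1 + 1 / \<eta>) * b\<^sup>2)" by (rule ennreal_leI)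
    also have "\<dots> = ennreal (1 + \<eta>) * ennreal (a\<^sup>2) + ennreal (1 + 1 / \<eta>) * ennreal (b\<^sup>2)"
      using \<eta> by (subst ennreal_plus) (auto simp: ennreal_mult'' simp del: ennreal_plus)
    finally show ?thesis unfolding incr_diff by (simp add: a_def b_def)
  qed
  have "2 * E u \<le> (\<integral>\<^sup>+z. ennreal (1 + \<eta>) * ennreal ((incr v z)\<^sup>2) + ennreal (1 + 1 / \<eta>) * ennreal ((incr (\<lambda>x. u x - v x) z)\<^sup>2) \<partial>incr_space)"
    unfolding two_E_incr[OF assms(1)] by (intro nn_integral_mono e)
  also have "\<dots> = ennreal (1 + \<eta>) * (\<integral>\<^sup>+z. ennreal ((incr v z)\<^sup>2) \<partial>incr_space) + ennreal (1 + 1 / \<eta>) * (\<integral>\<^sup>+z. ennreal ((incr (\<lambda>x. u x - v x) z)\<^sup>2) \<partial>incr_space)"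
    by (subst nn_integral_add) (auto simp: nn_integral_cmult simp del: ennreal_plus)
  also have "\<dots> = 2 * (ennreal (1 + \<eta>) * E v + ennreal (1 + 1 / \<eta>) * E (\<lambda>x. u x - v x))"
    by (simp add: two_E_incr[symmetric] distrib_left mult.left_commute del: ennreal_plus)
  finally show ?thesis by (rule two_mult_le_cancel)
qed

text \<open>The scalar lemma with exponent 2 on \<open>incr_space\<close>. It applies because
  \<open>incr\<close> is linear, so the difference of increments is the increment of the
  difference.\<close>

lemma E_brezis_lieb:
  assumes [measurable]: "\<And>n. u n \<in> borel_measurable borel" "v \<in> borel_measurable borel"
    and lim: "AE x in lborel. (\<lambda>n::nat. u n x) \<longlonglongrightarrow> v x"
    and K: "\<And>n. E (u n) \<le> ennreal K" "K \<ge> 0"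
  shows "E v < \<infinity>" "\<And>n. E (\<lambda>x. u n x - v x) < \<infinity>"
    "(\<lambda>n. enn2real (E (u n)) - enn2real (E (\<lambda>x. u n x - v x))) \<longlonglongrightarrow> enn2real (E v)"
proof -
  have pw: "\<bar>a\<bar> powr 2 = a\<^sup>2" for a :: real by (cases "a = 0") auto
  have fin: "(\<integral>\<^sup>+z. ennreal ((incr (u n) z)\<^sup>2) \<partial>incr_space) \<le> ennreal (2 * K)" for n
    using mult_left_mono[OF K(1), of 2] K(2) by (simp add: two_E_incr[symmetric] ennreal_mult)
  have int: "integrable incr_space (\<lambda>z. (incr (u n) z)\<^sup>2)" for n
    by (rule integrableI_bounded) (use le_less_trans[OF fin[of n]] in auto)
  have bd: "(LINT z|incr_space. (incr (u n) z)\<^sup>2) \<le> 2 * K" for n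
    using fin[of n] int[of n] K(2) by (simp add: nn_integral_eq_integral)
  note bl = brezis_lieb[of 2 "\<lambda>n. incr (u n)" incr_space "incr v" "2 * K", unfolded pw, OF _ _ _ int bd incr_tendsto_AE[OF assms(1,2) lim], simplified]
  have e: "E f = ennreal ((LINT z|incr_space. (incr f z)\<^sup>2) / 2)"
    if "f \<in> borel_measurable borel" "integrable incr_space (\<lambda>z. (incr f z)\<^sup>2)" for f
  proof (rule two_mult_cancel)
    have "2 * E f = ennreal (LINT z|incr_space. (incr f z)\<^sup>2)"
      unfolding two_E_incr[OF that(1)] using that(2) by (rule nn_integral_eq_integral) auto
    also have "\<dots> = 2 * ennreal ((LINT z|incr_space. (incr f z)\<^sup>2) / 2)"
      by (subst ennreal_numeral[symmetric], subst ennreal_mult[symmetric]) auto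
    finally show "2 * E f = 2 * ennreal ((LINT z|incr_space. (incr f z)\<^sup>2) / 2)" .
  qed
  have i2: "integrable incr_space (\<lambda>z. (incr (\<lambda>x. u n x - v x) z)\<^sup>2)" for n
    unfolding incr_diff by (rule bl(2)) measurable
  have iv: "integrable incr_space (\<lambda>z. (incr v z)\<^sup>2)" by (rule bl(1)) measurable
  show "E v < \<infinity>" using e[OF assms(2) iv] by simp
  show "E (\<lambda>x. u n x - v x) < \<infinity>" for n using e[OF _ i2[of n]] by simp
  have "(\<lambda>n. (LINT z|incr_space. (incr (u n) z)\<^sup>2) - (LINT z|incr_space. (incr (u n) z - incr v z)\<^sup>2)) \<longlonglongrightarrow> (LINT z|incr_space. (incr v z)\<^sup>2)"
    by (rule bl(3)) measurable
  then have "(\<lambda>n. ((LINT z|incr_space. (incr (u n) z)\<^sup>2) - (LINT z|incr_space. (incr (u n) z - incr v z)\<^sup>2)) / 2) \<longlonglongrightarrow> (LINT z|incr_space. (incr v z)\<^sup>2) / 2"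
    by (intro tendsto_divide tendsto_const) auto
  then show "(\<lambda>n. enn2real (E (u n)) - enn2real (E (\<lambda>x. u n x - v x))) \<longlonglongrightarrow> enn2real (E v)"
    using e[OF assms(1) int] e[OF _ i2] e[OF assms(2) iv] by (simp add: incr_diff diff_divide_distrib)
qed

end

section \<open>Midpoint hulls of tails\<close>

inductive_set tail_hull :: "(nat \<Rightarrow> 'a \<Rightarrow> real) \<Rightarrow> nat \<Rightarrow> ('a \<Rightarrow> real) set" for v n where
  base: "k \<ge> n \<Longrightarrow> v k \<in> tail_hull v n"
| mid: "f \<in> tail_hull v n \<Longrightarrow> g \<in> tail_hull v n \<Longrightarrow> (\<lambda>x. (f x + g x) / 2) \<in> tail_hull v n"

lemma tail_hull_mono: "f \<in> tail_hull v m \<Longrightarrow> n \<le> m \<Longrightarrow> f \<in> tail_hull v n"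
  by (induction rule: tail_hull.induct) (auto intro: tail_hull.intros)

text \<open>An interval around y is closed under midpoints. Hence any choice of elements from
  successive hulls keeps the pointwise limit of v.\<close>

lemma tail_hull_close:
  assumes "f \<in> tail_hull v n" and c: "\<And>k. k \<ge> n \<Longrightarrow> \<bar>v k x - y\<bar> \<le> \<epsilon>"
  shows "\<bar>f x - y\<bar> \<le> \<epsilon>"
  using assms(1)
proof induction
  case (base k)
  then show ?case by (rule c)
next
  case (mid f g)
  then show ?case by (simp add: abs_le_iff field_simps)
qed

lemma test_functions_mid:
  assumes "f \<in> test_functions" "g \<in> test_functions"
  shows "(\<lambda>x. (f x + g x) / 2) \<in> test_functions"
  using test_functions_cmult[OF test_functions_add[OF assms], of "1/2"] by simp

lemma tail_hull_test: "f \<in> tail_hull v n \<Longrightarrow> (\<And>k. v k \<in> test_functions) \<Longrightarrow> f \<in> test_functions"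
  by (induction rule: tail_hull.induct) (auto intro: test_functions_mid)

context levy
begin

lemma tail_hull_E_le:
  assumes f: "f \<in> tail_hull v n" and v: "\<And>k. v k \<in> test_functions" and K: "\<And>k. E (v k) \<le> ennreal K"
  shows "E f \<le> ennreal K"
  using f
proof induction
  case (mid f g)
  have [measurable]: "f \<in> borel_measurable borel" "g \<in> borel_measurable borel"
    using tail_hull_test[OF mid.hyps(1) v] tail_hull_test[OF mid.hyps(2) v] by (auto intro: test_functions_borel)
  have "4 * E (\<lambda>x. (f x + g x) / 2) \<le> E (\<lambda>x. f x - g x) + 4 * E (\<lambda>x. (f x + g x) / 2)" by simp
  also have "\<dots> = 2 * E f + 2 * E g" by (rule E_parallelogram) measurable
  also have "\<dots> \<le> 2 * ennreal K + 2 * ennreal K" by (intro add_mono mult_left_mono mid.IH) auto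
  also have "\<dots> = 4 * ennreal K" by (simp add: distrib_right[symmetric])
  finally show ?case by (simp add: ennreal_mult_le_mult_iff)
qed (rule K)

text \<open>Lower semicontinuity in the second index of the Cauchy condition. The almost everywhere
  limit is thereby recognised as the limit in energy, without any appeal to completeness.\<close>

lemma E_cauchy_limit:
  assumes [measurable]: "\<And>n. z n \<in> borel_measurable borel" "w \<in> borel_measurable borel"
    and lim: "AE x in lborel. (\<lambda>n::nat. z n x) \<longlonglongrightarrow> w x"
    and cau: "\<And>\<epsilon>. \<epsilon> > 0 \<Longrightarrow> \<exists>N. \<forall>m\<ge>N. \<forall>n\<ge>N. E (\<lambda>x. z m x - z n x) \<le> ennreal \<epsilon>"
  shows "(\<lambda>n. E (\<lambda>x. z n x - w x)) \<longlonglongrightarrow> 0"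
proof (rule order_tendstoI)
  fix e :: ennreal assume "e > 0"
  then obtain e' :: real where e': "e' > 0" "ennreal e' < e" by (rule ennreal_pos_below) (rule that)
  obtain N where N: "\<And>m n. m \<ge> N \<Longrightarrow> n \<ge> N \<Longrightarrow> E (\<lambda>x. z m x - z n x) \<le> ennreal e'" using cau[OF e'(1)] by blast
  have "E (\<lambda>x. z n x - w x) \<le> ennreal e'" if n: "n \<ge> N" for n
  proof (rule E_liminf[where u="\<lambda>m x. z n x - z m x"])
    show "AE x in lborel. (\<lambda>m. z n x - z m x) \<longlonglongrightarrow> z n x - w x"
      using lim by eventually_elim (intro tendsto_diff tendsto_const)
    show "\<forall>\<^sub>F m in sequentially. E (\<lambda>x. z n x - z m x) \<le> ennreal e'"
      unfolding eventually_sequentially using N n by blast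
  qed measurable
  then show "\<forall>\<^sub>F n in sequentially. E (\<lambda>x. z n x - w x) < e"
    unfolding eventually_sequentially using e'(2) by (blast intro: le_less_trans)
qed simp

text \<open>Instead of weak compactness: almost-minimal elements of the convex tails form a Cauchy sequence by the
  parallelogram identity. Midpoints suffice.\<close>

lemma mazur_tail:
  assumes v: "\<And>n. v n \<in> test_functions" and K: "\<And>n. E (v n) \<le> ennreal K"
    and lim: "AE x in lborel. (\<lambda>n::nat. v n x) \<longlonglongrightarrow> w x"
  shows "\<exists>z. (\<forall>n. z n \<in> test_functions) \<and> (AE x in lborel. (\<lambda>n::nat. z n x) \<longlonglongrightarrow> w x) \<and>
     (\<forall>\<epsilon>>0. \<exists>N. \<forall>m\<ge>N. \<forall>n\<ge>N. E (\<lambda>x. z m x - z n x) \<le> ennreal \<epsilon>)"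
proof -
  define e where "e f = enn2real (E f)" for f
  define d where "d n = Inf (e ` tail_hull v n)" for n
  \<comment> \<open>\<open>ennreal K\<close> is 0 for negative K; this is the real number that it
    stands for.\<close>
  define K' where "K' = max K 0"
  have ht: "f \<in> test_functions" if "f \<in> tail_hull v n" for f n using tail_hull_test[OF that v] .
  have Ee: "E f = ennreal (e f)" if "f \<in> test_functions" for f
    using E_test_finite[OF that] by (simp add: e_def)
  have e0: "0 \<le> e f" for f by (simp add: e_def)
  have eK: "e f \<le> K'" if "f \<in> tail_hull v n" for f n
  proof -
    have "ennreal (e f) \<le> ennreal K'"
      using order_trans[OF tail_hull_E_le[OF that v K], of "ennreal K'"] Ee[OF ht[OF that]] by (simp add: K'_def ennreal_leI)
    then show ?thesis by (subst (asm) ennreal_le_iff) (auto simp: K'_def)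
  qed
  have bdd: "bdd_below (e ` tail_hull v n)" for n using e0 by (auto intro!: bdd_belowI[of _ 0])
  have dle: "d n \<le> e f" if "f \<in> tail_hull v n" for f n
    unfolding d_def using that by (intro cInf_lower bdd) auto
  have vn: "v n \<in> tail_hull v n" for n by (rule tail_hull.base) simp
  have dmono: "d n \<le> d m" if "n \<le> m" for n m
    unfolding d_def using vn[of m] tail_hull_mono[OF _ that] by (intro cInf_superset_mono bdd) auto
  have dK: "d n \<le> K'" for n using dle[OF vn] eK[OF vn] by (rule order_trans)
  \<comment> \<open>The hulls shrink, so their infima increase, and they stay below
    \<open>K'\<close>. That d is therefore Cauchy drives the argument.\<close>
  have "incseq d" using dmono by (simp add: incseq_def)
  from incseq_convergent[OF this, of K'] dK obtain L where "d \<longlonglongrightarrow> L" by blast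
  then have "convergent d" by (rule convergentI)
  then have dC: "Cauchy d" by (simp add: Cauchy_convergent_iff)
  have "\<exists>f. f \<in> tail_hull v n \<and> e f < d n + 1 / real (Suc n)" for n
  proof -
    have "Inf (e ` tail_hull v n) < d n + 1 / real (Suc n)" by (simp add: d_def)
    from cInf_lessD[OF _ this] show ?thesis using vn by blast
  qed
  then obtain z where z: "\<And>n. z n \<in> tail_hull v n" "\<And>n. e (z n) < d n + 1 / real (Suc n)" by metis
  have zt: "z n \<in> test_functions" for n using ht[OF z(1)] .
  have [measurable]: "z n \<in> borel_measurable borel" for n using zt by (rule test_functions_borel)
  \<comment> \<open>The midpoint lies in the hull of index n, so its energy is at least d n. The
    parallelogram identity leaves at most 2 e(z n) + 2 e(z m) - 4 d n, where both energies are
    within 1/(n+1) of d n and d m.\<close>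
  have diff: "e (\<lambda>x. z n x - z m x) \<le> 2 * (d m - d n) + 4 / real (Suc n)" if nm: "n \<le> m" for n m
  proof -
    let ?mid = "\<lambda>x. (z n x + z m x) / 2"
    have midn: "?mid \<in> tail_hull v n" by (intro tail_hull.mid z(1) tail_hull_mono[OF z(1) nm])
    have f1: "ennreal (e (\<lambda>x. z n x - z m x)) + 4 * ennreal (e ?mid) = 2 * ennreal (e (z n)) + 2 * ennreal (e (z m))"
      using E_parallelogram[of "z n" "z m"] Ee[OF zt] Ee[OF ht[OF midn]] Ee[OF test_functions_diff[OF zt zt]] by simp
    have f2: "ennreal (e (\<lambda>x. z n x - z m x)) + 4 * ennreal (e ?mid) = ennreal (e (\<lambda>x. z n x - z m x) + 4 * e ?mid)"
      using e0 by (simp add: ennreal_mult)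
    have f3: "2 * ennreal (e (z n)) + 2 * ennreal (e (z m)) = ennreal (2 * e (z n) + 2 * e (z m))"
      using e0 by (simp add: ennreal_mult)
    have "ennreal (e (\<lambda>x. z n x - z m x) + 4 * e ?mid) = ennreal (2 * e (z n) + 2 * e (z m))"
      by (rule trans[OF f2[symmetric] trans[OF f1 f3]])
    then have eq: "e (\<lambda>x. z n x - z m x) + 4 * e ?mid = 2 * e (z n) + 2 * e (z m)"
      by (subst (asm) ennreal_inj) (auto intro!: add_nonneg_nonneg e0)
    define q where "q = 1 / real (Suc n)"
    have "1 / real (Suc m) \<le> q" using nm by (simp add: q_def frac_le)
    then have b: "e (z n) < d n + q" "e (z m) < d m + q" using z(2)[of n] z(2)[of m] by (auto simp: q_def)
    have "D + 4 * M = 2 * a + 2 * b \<Longrightarrow> a < d n + q \<Longrightarrow> b < d m + q \<Longrightarrow> d n \<le> M \<Longrightarrow> D \<le> 2 * (d m - d n) + 4 * q"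
      for D M a b :: real by argo
    from this[OF eq b dle[OF midn]] show ?thesis by (simp add: q_def)
  qed
  have cau: "\<exists>N. \<forall>m\<ge>N. \<forall>n\<ge>N. E (\<lambda>x. z m x - z n x) \<le> ennreal \<epsilon>" if \<epsilon>: "\<epsilon> > 0" for \<epsilon>
  proof -
    obtain N1 where N1: "\<forall>m\<ge>N1. \<forall>n\<ge>N1. norm (d m - d n) < \<epsilon> / 4"
      using CauchyD[OF dC, of "\<epsilon> / 4"] \<epsilon> by auto
    obtain N2 :: nat where N2: "8 / \<epsilon> < real N2" using reals_Archimedean2 by blast
    have small: "4 / real (Suc n) \<le> \<epsilon> / 2" if "n \<ge> N2" for n
    proof -
      have "8 / \<epsilon> < real (Suc n)" using N2 that by linarith
      then show ?thesis using \<epsilon> by (simp add: field_simps)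
    qed
    have le: "E (\<lambda>x. z n x - z m x) \<le> ennreal \<epsilon>" if "n \<ge> max N1 N2" "n \<le> m" for n m
    proof -
      have "e (\<lambda>x. z n x - z m x) \<le> 2 * (d m - d n) + 4 / real (Suc n)" using that(2) by (rule diff)
      also have "\<dots> \<le> 2 * (\<epsilon> / 4) + \<epsilon> / 2"
      proof (intro add_mono mult_left_mono)
        have "\<bar>d m - d n\<bar> < \<epsilon> / 4" using N1[rule_format, of m n] that by simp
        then show "d m - d n \<le> \<epsilon> / 4" by linarith
        show "4 / real (Suc n) \<le> \<epsilon> / 2" using that by (intro small) simp
      qed simp
      finally have "e (\<lambda>x. z n x - z m x) \<le> \<epsilon>" by simp
      then show ?thesis unfolding Ee[OF test_functions_diff[OF zt zt]] by (rule ennreal_leI)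
    qed
    show ?thesis
    proof (intro exI[of _ "max N1 N2"] allI impI)
      fix m n assume mn: "m \<ge> max N1 N2" "n \<ge> max N1 N2"
      show "E (\<lambda>x. z m x - z n x) \<le> ennreal \<epsilon>"
      proof (cases "n \<le> m")
        case True
        have "E (\<lambda>x. z m x - z n x) = E (\<lambda>x. z n x - z m x)" by (rule E_minus_commute) measurable
        then show ?thesis using le[OF mn(2) True] by simp
      next
        case False
        then show ?thesis using le[OF mn(1), of n] by simp
      qed
    qed
  qed
  have "AE x in lborel. (\<lambda>n. z n x) \<longlonglongrightarrow> w x"
    using lim
  proof eventually_elim
    case (elim x)
    show ?case
    proof (rule LIMSEQ_I)
      fix r :: real assume r: "r > 0"
      obtain N where N: "\<And>k. k \<ge> N \<Longrightarrow> norm (v k x - w x) < r / 2"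
        using LIMSEQ_D[OF elim, of "r / 2"] r by auto
      have "norm (z n x - w x) < r" if n: "n \<ge> N" for n
      proof -
        have "\<bar>z n x - w x\<bar> \<le> r / 2"
        proof (rule tail_hull_close[OF z(1)[of n]])
          fix k assume "k \<ge> n"
          then have "norm (v k x - w x) < r / 2" using n by (intro N) linarith
          then show "\<bar>v k x - w x\<bar> \<le> r / 2" by simp
        qed
        then show ?thesis using r by simp
      qed
      then show "\<exists>N. \<forall>n\<ge>N. norm (z n x - w x) < r" by blast
    qed
  qed
  then show ?thesis
    by (intro exI[of _ z] conjI allI impI zt cau)
qed

end

section \<open>Existence of a minimiser\<close>

context levy_critical
begin

definition Lpp :: "('a \<Rightarrow> real) \<Rightarrow> ennreal" where
  "Lpp u = (\<integral>\<^sup>+x. ennreal (\<bar>u x\<bar> powr p) \<partial>lborel)"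

lemma Lp_norm_eq: "u \<in> borel_measurable borel \<Longrightarrow> Lp_norm p u = enn2real (Lpp u) powr (1 / p)"
  unfolding Lp_norm_def Lpp_def by (subst integral_eq_nn_integral) auto

lemma Lp_functions_iff: "u \<in> Lp_functions p \<longleftrightarrow> u \<in> borel_measurable borel \<and> Lpp u < \<infinity>"
  unfolding Lp_functions_def Lpp_def integrable_iff_bounded by auto

lemma Lpp_cmult:
  assumes [measurable]: "u \<in> borel_measurable borel"
  shows "Lpp (\<lambda>x. c * u x) = ennreal (\<bar>c\<bar> powr p) * Lpp u"
  unfolding Lpp_def by (subst nn_integral_cmult[symmetric]) (auto simp: abs_mult powr_mult ennreal_mult)

lemma Lpp_test_finite: "f \<in> test_functions \<Longrightarrow> Lpp f < \<infinity>"
proof -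
  assume f: "f \<in> test_functions"
  obtain R where R: "R > 0" "\<And>x. norm x \<ge> R \<Longrightarrow> f x = 0" using test_functions_support[OF f] by metis
  have "integrable lborel (\<lambda>x. \<bar>f x\<bar> powr p)"
  proof (rule integrable_compact_support[where R=R])
    show "continuous_on UNIV (\<lambda>x. \<bar>f x\<bar> powr p)"
      using test_functions_continuous[OF f] p_gt_2 by (intro continuous_on_powr' continuous_on_rabs continuous_on_const) auto
  qed (use R in auto)
  then show ?thesis unfolding Lpp_def integrable_iff_bounded by simp
qed

lemma Lpp_liminf:
  assumes [measurable]: "\<And>n. u n \<in> borel_measurable borel" "v \<in> borel_measurable borel"
    and lim: "AE x in lborel. (\<lambda>n::nat. u n x) \<longlonglongrightarrow> v x"
    and le: "\<forall>\<^sub>F n in sequentially. Lpp (u n) \<le> ennreal e"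
  shows "Lpp v \<le> ennreal e"
proof -
  have "Lpp v = (\<integral>\<^sup>+x. liminf (\<lambda>n. ennreal (\<bar>u n x\<bar> powr p)) \<partial>lborel)"
    unfolding Lpp_def
  proof (rule nn_integral_cong_AE)
    show "AE x in lborel. ennreal (\<bar>v x\<bar> powr p) = liminf (\<lambda>n. ennreal (\<bar>u n x\<bar> powr p))"
      using lim
    proof eventually_elim
      case (elim x)
      have "(\<lambda>n. ennreal (\<bar>u n x\<bar> powr p)) \<longlonglongrightarrow> ennreal (\<bar>v x\<bar> powr p)"
        using p_gt_2 by (intro tendsto_ennrealI tendsto_powr' tendsto_rabs tendsto_const elim) auto
      from lim_imp_Liminf[OF sequentially_bot this] show ?case by simp
    qed
  qed
  also have "\<dots> \<le> liminf (\<lambda>n. Lpp (u n))"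
    unfolding Lpp_def by (rule nn_integral_liminf) measurable
  also have "\<dots> \<le> ennreal e" by (rule Liminf_le) (use le in auto)
  finally show ?thesis .
qed

text \<open>Infimum over test functions only; it agrees with the infimum over the homogeneous space, where the Sobolev inequality
  \<open>sob\<close> with this constant extends by density.\<close>

definition S\<^sub>0 :: real where
  "S\<^sub>0 = Inf {enn2real (E \<phi>) |\<phi>. \<phi> \<in> test_functions \<and> Lpp \<phi> = 1}"

lemma normalize_test:
  assumes f: "f \<in> test_functions" and A: "Lpp f = ennreal A" "A > 0"
  shows "(\<lambda>x. A powr (- 1 / p) * f x) \<in> test_functions" "Lpp (\<lambda>x. A powr (- 1 / p) * f x) = 1"
    "E (\<lambda>x. A powr (- 1 / p) * f x) = ennreal (A powr (- 2 / p)) * E f"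
proof -
  have [measurable]: "f \<in> borel_measurable borel" using f by (rule test_functions_borel)
  show "(\<lambda>x. A powr (- 1 / p) * f x) \<in> test_functions" by (rule test_functions_cmult[OF f])
  have "\<bar>A powr (- 1 / p)\<bar> powr p = A powr (- 1)" using p_gt_2 by (simp add: powr_powr)
  then have "Lpp (\<lambda>x. A powr (- 1 / p) * f x) = ennreal (A powr (- 1)) * ennreal A"
    by (simp only: Lpp_cmult[OF test_functions_borel[OF f]] A(1))
  also have "\<dots> = ennreal (A powr (- 1) * A)" using A(2) by (intro ennreal_mult[symmetric]) auto
  also have "A powr (- 1) * A = 1" using A(2) by (simp add: powr_minus)
  finally show "Lpp (\<lambda>x. A powr (- 1 / p) * f x) = 1" by simp
  have "(A powr (- 1 / p))\<^sup>2 = A powr (- 2 / p)" by (simp add: power2_eq_square powr_add[symmetric])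
  then show "E (\<lambda>x. A powr (- 1 / p) * f x) = ennreal (A powr (- 2 / p)) * E f" by (subst E_cmult) auto
qed

text \<open>Makes the set under the infimum nonempty. A continuous function with f 0 nonzero is
  bounded away from 0 on a ball, so its p-th power integral is positive and can be
  normalised.\<close>

lemma ex_normalized_test: "\<exists>\<phi>. \<phi> \<in> test_functions \<and> Lpp \<phi> = 1"
proof -
  obtain f :: "'a \<Rightarrow> real" where f: "f \<in> test_functions" "f 0 \<noteq> 0" by (rule ex_test_function) (rule that)
  have "isCont f 0" using test_functions_continuous[OF f(1)] by (simp add: continuous_on_eq_continuous_at)
  then obtain d where d: "d > 0" "\<And>x. norm x < d \<Longrightarrow> \<bar>f x - f 0\<bar> < \<bar>f 0\<bar> / 2"
  proof -
    have "0 < \<bar>f 0\<bar> / 2" using f(2) by simp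
    then have "\<exists>d>0. \<forall>x. x \<noteq> 0 \<and> norm (x - 0) < d \<longrightarrow> norm (f x - f 0) < \<bar>f 0\<bar> / 2"
      using \<open>isCont f 0\<close> unfolding isCont_def LIM_eq by blast
    then obtain d where d: "d > 0" "\<forall>x. x \<noteq> 0 \<and> norm x < d \<longrightarrow> \<bar>f x - f 0\<bar> < \<bar>f 0\<bar> / 2" by auto
    show ?thesis
    proof (rule that[OF d(1)])
      fix x :: 'a assume "norm x < d"
      then show "\<bar>f x - f 0\<bar> < \<bar>f 0\<bar> / 2" using d(2) f(2) by (cases "x = 0") auto
    qed
  qed
  have "(0::ennreal) < ennreal ((\<bar>f 0\<bar> / 2) powr p) * ennreal (unit_ball_vol (real DIM('a)) * d ^ DIM('a))"
    using d f(2) by (simp add: ennreal_zero_less_mult_iff)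
  also have "\<dots> = ennreal ((\<bar>f 0\<bar> / 2) powr p) * emeasure lborel (ball (0::'a) d)"
    using d by (subst emeasure_ball) auto
  also have "\<dots> = (\<integral>\<^sup>+x. ennreal ((\<bar>f 0\<bar> / 2) powr p) * indicator (ball (0::'a) d) x \<partial>lborel)"
    by (subst nn_integral_cmult_indicator) auto
  also have "\<dots> \<le> Lpp f"
    unfolding Lpp_def
  proof (rule nn_integral_mono)
    fix x :: 'a
    show "ennreal ((\<bar>f 0\<bar> / 2) powr p) * indicator (ball 0 d) x \<le> ennreal (\<bar>f x\<bar> powr p)"
    proof (cases "norm x < d")
      case True
      then have "\<bar>f 0\<bar> / 2 \<le> \<bar>f x\<bar>" using d(2)[OF True] by linarith
      then have "(\<bar>f 0\<bar> / 2) powr p \<le> \<bar>f x\<bar> powr p" using p_gt_2 by (intro powr_mono2) auto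
      then show ?thesis using True by (simp add: ennreal_leI)
    qed simp
  qed
  finally have pos: "Lpp f > 0" .
  define A where "A = enn2real (Lpp f)"
  have "Lpp f = ennreal A" "A > 0" using pos Lpp_test_finite[OF f(1)] by (auto simp: A_def enn2real_positive_iff)
  from normalize_test[OF f(1) this] show ?thesis by blast
qed

lemma S0_le:
  assumes "\<phi> \<in> test_functions" "Lpp \<phi> = 1"
  shows "S\<^sub>0 \<le> enn2real (E \<phi>)"
  unfolding S\<^sub>0_def using assms by (intro cInf_lower bdd_belowI[of _ 0]) auto

lemma S0_approx:
  assumes "\<epsilon> > 0"
  obtains \<phi> where "\<phi> \<in> test_functions" "Lpp \<phi> = 1" "enn2real (E \<phi>) < S\<^sub>0 + \<epsilon>"
proof -
  have "Inf {enn2real (E \<phi>) |\<phi>. \<phi> \<in> test_functions \<and> Lpp \<phi> = 1} < S\<^sub>0 + \<epsilon>" using assms by (simp add: S\<^sub>0_def)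
  moreover have "{enn2real (E \<phi>) |\<phi>. \<phi> \<in> test_functions \<and> Lpp \<phi> = 1} \<noteq> {}" using ex_normalized_test by blast
  ultimately obtain y where "y \<in> {enn2real (E \<phi>) |\<phi>. \<phi> \<in> test_functions \<and> Lpp \<phi> = 1}" and y: "y < S\<^sub>0 + \<epsilon>"
    using cInf_lessD[of "{enn2real (E \<phi>) |\<phi>. \<phi> \<in> test_functions \<and> Lpp \<phi> = 1}" "S\<^sub>0 + \<epsilon>"] by auto
  then obtain \<phi> where "\<phi> \<in> test_functions" "Lpp \<phi> = 1" "y = enn2real (E \<phi>)" by blast
  then show ?thesis using that[of \<phi>] y by simp
qed

lemma S0_pos: "S\<^sub>0 > 0"
proof -
  obtain C :: real where C: "C > 0"
    "\<forall>u A. u \<in> borel_measurable borel \<longrightarrow> A \<ge> 0 \<longrightarrow> (\<integral>\<^sup>+x. ennreal (\<bar>u x\<bar> powr p) \<partial>lborel) = ennreal A \<longrightarrow> ennreal (A powr (2 / p)) \<le> ennreal C * E u"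
  proof (rule sobolev)
    fix C :: real assume c: "C > 0" and h: "\<And>u A. u \<in> borel_measurable borel \<Longrightarrow> A \<ge> 0 \<Longrightarrow> (\<integral>\<^sup>+x. ennreal (\<bar>u x\<bar> powr p) \<partial>lborel) = ennreal A \<Longrightarrow> ennreal (A powr (2 / p)) \<le> ennreal C * E u"
    show ?thesis by (rule that[OF c]) (intro allI impI h)
  qed
  have "1 / C \<le> S\<^sub>0"
    unfolding S\<^sub>0_def
  proof (rule cInf_greatest)
    show "{enn2real (E \<phi>) |\<phi>. \<phi> \<in> test_functions \<and> Lpp \<phi> = 1} \<noteq> {}" using ex_normalized_test by blast
    fix y assume "y \<in> {enn2real (E \<phi>) |\<phi>. \<phi> \<in> test_functions \<and> Lpp \<phi> = 1}"
    then obtain \<phi> where \<phi>: "\<phi> \<in> test_functions" "Lpp \<phi> = 1" "y = enn2real (E \<phi>)" by blast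
    have "ennreal (1 powr (2 / p)) \<le> ennreal C * E \<phi>"
      using C(2)[rule_format, of \<phi> 1] \<phi>(2) test_functions_borel[OF \<phi>(1)] by (simp add: Lpp_def)
    moreover have "E \<phi> = ennreal y" "y \<ge> 0" using E_test_finite[OF \<phi>(1)] by (auto simp: \<phi>(3))
    ultimately have "ennreal 1 \<le> ennreal (C * y)" using C(1) by (simp add: ennreal_mult)
    then have "1 \<le> C * y" using C(1) \<open>y \<ge> 0\<close> by (subst (asm) ennreal_le_iff) auto
    then show "1 / C \<le> y" using C(1) by (simp add: field_simps)
  qed
  then show ?thesis using C(1) by (meson divide_pos_pos less_le_trans zero_less_one)
qed

text \<open>Phrased through real upper bounds e of the energy: for infinite energy it is vacuous,
  and in \<open>sob_closed\<close> the bound can be relaxed and then tightened in the limit.\<close>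

definition sob :: "('a \<Rightarrow> real) \<Rightarrow> bool" where
  "sob u \<longleftrightarrow> (\<forall>e\<ge>0. E u \<le> ennreal e \<longrightarrow> Lpp u \<le> ennreal ((e / S\<^sub>0) powr (p / 2)))"

lemma sob_test:
  assumes f: "f \<in> test_functions"
  shows "sob f"
  unfolding sob_def
proof (intro allI impI)
  fix e :: real assume e: "0 \<le> e" "E f \<le> ennreal e"
  define A where "A = enn2real (Lpp f)"
  have A: "Lpp f = ennreal A" "A \<ge> 0" using Lpp_test_finite[OF f] by (auto simp: A_def)
  show "Lpp f \<le> ennreal ((e / S\<^sub>0) powr (p / 2))"
  proof (cases "A = 0")
    case False
    then have Ap: "A > 0" using A by simp
    note n = normalize_test[OF f A(1) Ap]
    have "E (\<lambda>x. A powr (- 1 / p) * f x) \<le> ennreal (A powr (- 2 / p)) * ennreal e"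
      unfolding n(3) by (intro mult_left_mono e(2)) auto
    also have "\<dots> = ennreal (A powr (- 2 / p) * e)" using e(1) by (simp add: ennreal_mult)
    finally have "enn2real (E (\<lambda>x. A powr (- 1 / p) * f x)) \<le> A powr (- 2 / p) * e"
      using e(1) by (intro enn2real_leI) auto
    then have "S\<^sub>0 \<le> A powr (- 2 / p) * e" using S0_le[OF n(1,2)] by linarith
    then have "A powr (2 / p) * S\<^sub>0 \<le> A powr (2 / p) * (A powr (- 2 / p) * e)" by (intro mult_left_mono) auto
    also have "\<dots> = e" using Ap by (simp add: mult.assoc[symmetric] powr_add[symmetric])
    finally have "A powr (2 / p) \<le> e / S\<^sub>0" using S0_pos by (simp add: field_simps)
    then have "(A powr (2 / p)) powr (p / 2) \<le> (e / S\<^sub>0) powr (p / 2)" using p_gt_2 by (intro powr_mono2) auto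
    then have "A \<le> (e / S\<^sub>0) powr (p / 2)" using p_gt_2 Ap by (simp add: powr_powr)
    then show ?thesis unfolding A by (rule ennreal_leI)
  qed (simp add: A)
qed

text \<open>\<open>E_young\<close> bounds the energy of \<open>u n\<close> by (1+\<eta>) e + \<eta>
  for large n, Fatou carries the resulting inequality to v, and \<eta> = 1/(k+1) removes the
  loss.\<close>

lemma sob_closed:
  assumes [measurable]: "\<And>n. u n \<in> borel_measurable borel" "v \<in> borel_measurable borel"
    and sob: "\<And>n. sob (u n)" and lim: "AE x in lborel. (\<lambda>n::nat. u n x) \<longlonglongrightarrow> v x"
    and conv: "(\<lambda>n. E (\<lambda>x. u n x - v x)) \<longlonglongrightarrow> 0"
  shows "sob v"
  unfolding sob_def
proof (intro allI impI)
  fix e :: real assume e: "0 \<le> e" "E v \<le> ennreal e"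
  have le: "Lpp v \<le> ennreal ((((1 + \<eta>) * e + \<eta>) / S\<^sub>0) powr (p / 2))" if \<eta>: "\<eta> > 0" for \<eta>
  proof (rule Lpp_liminf[OF assms(1,2) lim])
    have "(\<lambda>n. ennreal (1 + 1 / \<eta>) * E (\<lambda>x. u n x - v x)) \<longlonglongrightarrow> ennreal (1 + 1 / \<eta>) * 0"
      using conv by (intro ennreal_tendsto_cmult) auto
    then have "\<forall>\<^sub>F n in sequentially. ennreal (1 + 1 / \<eta>) * E (\<lambda>x. u n x - v x) < ennreal \<eta>"
      using \<eta> by (intro order_tendstoD) auto
    then show "\<forall>\<^sub>F n in sequentially. Lpp (u n) \<le> ennreal ((((1 + \<eta>) * e + \<eta>) / S\<^sub>0) powr (p / 2))"
    proof eventually_elim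
      case (elim n)
      have "E (u n) \<le> ennreal (1 + \<eta>) * E v + ennreal (1 + 1 / \<eta>) * E (\<lambda>x. u n x - v x)"
        using \<eta> by (intro E_young) auto
      also have "\<dots> \<le> ennreal (1 + \<eta>) * ennreal e + ennreal \<eta>"
        using elim e by (intro add_mono mult_left_mono) auto
      also have "\<dots> = ennreal ((1 + \<eta>) * e + \<eta>)"
        using \<eta> e by (simp add: ennreal_mult[symmetric] ennreal_plus[symmetric] del: ennreal_plus)
      finally show ?case using sob[of n] \<eta> e unfolding sob_def by (auto simp del: ennreal_plus)
    qed
  qed
  have "(\<lambda>k. ennreal ((((1 + 1 / real (Suc k)) * e + 1 / real (Suc k)) / S\<^sub>0) powr (p / 2))) \<longlonglongrightarrow> ennreal ((((1 + 0) * e + 0) / S\<^sub>0) powr (p / 2))"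
  proof (intro tendsto_ennrealI tendsto_powr' tendsto_divide tendsto_add tendsto_mult tendsto_const)
    show "(\<lambda>k. 1 / real (Suc k)) \<longlonglongrightarrow> 0" by (rule LIMSEQ_Suc[OF lim_1_over_n])
    then show "(\<lambda>k. 1 / real (Suc k)) \<longlonglongrightarrow> 0" .
  qed (use S0_pos p_gt_2 e in \<open>auto intro!: always_eventually divide_nonneg_pos add_nonneg_nonneg mult_nonneg_nonneg\<close>)
  then have "(\<lambda>k. ennreal ((((1 + 1 / real (Suc k)) * e + 1 / real (Suc k)) / S\<^sub>0) powr (p / 2))) \<longlonglongrightarrow> ennreal ((e / S\<^sub>0) powr (p / 2))"
    by simp
  then show "Lpp v \<le> ennreal ((e / S\<^sub>0) powr (p / 2))"
    by (rule tendsto_lowerbound) (auto intro!: always_eventually le simp del: of_nat_Suc)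
qed

end

section \<open>The homogeneous space and the limit of a minimising sequence\<close>

context levy_critical
begin

lemma hdot_equiv_ex:
  "\<exists>c C. c > 0 \<and> C > 0 \<and> (\<forall>f\<in>test_functions. c * (hdot_norm \<alpha> f)\<^sup>2 \<le> enn2real (E f) \<and> enn2real (E f) \<le> C * (hdot_norm \<alpha> f)\<^sup>2)"
proof (rule hdot_norm_equiv)
  fix c C :: real assume a: "c > 0" "C > 0"
    "\<And>f. f \<in> test_functions \<Longrightarrow> c * (hdot_norm \<alpha> f)\<^sup>2 \<le> enn2real (E f)"
    "\<And>f. f \<in> test_functions \<Longrightarrow> enn2real (E f) \<le> C * (hdot_norm \<alpha> f)\<^sup>2"
  show ?thesis by (intro exI[of _ c] exI[of _ C] conjI ballI a)
qed

lemma hdot_norm_nonneg: "hdot_norm \<alpha> f \<ge> 0"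
  by (simp add: hdot_norm_def)

lemma Lpp_diff_finite:
  assumes [measurable]: "u \<in> borel_measurable borel" "v \<in> borel_measurable borel" and "Lpp u < \<infinity>" "Lpp v < \<infinity>"
  shows "Lpp (\<lambda>x. u x - v x) < \<infinity>"
proof -
  have "Lpp (\<lambda>x. u x - v x) \<le> (\<integral>\<^sup>+x. ennreal (2 powr (p - 1)) * (ennreal (\<bar>u x\<bar> powr p) + ennreal (\<bar>v x\<bar> powr p)) \<partial>lborel)"
    unfolding Lpp_def
  proof (rule nn_integral_mono)
    fix x
    have "\<bar>u x - v x\<bar> powr p \<le> 2 powr (p - 1) * (\<bar>u x\<bar> powr p + \<bar>v x\<bar> powr p)"
      using powr_add_le2[of p "u x" "- v x"] p_gt_2 by simp
    from ennreal_leI[OF this]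
    show "ennreal (\<bar>u x - v x\<bar> powr p) \<le> ennreal (2 powr (p - 1)) * (ennreal (\<bar>u x\<bar> powr p) + ennreal (\<bar>v x\<bar> powr p))"
      by (simp add: ennreal_mult ennreal_plus)
  qed
  also have "\<dots> = ennreal (2 powr (p - 1)) * (Lpp u + Lpp v)"
    unfolding Lpp_def by (subst nn_integral_cmult) (auto simp: nn_integral_add)
  also have "\<dots> < \<infinity>" using assms(3,4) by (simp add: ennreal_mult_less_top)
  finally show ?thesis .
qed

lemma Lp_integrable:
  assumes [measurable]: "u \<in> borel_measurable borel" and "Lpp u < \<infinity>"
  shows "integrable lborel (\<lambda>x. \<bar>u x\<bar> powr p)" "(LINT x|lborel. \<bar>u x\<bar> powr p) = enn2real (Lpp u)"
proof -
  show "integrable lborel (\<lambda>x. \<bar>u x\<bar> powr p)" using assms(2) unfolding Lpp_def by (intro integrableI_bounded) auto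
  show "(LINT x|lborel. \<bar>u x\<bar> powr p) = enn2real (Lpp u)"
    unfolding Lpp_def by (subst integral_eq_nn_integral) auto
qed

text \<open>The test functions that define membership are Cauchy in energy by the Plancherel
  comparison, and p-norm convergence gives a subsequence converging almost everywhere.
  \<open>E_cauchy_limit\<close> makes u their limit in energy, and \<open>sob_closed\<close>
  applies.\<close>

lemma sob_hdot:
  assumes u: "u \<in> hdot_space \<alpha>"
  shows "sob u"
proof -
  obtain \<phi> :: "nat \<Rightarrow> 'a \<Rightarrow> real" where \<phi>: "\<forall>n. \<phi> n \<in> test_functions"
    "\<forall>\<epsilon>>0. \<exists>M. \<forall>m\<ge>M. \<forall>n\<ge>M. hdot_norm \<alpha> (\<lambda>x. \<phi> m x - \<phi> n x) < \<epsilon>"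
    "(\<lambda>n. Lp_norm p (\<lambda>x. \<phi> n x - u x)) \<longlonglongrightarrow> 0" and uLp: "u \<in> Lp_functions p"
    using u unfolding hdot_space_def p_def[symmetric] by blast
  have [measurable]: "\<phi> n \<in> borel_measurable borel" for n using \<phi>(1) by (intro test_functions_borel) simp
  have um[measurable]: "u \<in> borel_measurable borel" and uf: "Lpp u < \<infinity>" using uLp unfolding Lp_functions_iff by auto
  obtain c C where cC: "c > 0" "C > 0" "\<forall>f\<in>test_functions. c * (hdot_norm \<alpha> f)\<^sup>2 \<le> enn2real (E f) \<and> enn2real (E f) \<le> C * (hdot_norm \<alpha> f)\<^sup>2"
    using hdot_equiv_ex by blast
  have cau: "\<exists>N. \<forall>m\<ge>N. \<forall>n\<ge>N. E (\<lambda>x. \<phi> m x - \<phi> n x) \<le> ennreal \<epsilon>" if \<epsilon>: "\<epsilon> > 0" for \<epsilon>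
  proof -
    have "sqrt (\<epsilon> / C) > 0" using \<epsilon> cC by simp
    with \<phi>(2) obtain N where N: "\<forall>m\<ge>N. \<forall>n\<ge>N. hdot_norm \<alpha> (\<lambda>x. \<phi> m x - \<phi> n x) < sqrt (\<epsilon> / C)" by blast
    have "E (\<lambda>x. \<phi> m x - \<phi> n x) \<le> ennreal \<epsilon>" if "m \<ge> N" "n \<ge> N" for m n
    proof -
      let ?f = "\<lambda>x. \<phi> m x - \<phi> n x"
      have t: "?f \<in> test_functions" using \<phi>(1) by (intro test_functions_diff) auto
      have "hdot_norm \<alpha> ?f < sqrt (\<epsilon> / C)" using N that by blast
      then have "(hdot_norm \<alpha> ?f)\<^sup>2 \<le> (sqrt (\<epsilon> / C))\<^sup>2" using hdot_norm_nonneg by (intro power_mono) auto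
      then have "(hdot_norm \<alpha> ?f)\<^sup>2 \<le> \<epsilon> / C" using \<epsilon> cC by simp
      then have "C * (hdot_norm \<alpha> ?f)\<^sup>2 \<le> \<epsilon>" using cC by (simp add: field_simps)
      moreover have "enn2real (E ?f) \<le> C * (hdot_norm \<alpha> ?f)\<^sup>2" using cC(3) t by blast
      ultimately have "enn2real (E ?f) \<le> \<epsilon>" by (rule order_trans[rotated])
      then have "ennreal (enn2real (E ?f)) \<le> ennreal \<epsilon>" by (rule ennreal_leI)
      then show ?thesis using E_test_finite[OF t] by simp
    qed
    then show ?thesis by blast
  qed
  have "(\<lambda>n. (Lp_norm p (\<lambda>x. \<phi> n x - u x)) powr p) \<longlonglongrightarrow> 0 powr p"
    using \<phi>(3) p_gt_2 by (intro tendsto_powr' tendsto_const) (auto simp: Lp_norm_def)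
  moreover have fin: "Lpp (\<lambda>x. \<phi> n x - u x) < \<infinity>" for n
    by (rule Lpp_diff_finite[OF _ um Lpp_test_finite[OF \<phi>(1)[rule_format]] uf]) measurable
  moreover have "(Lp_norm p (\<lambda>x. \<phi> n x - u x)) powr p = (LINT x|lborel. \<bar>\<phi> n x - u x\<bar> powr p)" for n
    using p_gt_2 Lp_integrable(2)[OF _ fin[of n]] by (simp add: Lp_norm_eq powr_powr)
  ultimately have L1: "(\<lambda>n. LINT x|lborel. \<bar>\<phi> n x - u x\<bar> powr p) \<longlonglongrightarrow> 0" using p_gt_2 by simp
  have "\<exists>r::nat \<Rightarrow> nat. strict_mono r \<and> (AE x in lborel. (\<lambda>n. \<bar>\<phi> (r n) x - u x\<bar> powr p) \<longlonglongrightarrow> 0)"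
  proof (rule tendsto_L1_AE_subseq)
    show "integrable lborel (\<lambda>x. \<bar>\<phi> n x - u x\<bar> powr p)" for n by (rule Lp_integrable(1)[OF _ fin]) measurable
    show "(\<lambda>n. LINT x|lborel. norm (\<bar>\<phi> n x - u x\<bar> powr p)) \<longlonglongrightarrow> 0" using L1 by simp
  qed
  then obtain r where r: "strict_mono (r::nat \<Rightarrow> nat)" "AE x in lborel. (\<lambda>n. \<bar>\<phi> (r n) x - u x\<bar> powr p) \<longlonglongrightarrow> 0"
    by blast
  have ae: "AE x in lborel. (\<lambda>n. \<phi> (r n) x) \<longlonglongrightarrow> u x"
    using r(2)
  proof eventually_elim
    case (elim x)
    have "(\<lambda>n. (\<bar>\<phi> (r n) x - u x\<bar> powr p) powr (1 / p)) \<longlonglongrightarrow> 0 powr (1 / p)"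
      using elim p_gt_2 by (intro tendsto_powr' tendsto_const) auto
    then have "(\<lambda>n. \<bar>\<phi> (r n) x - u x\<bar>) \<longlonglongrightarrow> 0" using p_gt_2 by (simp add: powr_powr)
    then show ?case by (simp add: tendsto_rabs_zero_iff LIM_zero_iff)
  qed
  show ?thesis
  proof (rule sob_closed[where u="\<lambda>n. \<phi> (r n)"])
    show "sob (\<phi> (r n))" for n using \<phi>(1) by (intro sob_test) simp
    show "(\<lambda>n. E (\<lambda>x. \<phi> (r n) x - u x)) \<longlonglongrightarrow> 0"
    proof (rule E_cauchy_limit)
      fix \<epsilon> :: real assume "\<epsilon> > 0"
      from cau[OF this] obtain N where N: "\<forall>m\<ge>N. \<forall>n\<ge>N. E (\<lambda>x. \<phi> m x - \<phi> n x) \<le> ennreal \<epsilon>" by blast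
      show "\<exists>N. \<forall>m\<ge>N. \<forall>n\<ge>N. E (\<lambda>x. \<phi> (r m) x - \<phi> (r n) x) \<le> ennreal \<epsilon>"
        using N seq_suble[OF r(1)] by (intro exI[of _ N]) (meson order_trans)
    qed (use ae in auto)
  qed (use ae in auto)
qed

text \<open>\<open>rescale\<close> changes neither the energy nor the p-norm, but carries a cell at
  (x, t) with L^2 quantity above m t^(-\<beta>) to one fixed ball, where the bound becomes
  m.\<close>

lemma ex_concentrated_sequence:
  "\<exists>w m R K. (\<forall>n. w n \<in> test_functions \<and> Lpp (w n) = 1 \<and> E (w n) \<le> ennreal K \<and> enn2real (E (w n)) < S\<^sub>0 + 1 / real (Suc n)
     \<and> ennreal m \<le> (\<integral>\<^sup>+y. indicator (cball 0 R) y * ennreal ((w n y)\<^sup>2) \<partial>lborel)) \<and> m > 0 \<and> R > 0 \<and> K > 0"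
proof -
  define K where "K = S\<^sub>0 + 1"
  have K: "K > 0" using S0_pos by (simp add: K_def)
  have "\<exists>\<phi>. \<phi> \<in> test_functions \<and> Lpp \<phi> = 1 \<and> enn2real (E \<phi>) < S\<^sub>0 + 1 / real (Suc n)" for n
  proof (rule S0_approx[of "1 / real (Suc n)"])
    fix \<phi> assume "\<phi> \<in> test_functions" "Lpp \<phi> = 1" "enn2real (E \<phi>) < S\<^sub>0 + 1 / real (Suc n)"
    then show ?thesis by blast
  qed simp
  then obtain \<phi> where \<phi>: "\<And>n. \<phi> n \<in> test_functions" "\<And>n. Lpp (\<phi> n) = 1" "\<And>n. enn2real (E (\<phi> n)) < S\<^sub>0 + 1 / real (Suc n)"
    by metis
  have EK: "E (\<phi> n) \<le> ennreal K" for n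
  proof -
    have "1 / real (Suc n) \<le> 1" by simp
    then have "enn2real (E (\<phi> n)) \<le> K" using \<phi>(3)[of n] unfolding K_def by linarith
    then have "ennreal (enn2real (E (\<phi> n))) \<le> ennreal K" by (rule ennreal_leI)
    then show ?thesis using E_test_finite[OF \<phi>(1)] by simp
  qed
  show ?thesis
  proof (rule nonvanishing[OF K])
    fix m R :: real assume mR: "m > 0" "R > 0" and nv: "\<And>u. u \<in> borel_measurable borel \<Longrightarrow> (\<integral>\<^sup>+x. ennreal (\<bar>u x\<bar> powr p) \<partial>lborel) = 1 \<Longrightarrow> E u \<le> ennreal K \<Longrightarrow>
      \<exists>x t. t > 0 \<and> ennreal (m * t powr (- \<beta>)) < (\<integral>\<^sup>+y. indicator (cball 0 R) y * ennreal ((u (x - t *\<^sub>R y))\<^sup>2) \<partial>lborel)"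
    have "\<exists>x t. t > 0 \<and> ennreal (m * t powr (- \<beta>)) < (\<integral>\<^sup>+y. indicator (cball 0 R) y * ennreal ((\<phi> n (x - t *\<^sub>R y))\<^sup>2) \<partial>lborel)" for n
      by (rule nv[OF test_functions_borel[OF \<phi>(1)] \<phi>(2)[unfolded Lpp_def] EK])
    then obtain x t where xt: "\<And>n. t n > 0"
      "\<And>n. ennreal (m * t n powr (- \<beta>)) < (\<integral>\<^sup>+y. indicator (cball 0 R) y * ennreal ((\<phi> n (x n - t n *\<^sub>R y))\<^sup>2) \<partial>lborel)"
      by metis
    define w where "w n = rescale (x n) (t n) (\<phi> n)" for n
    have pm[measurable]: "\<phi> n \<in> borel_measurable borel" for n using \<phi>(1) by (rule test_functions_borel)
    have Ew: "E (w n) = E (\<phi> n)" for n unfolding w_def by (rule rescale_E[OF pm xt(1)])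
    have Lw: "Lpp (w n) = 1" for n unfolding w_def Lpp_def rescale_Lp[OF pm xt(1)] using \<phi>(2) by (simp add: Lpp_def)
    have mass: "ennreal m \<le> (\<integral>\<^sup>+y. indicator (cball 0 R) y * ennreal ((w n y)\<^sup>2) \<partial>lborel)" for n
    proof -
      have tb: "(t n powr (\<beta> / 2))\<^sup>2 = t n powr \<beta>" by (simp add: power2_eq_square powr_add[symmetric])
      have "m = t n powr \<beta> * (m * t n powr (- \<beta>))" using xt(1)[of n] by (simp add: powr_minus field_simps)
      then have "ennreal m = ennreal (t n powr \<beta> * (m * t n powr (- \<beta>)))" by (rule arg_cong)
      also have "\<dots> = ennreal (t n powr \<beta>) * ennreal (m * t n powr (- \<beta>))"
        using mR by (subst ennreal_mult) auto
      also have "\<dots> \<le> ennreal (t n powr \<beta>) * (\<integral>\<^sup>+y. indicator (cball 0 R) y * ennreal ((\<phi> n (x n - t n *\<^sub>R y))\<^sup>2) \<partial>lborel)"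
        using less_imp_le[OF xt(2)[of n]] by (rule mult_left_mono) simp
      also have "\<dots> = (\<integral>\<^sup>+y. ennreal (t n powr \<beta>) * (indicator (cball 0 R) y * ennreal ((\<phi> n (x n - t n *\<^sub>R y))\<^sup>2)) \<partial>lborel)"
        by (rule nn_integral_cmult[symmetric]) measurable
      also have "\<dots> = (\<integral>\<^sup>+y. indicator (cball 0 R) y * ennreal ((w n y)\<^sup>2) \<partial>lborel)"
        by (intro nn_integral_cong) (simp add: w_def rescale_def power_mult_distrib tb ennreal_mult mult.left_commute)
      finally show ?thesis .
    qed
    have wt: "w n \<in> test_functions" for n unfolding w_def by (rule rescale_test[OF \<phi>(1) xt(1)])
    have "E (w n) \<le> ennreal K" "enn2real (E (w n)) < S\<^sub>0 + 1 / real (Suc n)" for n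
      unfolding Ew by (rule EK, rule \<phi>(3))
    then show ?thesis
      by (intro exI[of _ w] exI[of _ m] exI[of _ R] exI[of _ K] conjI allI wt Lw mass mR K)
  qed
qed

text \<open>Excludes a loss of mass: if the weak limit has energy \<open>y\<close> and mass \<open>A\<close>, then by Brezis--Lieb the remainder
  carries energy \<open>S\<^sub>0 - y\<close> and mass \<open>1 - A\<close>.\<close>

lemma missing_mass:
  assumes y: "0 \<le> y" "y \<le> S\<^sub>0" and A: "A > 0" and le: "1 - A \<le> ((S\<^sub>0 - y) / S\<^sub>0) powr (p / 2)"
  shows "y \<le> S\<^sub>0 * A powr (2 / p)"
proof -
  \<comment> \<open>The share of the energy kept by the limit. As p/2 > 1, raising a number in
    [0, 1] to this power does not increase it: the hypothesis gives q \<le> A, and then q^(p/2)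
    \<le> q \<le> A.\<close>
  define q where "q = y / S\<^sub>0"
  have q: "0 \<le> q" "q \<le> 1" using y S0_pos by (auto simp: q_def)
  have "(S\<^sub>0 - y) / S\<^sub>0 = 1 - q" using S0_pos by (simp add: q_def diff_divide_distrib)
  then have "1 - A \<le> (1 - q) powr (p / 2)" using le by simp
  also have "\<dots> \<le> (1 - q) powr 1" using q p_gt_2 by (intro powr_mono') auto
  finally have A1: "1 - A \<le> (1 - q)" using q by simp
  have "q powr (p / 2) \<le> q powr 1" using q p_gt_2 by (intro powr_mono') auto
  then have "q powr (p / 2) \<le> A" using q A1 by simp
  then have "(q powr (p / 2)) powr (2 / p) \<le> A powr (2 / p)" using p_gt_2 by (intro powr_mono2) auto
  then have "q \<le> A powr (2 / p)" using p_gt_2 q by (simp add: powr_powr)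
  then show ?thesis using S0_pos by (simp add: q_def field_simps)
qed

text \<open>An upper bound for the energy at the mass A is enough, as \<open>E_hdot_ge\<close>
  supplies the reverse inequality. The functions w and v n - w arise only as limits, so the Sobolev
  inequality reaches v n - w through convergence in energy.\<close>

theorem ex_minimizer:
  "\<exists>w A. w \<in> hdot_space \<alpha> \<and> A > 0 \<and> Lpp w = ennreal A \<and> E w \<le> ennreal (S\<^sub>0 * A powr (2 / p))"
proof -
  obtain w' m R K where w: "\<forall>n. w' n \<in> test_functions \<and> Lpp (w' n) = 1 \<and> E (w' n) \<le> ennreal K \<and> enn2real (E (w' n)) < S\<^sub>0 + 1 / real (Suc n)
     \<and> ennreal m \<le> (\<integral>\<^sup>+y. indicator (cball 0 R) y * ennreal ((w' n y)\<^sup>2) \<partial>lborel)" and mRK: "m > 0" "R > 0" "K > 0"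
    using ex_concentrated_sequence by (elim exE conjE) (rule that)
  have w': "w' n \<in> test_functions" "Lpp (w' n) = 1" "E (w' n) \<le> ennreal K" "enn2real (E (w' n)) < S\<^sub>0 + 1 / real (Suc n)"
     "ennreal m \<le> (\<integral>\<^sup>+y. indicator (cball 0 R) y * ennreal ((w' n y)\<^sup>2) \<partial>lborel)" for n
    using w[rule_format, of n] by blast+
  have [measurable]: "w' n \<in> borel_measurable borel" for n using w'(1) by (rule test_functions_borel)
  have "\<exists>B. \<forall>x. \<bar>w' n x\<bar> \<le> B" for n by (rule test_functions_bounded[OF w'(1)[of n]]) blast
  then obtain B where B: "\<And>n x. \<bar>w' n x\<bar> \<le> B n" by metis
  have "\<exists>C1>0. \<forall>u h. u \<in> borel_measurable borel \<longrightarrow> trans_sq u h \<le> ennreal (C1 * norm h powr \<alpha>) * E u"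
  proof (rule translation_modulus)
    fix C :: real assume c: "C > 0" and h: "\<And>u h. u \<in> borel_measurable borel \<Longrightarrow> trans_sq u h \<le> ennreal (C * norm h powr \<alpha>) * E u"
    show ?thesis by (intro exI[of _ C] conjI c allI impI h)
  qed
  then obtain C1 where C1: "C1 > 0" "\<And>u h. u \<in> borel_measurable borel \<Longrightarrow> trans_sq u h \<le> ennreal (C1 * norm h powr \<alpha>) * E u" by blast
  have modu: "trans_sq (w' n) h \<le> ennreal (C1 * K * norm h powr \<alpha>)" for n h
  proof -
    have "trans_sq (w' n) h \<le> ennreal (C1 * norm h powr \<alpha>) * E (w' n)" by (rule C1(2)) measurable
    also have "\<dots> \<le> ennreal (C1 * norm h powr \<alpha>) * ennreal K" by (intro mult_left_mono w'(3)) auto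
    also have "\<dots> = ennreal (C1 * K * norm h powr \<alpha>)" using C1 mRK by (simp add: ennreal_mult[symmetric] mult_ac)
    finally show ?thesis .
  qed
  have p1: "p \<ge> 1" using p_gt_2 by simp
  have "\<exists>r g. strict_mono (r::nat \<Rightarrow> nat) \<and> g \<in> borel_measurable borel \<and> (AE x in lborel. (\<lambda>n. w' (r n) x) \<longlonglongrightarrow> g x)
    \<and> (\<lambda>n. \<integral>\<^sup>+x. ennreal (gauss x) * ennreal ((w' (r n) x - g x)\<^sup>2) \<partial>lborel) \<longlonglongrightarrow> 0"
    by (rule rellich[where w=w' and B=B and C="C1 * K" and \<alpha>=\<alpha> and p=p])
       (use w'(2) B modu C1(1) mRK alpha p1 in \<open>auto simp: Lpp_def\<close>)
  then obtain r w where r: "strict_mono (r::nat \<Rightarrow> nat)" and [measurable]: "w \<in> borel_measurable borel"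
    and ae: "AE x in lborel. (\<lambda>n. w' (r n) x) \<longlonglongrightarrow> w x"
    and L2: "(\<lambda>n. \<integral>\<^sup>+x. ennreal (gauss x) * ennreal ((w' (r n) x - w x)\<^sup>2) \<partial>lborel) \<longlonglongrightarrow> 0" by blast
  define v where "v n = w' (r n)" for n
  have vt: "v n \<in> test_functions" for n by (simp add: v_def w'(1))
  have [measurable]: "v n \<in> borel_measurable borel" for n by (simp add: v_def)
  have aev: "AE x in lborel. (\<lambda>n. v n x) \<longlonglongrightarrow> w x" using ae by (simp add: v_def)
  have vK: "E (v n) \<le> ennreal K" for n by (simp add: v_def w'(3))
  have Lw1: "Lpp w \<le> ennreal 1"
    by (rule Lpp_liminf[where u=v]) (use aev in \<open>auto simp: v_def w'(2)\<close>)
  define A where "A = enn2real (Lpp w)"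
  have "Lpp w < \<top>" by (rule le_less_trans[OF Lw1]) simp
  then have A: "Lpp w = ennreal A" "A \<ge> 0" by (simp_all add: A_def)
  \<comment> \<open>If w vanished, the weighted L^2 distance to it would be at least g0 m, where g0
    bounds the Gaussian from below on the ball of radius R that carries the mass m.\<close>
  have "A \<noteq> 0"
  proof
    assume "A = 0"
    then have "AE x in lborel. ennreal (\<bar>w x\<bar> powr p) = 0" using A unfolding Lpp_def by (simp add: nn_integral_0_iff_AE)
    then have w0: "AE x in lborel. w x = 0" by eventually_elim (auto simp: ennreal_eq_0_iff)
    define g0 where "g0 = exp (- R\<^sup>2 / 2)"
    have "ennreal (g0 * m) \<le> (\<integral>\<^sup>+x. ennreal (gauss x) * ennreal ((w' (r n) x - w x)\<^sup>2) \<partial>lborel)" for n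
    proof -
      have "ennreal (g0 * m) = ennreal g0 * ennreal m" using mRK by (intro ennreal_mult) (auto simp: g0_def)
      also have "\<dots> \<le> ennreal g0 * (\<integral>\<^sup>+y. indicator (cball 0 R) y * ennreal ((w' (r n) y)\<^sup>2) \<partial>lborel)"
        by (intro mult_left_mono w'(5)) auto
      also have "\<dots> = (\<integral>\<^sup>+y. ennreal g0 * (indicator (cball 0 R) y * ennreal ((w' (r n) y)\<^sup>2)) \<partial>lborel)"
        by (rule nn_integral_cmult[symmetric]) measurable
      also have "\<dots> \<le> (\<integral>\<^sup>+x. ennreal (gauss x) * ennreal ((w' (r n) x - w x)\<^sup>2) \<partial>lborel)"
      proof (rule nn_integral_mono_AE)
        show "AE y in lborel. ennreal g0 * (indicator (cball 0 R) y * ennreal ((w' (r n) y)\<^sup>2)) \<le> ennreal (gauss y) * ennreal ((w' (r n) y - w y)\<^sup>2)"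
          using w0
        proof eventually_elim
          case (elim y)
          show ?case
          proof (cases "y \<in> cball 0 R")
            case True
            then have "(norm y)\<^sup>2 \<le> R\<^sup>2" by (intro power_mono) auto
            then have "g0 \<le> gauss y" by (simp add: g0_def gauss_def)
            then show ?thesis using elim True by (simp add: mult_right_mono ennreal_leI)
          qed simp
        qed
      qed
      finally show ?thesis .
    qed
    then have "ennreal (g0 * m) \<le> 0" using L2 by (intro tendsto_lowerbound[OF L2]) auto
    then show False using mRK by (simp add: g0_def mult_le_0_iff)
  qed
  then have Ap: "A > 0" using A by simp
  have "\<exists>z. (\<forall>n. z n \<in> test_functions) \<and> (AE x in lborel. (\<lambda>n::nat. z n x) \<longlonglongrightarrow> w x) \<and>
     (\<forall>\<epsilon>>0. \<exists>N. \<forall>m\<ge>N. \<forall>n\<ge>N. E (\<lambda>x. z m x - z n x) \<le> ennreal \<epsilon>)"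
    by (rule mazur_tail[OF vt vK aev])
  then obtain z where z: "\<And>n. z n \<in> test_functions" "AE x in lborel. (\<lambda>n::nat. z n x) \<longlonglongrightarrow> w x"
    and zc: "\<And>\<epsilon>. \<epsilon> > 0 \<Longrightarrow> \<exists>N. \<forall>m\<ge>N. \<forall>n\<ge>N. E (\<lambda>x. z m x - z n x) \<le> ennreal \<epsilon>" by blast
  have [measurable]: "z n \<in> borel_measurable borel" for n using z(1) by (rule test_functions_borel)
  have Ezw: "(\<lambda>n. E (\<lambda>x. z n x - w x)) \<longlonglongrightarrow> 0"
    by (rule E_cauchy_limit[OF _ _ z(2) zc]) measurable
  obtain c C where cC: "c > 0" "C > 0" "\<forall>f\<in>test_functions. c * (hdot_norm \<alpha> f)\<^sup>2 \<le> enn2real (E f) \<and> enn2real (E f) \<le> C * (hdot_norm \<alpha> f)\<^sup>2"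
    using hdot_equiv_ex by blast
  \<comment> \<open>Sobolev for the test functions z n - z m, then Fatou in m. The number
    \<open>e\<close> is chosen so that the power in \<open>sob\<close> returns \<epsilon>.\<close>
  have Lppz: "\<exists>N. \<forall>n\<ge>N. Lpp (\<lambda>x. z n x - w x) \<le> ennreal \<epsilon>" if \<epsilon>: "\<epsilon> > 0" for \<epsilon>
  proof -
    define e where "e = S\<^sub>0 * \<epsilon> powr (2 / p)"
    have e: "e > 0" using S0_pos \<epsilon> by (simp add: e_def)
    have ee: "(e / S\<^sub>0) powr (p / 2) = \<epsilon>" using S0_pos \<epsilon> p_gt_2 by (simp add: e_def powr_powr)
    obtain N where N: "\<forall>m\<ge>N. \<forall>n\<ge>N. E (\<lambda>x. z m x - z n x) \<le> ennreal e" using zc[OF e] by blast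
    have "Lpp (\<lambda>x. z n x - w x) \<le> ennreal \<epsilon>" if n: "n \<ge> N" for n
    proof (rule Lpp_liminf[where u="\<lambda>m x. z n x - z m x"])
      show "AE x in lborel. (\<lambda>m. z n x - z m x) \<longlonglongrightarrow> z n x - w x"
        using z(2) by eventually_elim (intro tendsto_diff tendsto_const)
      have "Lpp (\<lambda>x. z n x - z m x) \<le> ennreal \<epsilon>" if m: "m \<ge> N" for m
      proof -
        have "sob (\<lambda>x. z n x - z m x)" by (rule sob_test[OF test_functions_diff[OF z(1) z(1)]])
        moreover have "E (\<lambda>x. z n x - z m x) \<le> ennreal e" using N n m by blast
        ultimately show ?thesis using e unfolding sob_def ee[symmetric] by simp
      qed
      then show "\<forall>\<^sub>F m in sequentially. Lpp (\<lambda>x. z n x - z m x) \<le> ennreal \<epsilon>"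
        unfolding eventually_sequentially by blast
    qed measurable
    then show ?thesis by blast
  qed
  \<comment> \<open>The witness is z rather than v: only z is known to be Cauchy in energy, and the
    lower comparison constant c turns this into Cauchy for \<open>hdot_norm\<close>.\<close>
  have wX: "w \<in> hdot_space \<alpha>"
    unfolding hdot_space_def p_def[symmetric]
  proof (intro CollectI conjI exI[of _ z] allI impI z(1))
    show "w \<in> Lp_functions p" unfolding Lp_functions_iff A by simp
    fix \<epsilon> :: real assume \<epsilon>: "\<epsilon> > 0"
    obtain N where N: "\<forall>m\<ge>N. \<forall>n\<ge>N. E (\<lambda>x. z m x - z n x) \<le> ennreal (c * (\<epsilon> / 2)\<^sup>2)"
      using zc[of "c * (\<epsilon> / 2)\<^sup>2"] \<epsilon> cC by auto
    show "\<exists>M. \<forall>m\<ge>M. \<forall>n\<ge>M. hdot_norm \<alpha> (\<lambda>x. z m x - z n x) < \<epsilon>"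
    proof (intro exI[of _ N] allI impI)
      fix m n assume mn: "N \<le> m" "N \<le> n"
      let ?f = "\<lambda>x. z m x - z n x"
      have t: "?f \<in> test_functions" by (rule test_functions_diff[OF z(1) z(1)])
      have "E ?f \<le> ennreal (c * (\<epsilon> / 2)\<^sup>2)" using N mn by blast
      then have "enn2real (E ?f) \<le> c * (\<epsilon> / 2)\<^sup>2" by (rule enn2real_leI[rotated]) (use cC in simp)
      moreover have "c * (hdot_norm \<alpha> ?f)\<^sup>2 \<le> enn2real (E ?f)" using cC(3) t by blast
      ultimately have "c * (hdot_norm \<alpha> ?f)\<^sup>2 \<le> c * (\<epsilon> / 2)\<^sup>2" by (rule order_trans[rotated])
      then have "(hdot_norm \<alpha> ?f)\<^sup>2 \<le> (\<epsilon> / 2)\<^sup>2" using cC by simp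
      then have "hdot_norm \<alpha> ?f \<le> \<epsilon> / 2" by (rule power2_le_imp_le) (use \<epsilon> in simp)
      then show "hdot_norm \<alpha> ?f < \<epsilon>" using \<epsilon> by simp
    qed
  next
    show "(\<lambda>n. Lp_norm p (\<lambda>x. z n x - w x)) \<longlonglongrightarrow> 0"
    proof (rule LIMSEQ_I)
      fix \<epsilon> :: real assume \<epsilon>: "\<epsilon> > 0"
      obtain N where N: "\<forall>n\<ge>N. Lpp (\<lambda>x. z n x - w x) \<le> ennreal ((\<epsilon> / 2) powr p)"
        using Lppz[of "(\<epsilon> / 2) powr p"] \<epsilon> by auto
      show "\<exists>N. \<forall>n\<ge>N. norm (Lp_norm p (\<lambda>x. z n x - w x) - 0) < \<epsilon>"
      proof (intro exI[of _ N] allI impI)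
        fix n assume "N \<le> n"
        then have "enn2real (Lpp (\<lambda>x. z n x - w x)) \<le> (\<epsilon> / 2) powr p"
          using N by (intro enn2real_leI) auto
        then have "(enn2real (Lpp (\<lambda>x. z n x - w x))) powr (1 / p) \<le> ((\<epsilon> / 2) powr p) powr (1 / p)"
          using p_gt_2 by (intro powr_mono2) auto
        then have "Lp_norm p (\<lambda>x. z n x - w x) \<le> \<epsilon> / 2"
          using p_gt_2 \<epsilon> by (simp add: Lp_norm_eq powr_powr)
        moreover have "Lp_norm p (\<lambda>x. z n x - w x) \<ge> 0" by (simp add: Lp_norm_def)
        ultimately show "norm (Lp_norm p (\<lambda>x. z n x - w x) - 0) < \<epsilon>" using \<epsilon> by simp
      qed
    qed
  qed
  \<comment> \<open>v n - w is the limit of the test functions v n - z k, and the energy of the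
    error is that of z k - w.\<close>
  have sobv: "sob (\<lambda>x. v n x - w x)" for n
  proof (rule sob_closed[where u="\<lambda>k x. v n x - z k x"])
    show "sob (\<lambda>x. v n x - z k x)" for k by (rule sob_test[OF test_functions_diff[OF vt z(1)]])
    show "AE x in lborel. (\<lambda>k. v n x - z k x) \<longlonglongrightarrow> v n x - w x"
      using z(2) by eventually_elim (intro tendsto_diff tendsto_const)
    have "E (\<lambda>x. v n x - z k x - (v n x - w x)) = E (\<lambda>x. z k x - w x)" for k
      using E_minus_commute[of w "z k"] by simp
    then show "(\<lambda>k. E (\<lambda>x. v n x - z k x - (v n x - w x))) \<longlonglongrightarrow> 0" using Ezw by simp
  qed measurable
  note blE = E_brezis_lieb[OF _ _ aev vK less_imp_le[OF mRK(3)]]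
  have vfin: "Lpp (v n) < \<infinity>" for n by (simp add: v_def w'(2))
  have v1: "(LINT x|lborel. \<bar>v n x\<bar> powr p) = 1" for n
    using Lp_integrable(2)[OF _ vfin[of n]] by (simp add: v_def w'(2))
  note blp = brezis_lieb[of p v lborel w 1, OF p1 _ _ Lp_integrable(1)[OF _ vfin] _ aev]
  define a where "a n = (LINT x|lborel. \<bar>v n x - w x\<bar> powr p)" for n
  define e where "e n = enn2real (E (\<lambda>x. v n x - w x))" for n
  define y where "y = enn2real (E w)"
  have "(LINT x|lborel. \<bar>w x\<bar> powr p) = A"
    using Lp_integrable(2)[of w] A by simp
  then have "(\<lambda>n. 1 - a n) \<longlonglongrightarrow> A"
    using blp(3) v1 by (simp add: a_def)
  then have alim: "(\<lambda>n. 1 - (1 - a n)) \<longlonglongrightarrow> 1 - A" by (intro tendsto_diff tendsto_const)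
  have elim: "(\<lambda>n. enn2real (E (v n)) - e n) \<longlonglongrightarrow> y" using blE(3) by (simp add: e_def y_def)
  have Slim: "(\<lambda>n. enn2real (E (v n))) \<longlonglongrightarrow> S\<^sub>0"
  proof (rule tendsto_sandwich[of "\<lambda>_. S\<^sub>0" _ _ "\<lambda>n. S\<^sub>0 + 1 / real (Suc n)"])
    show "\<forall>\<^sub>F n in sequentially. S\<^sub>0 \<le> enn2real (E (v n))"
      using w' by (auto simp: v_def intro!: S0_le always_eventually)
    show "\<forall>\<^sub>F n in sequentially. enn2real (E (v n)) \<le> S\<^sub>0 + 1 / real (Suc n)"
    proof (intro always_eventually allI)
      fix n
      have "1 / real (Suc (r n)) \<le> 1 / real (Suc n)" using seq_suble[OF r, of n] by (intro divide_left_mono) auto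
      then show "enn2real (E (v n)) \<le> S\<^sub>0 + 1 / real (Suc n)" using w'(4)[of "r n"] unfolding v_def by linarith
    qed
    have "(\<lambda>n. S\<^sub>0 + 1 / real (Suc n)) \<longlonglongrightarrow> S\<^sub>0 + 0"
      by (intro tendsto_add tendsto_const LIMSEQ_Suc[OF lim_1_over_n])
    then show "(\<lambda>n. S\<^sub>0 + 1 / real (Suc n)) \<longlonglongrightarrow> S\<^sub>0" by simp
  qed simp
  have elim2: "e \<longlonglongrightarrow> S\<^sub>0 - y"
    using tendsto_diff[OF Slim elim] by simp
  have e0: "e n \<ge> 0" for n by (simp add: e_def)
  have "S\<^sub>0 - y \<ge> 0" by (rule LIMSEQ_le_const[OF elim2]) (use e0 in auto)
  moreover have "y \<ge> 0" by (simp add: y_def)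
  \<comment> \<open>The limit of the Sobolev inequality for v n - w: by the two Brezis-Lieb
    statements its mass tends to 1 - A and its energy to \<open>S\<^sub>0 - y\<close>.\<close>
  moreover have "1 - A \<le> ((S\<^sub>0 - y) / S\<^sub>0) powr (p / 2)"
  proof (rule LIMSEQ_le[of a _ "\<lambda>n. (e n / S\<^sub>0) powr (p / 2)"])
    show "a \<longlonglongrightarrow> 1 - A" using alim by simp
    show "(\<lambda>n. (e n / S\<^sub>0) powr (p / 2)) \<longlonglongrightarrow> ((S\<^sub>0 - y) / S\<^sub>0) powr (p / 2)"
      using S0_pos p_gt_2 e0 by (intro tendsto_powr' tendsto_divide elim2 tendsto_const) auto
    have "a n \<le> (e n / S\<^sub>0) powr (p / 2)" for n
    proof -
      have "E (\<lambda>x. v n x - w x) = ennreal (e n)" using blE(2)[of n] by (simp add: e_def)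
      then have "Lpp (\<lambda>x. v n x - w x) \<le> ennreal ((e n / S\<^sub>0) powr (p / 2))"
        using sobv[of n] e0[of n] unfolding sob_def by simp
      then have "enn2real (Lpp (\<lambda>x. v n x - w x)) \<le> (e n / S\<^sub>0) powr (p / 2)" by (intro enn2real_leI) auto
      moreover have "Lpp (\<lambda>x. v n x - w x) < \<infinity>" by (intro Lpp_diff_finite vfin) (auto simp: A)
      ultimately show ?thesis using Lp_integrable(2)[of "\<lambda>x. v n x - w x"] by (simp add: a_def)
    qed
    then show "\<exists>N. \<forall>n\<ge>N. a n \<le> (e n / S\<^sub>0) powr (p / 2)" by blast
  qed
  ultimately have "y \<le> S\<^sub>0 * A powr (2 / p)" using Ap by (intro missing_mass) auto
  then have "ennreal y \<le> ennreal (S\<^sub>0 * A powr (2 / p))" by (rule ennreal_leI)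
  moreover have "E w = ennreal y" using blE(1) by (simp add: y_def)
  ultimately have "E w \<le> ennreal (S\<^sub>0 * A powr (2 / p))" by simp
  with wX Ap A(1) show ?thesis by (intro exI[of _ w] exI[of _ A] conjI)
qed

text \<open>For finite energy this is \<open>sob\<close> with e the energy itself, solved for e; the
  exponents p/2 and 2/p are inverse to each other.\<close>

lemma E_hdot_ge:
  assumes u: "u \<in> hdot_space \<alpha>" and A: "Lpp u = ennreal A" "A > 0"
  shows "ennreal (S\<^sub>0 * A powr (2 / p)) \<le> E u"
proof (cases "E u")
  case (real e)
  have "ennreal A \<le> ennreal ((e / S\<^sub>0) powr (p / 2))"
    using sob_hdot[OF u] real unfolding sob_def A(1) by auto
  then have "A \<le> (e / S\<^sub>0) powr (p / 2)" by (subst (asm) ennreal_le_iff) auto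
  then have "A powr (2 / p) \<le> ((e / S\<^sub>0) powr (p / 2)) powr (2 / p)" using A p_gt_2 by (intro powr_mono2) auto
  then have "A powr (2 / p) \<le> e / S\<^sub>0" using p_gt_2 real S0_pos by (simp add: powr_powr)
  then have "S\<^sub>0 * A powr (2 / p) \<le> e" using S0_pos by (simp add: field_simps)
  then show ?thesis using real by (simp add: ennreal_leI)
qed simp

end

section \<open>The energy as an integral over the sphere\<close>

context levy
begin

interpretation nu: finite_measure \<nu> by (rule finite_nu)
interpretation P1: pair_sigma_finite "lborel :: real measure" \<nu> ..
interpretation P3: pair_sigma_finite "lborel :: 'a measure" \<nu> ..

lemma two_E_iterated:
  assumes [measurable]: "u \<in> borel_measurable borel"
  shows "2 * E u = (\<integral>\<^sup>+x. (\<integral>\<^sup>+r. levy_weight \<alpha> r * (\<integral>\<^sup>+\<theta>. ennreal ((u x - u (x - r *\<^sub>R \<theta>))\<^sup>2) \<partial>\<nu>) \<partial>lborel) \<partial>lborel)"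
proof -
  let ?f = "\<lambda>x r \<theta>. levy_weight \<alpha> r * ennreal ((u x - u (x - r *\<^sub>R \<theta>))\<^sup>2)"
  have "2 * E u = (\<integral>\<^sup>+\<theta>. (\<integral>\<^sup>+r. (\<integral>\<^sup>+x. ?f x r \<theta> \<partial>lborel) \<partial>lborel) \<partial>\<nu>)"
    unfolding two_E ray_energy_def trans_sq_def by (simp add: nn_integral_cmult)
  also have "\<dots> = (\<integral>\<^sup>+\<theta>. (\<integral>\<^sup>+x. (\<integral>\<^sup>+r. ?f x r \<theta> \<partial>lborel) \<partial>lborel) \<partial>\<nu>)"
    by (intro nn_integral_cong lborel_pair.Fubini') measurable
  also have "\<dots> = (\<integral>\<^sup>+x. (\<integral>\<^sup>+\<theta>. (\<integral>\<^sup>+r. ?f x r \<theta> \<partial>lborel) \<partial>\<nu>) \<partial>lborel)"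
    by (rule P3.Fubini') measurable
  also have "\<dots> = (\<integral>\<^sup>+x. (\<integral>\<^sup>+r. (\<integral>\<^sup>+\<theta>. ?f x r \<theta> \<partial>\<nu>) \<partial>lborel) \<partial>lborel)"
    by (intro nn_integral_cong P1.Fubini') measurable
  also have "\<dots> = (\<integral>\<^sup>+x. (\<integral>\<^sup>+r. levy_weight \<alpha> r * (\<integral>\<^sup>+\<theta>. ennreal ((u x - u (x - r *\<^sub>R \<theta>))\<^sup>2) \<partial>\<nu>) \<partial>lborel) \<partial>lborel)"
    by (intro nn_integral_cong nn_integral_cmult) measurable
  finally show ?thesis .
qed

text \<open>The measure on the sphere is carried to the whole space by the inclusion
  \<open>id\<close>, and restricting to r > 0 while dividing by r^(1+\<alpha>) amounts to
  multiplying by \<open>levy_weight\<close>.\<close>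

lemma energy_eq_E:
  assumes [measurable]: "u \<in> borel_measurable borel" and T: "id \<in> measurable \<mu> borel" and \<nu>: "\<nu> = distr \<mu> borel id"
  shows "energy \<mu> \<alpha> u = E u"
proof -
  have inner: "(\<integral>\<^sup>+\<theta>. ennreal (\<bar>u x - u (x - r *\<^sub>R \<theta>)\<bar>\<^sup>2) \<partial>\<mu>) = (\<integral>\<^sup>+\<theta>. ennreal ((u x - u (x - r *\<^sub>R \<theta>))\<^sup>2) \<partial>\<nu>)" for x r
    unfolding \<nu> by (subst nn_integral_distr[OF T]) auto
  have w: "F / ennreal (r powr (1 + \<alpha>)) * indicator {0<..} r = levy_weight \<alpha> r * F" for F and r :: real
  proof (cases "r > 0")
    case True
    have "r powr (- 1 - \<alpha>) = inverse (r powr (1 + \<alpha>))" using powr_minus[of r "1 + \<alpha>"] by (simp add: algebra_simps)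
    then show ?thesis using True by (simp add: levy_weight_def divide_ennreal_def inverse_ennreal mult.commute)
  qed (simp add: levy_weight_def)
  have "energy \<mu> \<alpha> u = 2 * E u / 2"
    unfolding energy_def inner w two_E_iterated[OF assms(1)] ..
  also have "\<dots> = E u" by (subst mult.commute) (simp add: mult_divide_eq_ennreal)
  finally show ?thesis .
qed

end

theorem theorem4p5:
  fixes \<mu> :: "(real ^ 'n) measure" and \<alpha> c\<^sub>0 :: real
  assumes dim: "CARD('n) \<ge> 2"
    and alpha: "0 < \<alpha>" "\<alpha> < 2"
    and borel: "sets \<mu> = sets (restrict_space borel (sphere 0 1))"
    and finite: "finite_measure \<mu>"
    and symmetric: "distr \<mu> \<mu> uminus = \<mu>"
    and nondegenerate: "c\<^sub>0 > 0"
      "(INF \<zeta>\<in>sphere 0 1. LINT \<theta>|\<mu>. \<bar>\<zeta> \<bullet> \<theta>\<bar> powr \<alpha>) \<ge> c\<^sub>0"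
  shows "\<exists>u\<in>nonzero_hdot \<alpha>.
    energy \<mu> \<alpha> u = best_constant \<mu> \<alpha> * ennreal ((Lp_norm (crit_exponent CARD('n) \<alpha>) u)\<^sup>2)"
proof -
  interpret mu: finite_measure \<mu> by (rule finite)
  \<comment> \<open>The image under the inclusion of the sphere: the integrals are the same, but the
    measurable sets are the Borel sets of the whole space, as the locale demands.\<close>
  define \<nu> where "\<nu> = distr \<mu> borel id"
  have sp: "space \<mu> = sphere 0 1"
    using sets_eq_imp_space_eq[OF borel] by (simp add: space_restrict_space)
  have T: "id \<in> measurable \<mu> borel"
    unfolding measurable_cong_sets[OF borel refl] by (intro measurable_restrict_space1) simp
  have nondeg: "ennreal c\<^sub>0 \<le> (\<integral>\<^sup>+\<theta>. ennreal (\<bar>\<zeta> \<bullet> \<theta>\<bar> powr \<alpha>) \<partial>\<nu>)" if \<zeta>: "norm \<zeta> = 1" for \<zeta> :: "real ^ 'n"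
  proof -
    have m: "(\<lambda>\<theta>. \<bar>\<zeta> \<bullet> \<theta>\<bar> powr \<alpha>) \<in> borel_measurable \<mu>"
      using measurable_compose[OF T, of "\<lambda>\<theta>. \<bar>\<zeta> \<bullet> \<theta>\<bar> powr \<alpha>" borel] by simp
    \<comment> \<open>The bound 1 on the sphere makes the Bochner integral of the hypothesis agree
      with the nonnegative integral in which \<open>levy\<close> states non-degeneracy.\<close>
    have int: "integrable \<mu> (\<lambda>\<theta>. \<bar>\<zeta> \<bullet> \<theta>\<bar> powr \<alpha>)"
    proof (rule mu.integrable_const_bound[of _ 1])
      show "AE \<theta> in \<mu>. norm (\<bar>\<zeta> \<bullet> \<theta>\<bar> powr \<alpha>) \<le> 1"
      proof (rule AE_I2)
        fix \<theta> assume "\<theta> \<in> space \<mu>"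
        then have "\<bar>\<zeta> \<bullet> \<theta>\<bar> \<le> 1" using Cauchy_Schwarz_ineq2[of \<zeta> \<theta>] \<zeta> by (simp add: sp)
        then show "norm (\<bar>\<zeta> \<bullet> \<theta>\<bar> powr \<alpha>) \<le> 1" using alpha by (simp add: powr_le1)
      qed
    qed (rule m)
    have "c\<^sub>0 \<le> (INF \<zeta>\<in>sphere 0 1. LINT \<theta>|\<mu>. \<bar>\<zeta> \<bullet> \<theta>\<bar> powr \<alpha>)" by (rule nondegenerate(2))
    also have "\<dots> \<le> (LINT \<theta>|\<mu>. \<bar>\<zeta> \<bullet> \<theta>\<bar> powr \<alpha>)"
      using \<zeta> by (intro cINF_lower bdd_belowI[of _ 0]) auto
    finally have "ennreal c\<^sub>0 \<le> ennreal (LINT \<theta>|\<mu>. \<bar>\<zeta> \<bullet> \<theta>\<bar> powr \<alpha>)" by (rule ennreal_leI)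
    also have "\<dots> = (\<integral>\<^sup>+\<theta>. ennreal (\<bar>\<zeta> \<bullet> \<theta>\<bar> powr \<alpha>) \<partial>\<mu>)"
      using int by (intro nn_integral_eq_integral[symmetric]) auto
    also have "\<dots> = (\<integral>\<^sup>+\<theta>. ennreal (\<bar>\<zeta> \<bullet> \<theta>\<bar> powr \<alpha>) \<partial>\<nu>)"
      unfolding \<nu>_def by (subst nn_integral_distr[OF T]) auto
    finally show ?thesis .
  qed
  have "levy \<nu> \<alpha> c\<^sub>0"
  proof (rule levy.intro)
    show "sets \<nu> = sets borel" by (simp add: \<nu>_def)
    show "finite_measure \<nu>" unfolding \<nu>_def by (rule mu.finite_measure_distr[OF T])
    show "AE \<theta> in \<nu>. norm \<theta> = 1"
      unfolding \<nu>_def by (subst AE_distr_iff[OF T]) (auto simp: sp)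
    show "2 \<le> DIM(real ^ 'n)" using dim by simp
  qed (use alpha nondegenerate(1) nondeg in auto)
  define q where "q = crit_exponent CARD('n) \<alpha>"
  have pc: "crit_exponent DIM(real ^ 'n) \<alpha> = q" by (simp add: q_def)
  interpret levy_critical \<nu> \<alpha> c\<^sub>0 "real DIM(real ^ 'n) - \<alpha>" q
    by (intro levy_critical.intro levy_critical_axioms.intro refl pc[symmetric]) (rule \<open>levy \<nu> \<alpha> c\<^sub>0\<close>)
  have en: "energy \<mu> \<alpha> u = E u" if "u \<in> borel_measurable borel" for u
    by (rule energy_eq_E[OF that T \<nu>_def])
  have hdot_Lp: "u \<in> borel_measurable borel" "Lpp u < \<infinity>" if "u \<in> hdot_space \<alpha>" for u
    using that Lp_functions_iff[of u] unfolding hdot_space_def pc by auto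
  have nrm: "(Lp_norm q u)\<^sup>2 = A powr (2 / q)" if "u \<in> borel_measurable borel" "Lpp u = ennreal A" "A > 0" for u A
    using Lp_norm_eq[OF that(1)] that(2,3) by (simp add: power2_eq_square powr_add[symmetric])
  \<comment> \<open>In the extended reals this cancellation needs a finite positive b. It is
    available because a nonzero element of the space has \<open>Lpp\<close> strictly between 0 and
    infinity.\<close>
  have quot: "ennreal (S\<^sub>0 * b) / ennreal b = ennreal S\<^sub>0" if "b > 0" for b
    using that S0_pos by (simp add: divide_ennreal)
  obtain w A where w: "w \<in> hdot_space \<alpha>" "A > 0" "Lpp w = ennreal A" "E w \<le> ennreal (S\<^sub>0 * A powr (2 / q))"
    using ex_minimizer by blast
  note wb = hdot_Lp(1)[OF w(1)]
  have Ew: "E w = ennreal (S\<^sub>0 * A powr (2 / q))"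
    using E_hdot_ge[OF w(1) w(3,2)] w(4) by (rule antisym[rotated])
  have zero: "Lpp u = 0 \<longleftrightarrow> (AE x in lborel. u x = 0)" if [measurable]: "u \<in> borel_measurable borel" for u
    unfolding Lpp_def by (subst nn_integral_0_iff_AE) (auto simp: ennreal_eq_0_iff)
  have wn: "w \<in> nonzero_hdot \<alpha>"
    using w zero[OF wb] by (auto simp: nonzero_hdot_def)
  have "best_constant \<mu> \<alpha> = ennreal S\<^sub>0"
  proof (rule antisym)
    have "best_constant \<mu> \<alpha> \<le> energy \<mu> \<alpha> w / ennreal ((Lp_norm (crit_exponent DIM(real ^ 'n) \<alpha>) w)\<^sup>2)"
      unfolding best_constant_def by (rule INF_lower[OF wn])
    also have "\<dots> = ennreal S\<^sub>0"
      unfolding pc nrm[OF wb w(3,2)] en[OF wb] Ew using w(2) by (intro quot) simp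
    finally show "best_constant \<mu> \<alpha> \<le> ennreal S\<^sub>0" .
    show "ennreal S\<^sub>0 \<le> best_constant \<mu> \<alpha>"
      unfolding best_constant_def
    proof (rule INF_greatest)
      fix u :: "real ^ 'n \<Rightarrow> real" assume u: "u \<in> nonzero_hdot \<alpha>"
      then have uX: "u \<in> hdot_space \<alpha>" by (simp add: nonzero_hdot_def)
      note ub = hdot_Lp(1)[OF uX]
      define B where "B = enn2real (Lpp u)"
      have "Lpp u \<noteq> 0" using u zero[OF ub] by (simp add: nonzero_hdot_def)
      then have B: "Lpp u = ennreal B" "B > 0"
        using hdot_Lp(2)[OF uX] by (auto simp: B_def enn2real_positive_iff zero_less_iff_neq_zero)
      have "ennreal S\<^sub>0 = ennreal (S\<^sub>0 * B powr (2 / q)) / ennreal (B powr (2 / q))"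
        using B(2) by (intro quot[symmetric]) simp
      also have "\<dots> \<le> E u / ennreal (B powr (2 / q))"
        using E_hdot_ge[OF uX B] by (rule divide_right_mono_ennreal)
      finally show "ennreal S\<^sub>0 \<le> energy \<mu> \<alpha> u / ennreal ((Lp_norm (crit_exponent DIM(real ^ 'n) \<alpha>) u)\<^sup>2)"
        unfolding pc nrm[OF ub B] en[OF ub] .
    qed
  qed
  then have "energy \<mu> \<alpha> w = best_constant \<mu> \<alpha> * ennreal ((Lp_norm q w)\<^sup>2)"
    unfolding en[OF wb] nrm[OF wb w(3,2)] Ew using S0_pos by (simp add: ennreal_mult)
  with wn show ?thesis unfolding q_def by blast
qed

end
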